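(* In the growth curve model $\mathbf{Y}_n = \mathbf{X}\boldsymbol{\Theta}\mathbf{Z}' + \boldsymbol{\mathcal{E}}$, assume that $$\lim_{n\to\infty}\frac{1}{n}(\mathbf{X}'\mathbf{X})=\mathbf{R},$$ where $\mathbf{R}$ is a positive definite matrix. Let $\mathbf{C}$ be a given $s\times m$ real matrix and $\mathbf{D}$ a given $t\times q$ real matrix, let $\boldsymbol{\gamma}=\mathbf{C}\boldsymbol{\Theta}\mathbf{D}'$, and let $$\hat{\boldsymbol{\gamma}}(\mathbf{Y}_n)=\mathbf{C}(\mathbf{X}'\mathbf{X})^{-1}\mathbf{X}'\mathbf{Y}_n\hat{\boldsymbol{\Sigma}}^{-1}(\mathbf{Y}_n)\mathbf{Z}\bigl(\mathbf{Z}'\hat{\boldsymbol{\Sigma}}^{-1}(\mathbf{Y}_n)\mathbf{Z}\bigr)^{-1}\mathbf{D}'.$$ Then, as $n\to\infty$, $\sqrt{n}\,[\hat{\boldsymbol{\gamma}}(\mathbf{Y}_n)-\boldsymbol{\gamma}]$ converges in distribution to $$\mathcal{N}_{s\times t}\Bigl(\mathbf{0},\,(\mathbf{C}\mathbf{R}^{-1}\mathbf{C}')\otimes\bigl(\mathbf{D}(\mathbf{Z}'\boldsymbol{\Sigma}^{-1}\mathbf{Z})^{-1}\mathbf{D}'\bigr)\Bigr).$$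
   Context: Fix positive integers $m$ and $p>q$. For each sample size $n>m$: $\mathbf{X}$ is a known (non-random) $n\times m$ matrix of full rank $m$, depending on $n$ (its rows are added one after another as $n$ grows); $\mathbf{Z}$ is a known $p\times q$ matrix of full rank $q$, not depending on $n$; $\boldsymbol{\Theta}$ is an unknown fixed $m\times q$ real matrix; $\boldsymbol{\Sigma}$ is an unknown fixed positive definite $p\times p$ matrix. The $n\times p$ random error matrix $\boldsymbol{\mathcal{E}}=(\boldsymbol{\mathcal{E}}_1,\ldots,\boldsymbol{\mathcal{E}}_n)'$ has a continuous distribution (not assumed normal) with mean $\mathbf{0}$ and $\operatorname{Cov}(\operatorname{vec}(\boldsymbol{\mathcal{E}}'))=\mathbf{I}_n\otimes\boldsymbol{\Sigma}$, and $\boldsymbol{\mathcal{E}}_1,\ldots,\boldsymbol{\mathcal{E}}_n$ are independent and identically distributed random vectors in $\mathbb{R}^p$ whose common distribution does not depend on $n$. A prime denotes transpose, $\operatorname{vec}$ stacks columns, $\mathbf{A}\otimes\mathbf{B}=(a_{ij}\mathbf{B})$ is the Kronecker product, and $\mathbf{P}_X=\mathbf{X}(\mathbf{X}'\mathbf{X})^{-1}\mathbf{X}'$. The first-stage covariance estimator is $$\hat{\boldsymbol{\Sigma}}(\mathbf{Y}_n)=\mathbf{Y}_n'\mathbf{W}\mathbf{Y}_n,\qquad \mathbf{W}=\frac{1}{n-\operatorname{rank}(\mathbf{X})}(\mathbf{I}_n-\mathbf{P}_X),$$ which is taken to be positive definite with probability 1 (so that $\hat{\boldsymbol{\Sigma}}^{-1}(\mathbf{Y}_n)$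 is defined almost surely). An $s\times t$ random matrix $\mathbf{T}$ has distribution $\mathcal{N}_{s\times t}(\mathbf{0},\mathbf{V})$ if the $st$-dimensional vector $\operatorname{vec}(\mathbf{T}')$ (the rows of $\mathbf{T}$ stacked) is multivariate normal (possibly degenerate) with mean $\mathbf{0}$ and covariance matrix $\mathbf{V}$. *)

theory Defs
  imports "HOL-Probability.Probability"
begin

text \<open>
  A matrix with \<open>n\<close> rows and \<open>CARD('k)\<close> columns, where \<open>n\<close> varies, is given by its rows
  \<open>A 0, \<dots>, A (n - 1)\<close>, so it is a function \<open>A :: nat \<Rightarrow> real^'k\<close> of which only the values below \<open>n\<close>
  matter.  An \<open>n \<times> n\<close> matrix is a function \<open>nat \<Rightarrow> nat \<Rightarrow> real\<close> read in the same way.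
  Matrices of fixed size use the library type \<open>real^'k^'l\<close> (\<open>CARD('l)\<close> rows, \<open>CARD('k)\<close> columns).
\<close>

text \<open>The product \<open>A' B\<close> of an \<open>n \<times> k\<close> matrix transposed and an \<open>n \<times> l\<close> matrix.\<close>

definition tmult :: "nat \<Rightarrow> (nat \<Rightarrow> real^'k) \<Rightarrow> (nat \<Rightarrow> real^'l) \<Rightarrow> real^'l^'k" where
  "tmult n A B = (\<chi> a b. \<Sum>i<n. A i $ a * B i $ b)"

text \<open>The product of an \<open>n \<times> n\<close> matrix and an \<open>n \<times> k\<close> matrix.\<close>

definition sqmult :: "nat \<Rightarrow> (nat \<Rightarrow> nat \<Rightarrow> real) \<Rightarrow> (nat \<Rightarrow> real^'k) \<Rightarrow> nat \<Rightarrow> real^'k" where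
  "sqmult n W A = (\<lambda>i. \<Sum>j<n. W i j *\<^sub>R A j)"

definition rows_rank :: "nat \<Rightarrow> (nat \<Rightarrow> real^'k) \<Rightarrow> nat" where
  "rows_rank n A = dim (A ` {..<n})"

text \<open>Entries of \<open>P\<^sub>X = X (X' X)\<^sup>-\<^sup>1 X'\<close>.\<close>

definition proj_mat :: "nat \<Rightarrow> (nat \<Rightarrow> real^'m) \<Rightarrow> nat \<Rightarrow> nat \<Rightarrow> real" where
  "proj_mat n X = (\<lambda>i j. X i \<bullet> (matrix_inv (tmult n X X) *v X j))"

definition weight_mat :: "nat \<Rightarrow> (nat \<Rightarrow> real^'m) \<Rightarrow> nat \<Rightarrow> nat \<Rightarrow> real" where
  "weight_mat n X =
     (\<lambda>i j. 1 / real (n - rows_rank n X) * ((if i = j then 1 else 0) - proj_mat n X i j))"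

definition Sigma_hat :: "nat \<Rightarrow> (nat \<Rightarrow> real^'m) \<Rightarrow> (nat \<Rightarrow> real^'p) \<Rightarrow> real^'p^'p" where
  "Sigma_hat n X Y = tmult n Y (sqmult n (weight_mat n X) Y)"

definition gamma_hat ::
  "real^'m^'s \<Rightarrow> real^'q^'t \<Rightarrow> real^'q^'p \<Rightarrow> nat \<Rightarrow> (nat \<Rightarrow> real^'m) \<Rightarrow> (nat \<Rightarrow> real^'p) \<Rightarrow> real^'t^'s"
where
  "gamma_hat C D Z n X Y =
     (let Si = matrix_inv (Sigma_hat n X Y) in
      C ** matrix_inv (tmult n X X) ** tmult n X Y ** Si ** Z
        ** matrix_inv (transpose Z ** Si ** Z) ** transpose D)"

definition pos_def :: "real^'k^'k \<Rightarrow> bool" where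
  "pos_def A \<longleftrightarrow> transpose A = A \<and> (\<forall>v. v \<noteq> 0 \<longrightarrow> v \<bullet> (A *v v) > 0)"

text \<open>
  The Kronecker product, with rows and columns indexed by pairs: row \<open>(i, k)\<close> and column \<open>(j, l)\<close>
  hold \<open>A\<^sub>i\<^sub>j B\<^sub>k\<^sub>l\<close>.  The vector \<open>vec(T')\<close> is indexed by pairs in the same way, so that the
  lexicographic order of the pairs gives the usual block matrix and the stacked rows.
\<close>

definition kronecker :: "real^'b^'a \<Rightarrow> real^'d^'c \<Rightarrow> real^('b \<times> 'd)^('a \<times> 'c)" where
  "kronecker A B = (\<chi> r c. A $ fst r $ fst c * B $ snd r $ snd c)"

definition vec_rows :: "real^'t^'s \<Rightarrow> real^('s \<times> 't)" where
  "vec_rows T = (\<chi> r. T $ fst r $ snd r)"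

definition cov :: "'w measure \<Rightarrow> ('w \<Rightarrow> real) \<Rightarrow> ('w \<Rightarrow> real) \<Rightarrow> real" where
  "cov M f g = (\<integral>\<omega>. (f \<omega> - (\<integral>\<omega>. f \<omega> \<partial>M)) * (g \<omega> - (\<integral>\<omega>. g \<omega> \<partial>M)) \<partial>M)"

text \<open>Univariate normal laws, including the point masses (variance 0).\<close>

definition normal_law :: "real measure \<Rightarrow> bool" where
  "normal_law N \<longleftrightarrow>
     (\<exists>\<mu>. N = return borel \<mu> \<or> (\<exists>\<sigma>>0. N = density lborel (\<lambda>x. ennreal (normal_density \<mu> \<sigma> x))))"

text \<open>
  A possibly degenerate multivariate normal law: every linear combination of the coordinates is
  normal.
\<close>

definition multivariate_normal :: "(real^'k) measure \<Rightarrow> real^'k \<Rightarrow> real^'k^'k \<Rightarrow> bool" where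
  "multivariate_normal N \<mu> V \<longleftrightarrow>
     prob_space N \<and> sets N = sets borel \<and>
     (\<forall>a. normal_law (distr N borel (\<lambda>x. a \<bullet> x))) \<and>
     (\<forall>i. (\<integral>x. x $ i \<partial>N) = \<mu> $ i) \<and>
     (\<forall>i j. cov N (\<lambda>x. x $ i) (\<lambda>x. x $ j) = V $ i $ j)"

definition matrix_normal :: "(real^'t^'s) measure \<Rightarrow> real^'t^'s \<Rightarrow> real^('s \<times> 't)^('s \<times> 't) \<Rightarrow> bool"
where
  "matrix_normal N \<mu> V \<longleftrightarrow>
     prob_space N \<and> sets N = sets borel \<and>
     multivariate_normal (distr N borel vec_rows) (vec_rows \<mu>) V"

text \<open>
  Convergence in distribution to a law \<open>N\<close>.  The library has weak convergence only for measures
  on \<open>real\<close>.  Measurability is part of the definition because the Bochner integral of a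
  non-measurable function is 0 by convention.
\<close>

definition converges_in_distribution ::
  "'w measure \<Rightarrow> (nat \<Rightarrow> 'w \<Rightarrow> 'a::euclidean_space) \<Rightarrow> 'a measure \<Rightarrow> bool"
where
  "converges_in_distribution M T N \<longleftrightarrow>
     (\<forall>\<^sub>F n in sequentially. T n \<in> borel_measurable M) \<and>
     (\<forall>f :: 'a \<Rightarrow> real. continuous_on UNIV f \<and> bounded (range f) \<longrightarrow>
        (\<lambda>n. \<integral>\<omega>. f (T n \<omega>) \<partial>M) \<longlonglongrightarrow> (\<integral>x. f x \<partial>N))"

text \<open>
  The assumptions on the error matrices: \<open>\<epsilon> n i\<close> is row \<open>i\<close> of the \<open>n\<close>-row error matrix, \<open>F\<close> is the
  law common to all rows and all \<open>n\<close>.  The covariance clause is the entrywise form of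
  \<open>Cov(vec(E')) = I\<^sub>n \<otimes> \<Sigma>\<close>.  The last clause expresses that the law of the error matrix is continuous
  in the sense of having no atoms; this is the weakest usual meaning and is implied by the existence
  of a density.
\<close>

definition growth_errors ::
  "'w measure \<Rightarrow> nat \<Rightarrow> (nat \<Rightarrow> nat \<Rightarrow> 'w \<Rightarrow> real^'p) \<Rightarrow> (real^'p) measure \<Rightarrow> real^'p^'p \<Rightarrow> bool"
where
  "growth_errors M n \<epsilon> F S \<longleftrightarrow>
     prob_space.indep_vars M (\<lambda>_. borel) (\<epsilon> n) {..<n} \<and>
     (\<forall>i<n. distr M borel (\<epsilon> n i) = F) \<and>
     (\<forall>i<n. \<forall>a. integrable M (\<lambda>\<omega>. (\<epsilon> n i \<omega> $ a)\<^sup>2)) \<and>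
     (\<forall>i<n. \<forall>a. (\<integral>\<omega>. \<epsilon> n i \<omega> $ a \<partial>M) = 0) \<and>
     (\<forall>i<n. \<forall>j<n. \<forall>a b.
        cov M (\<lambda>\<omega>. \<epsilon> n i \<omega> $ a) (\<lambda>\<omega>. \<epsilon> n j \<omega> $ b) = (if i = j then 1 else 0) * S $ a $ b) \<and>
     (\<forall>A :: nat \<Rightarrow> real^'p. measure M {\<omega> \<in> space M. \<forall>i<n. \<epsilon> n i \<omega> = A i} = 0)"

end

(*
  Write E for the error matrix, U = X'E / sqrt n and G(S) = S^-1 Z (Z' S^-1 Z)^-1.  Since Z' G(S) = I,
    sqrt n (gamma_hat - gamma) = C (X'X / n)^-1 U G(Sigma_hat) D'.
  The covariance estimator is n / (n - m) * (E'E / n - U' (X'X / n)^-1 U / n), which tends to Sigma in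
  probability by the weak law of large numbers (truncation, as only second moments exist) and because
  the entries of U are bounded in L^2.  Hence the normalised error differs from the linear statistic
  C R^-1 U G(Sigma) D' by a term that vanishes in probability.  Every linear functional of that
  statistic is a weighted sum of the i.i.d. rows of E in which no single row matters, so its
  characteristic function converges to a Gaussian one; Levy's continuity theorem in several
  dimensions, proved by smoothing test functions with a Gaussian kernel, turns this into convergence
  in distribution.
*)
theory Submission
  imports Defs "HOL-Real_Asymp.Real_Asymp"
begin

section \<open>Characteristic functions and the standard Gaussian law on a Euclidean space\<close>

text \<open>The error matrices of different sample sizes may be coupled in any way, so almost sure
  limits are out of reach: the limit theorems are stated for triangular arrays, in mean or in
  probability. Replacing the estimator by the linear statistic needs only L^2 bounds on
  \<open>U\<close>, not its convergence in law; the two statistics are then compared through their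
  characters, whose difference is bounded and therefore also tends to 0 in mean. The joint law of
  \<open>U\<close> and the covariance estimator never enters. For the continuity theorem the limit
  law is built beforehand, as a linear image of a standard Gaussian matrix. Because it is a
  probability measure, no mass can escape, and tightness of the approximating laws is a consequence
  rather than a hypothesis. The Gaussian is the smoothing kernel because its density is a multiple
  of its own characteristic function, so no inversion formula is needed. Degenerate limits require
  no separate treatment, since a linear image of a Gaussian and its characteristic function make
  sense for singular covariances too.\<close>

definition vchar :: "'a::euclidean_space measure \<Rightarrow> 'a \<Rightarrow> complex" where
  "vchar N t = (CLINT x|N. iexp (t \<bullet> x))"

lemma norm_vchar_le_1:
  assumes "prob_space N"
  shows "cmod (vchar N t) \<le> 1"
proof -
  interpret prob_space N by fact
  have "cmod (vchar N t) \<le> (\<integral>x. cmod (iexp (t \<bullet> x)) \<partial>N)"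
    unfolding vchar_def by (rule integral_norm_bound)
  then show ?thesis by (simp add: prob_space)
qed

text \<open>The product form lets integrals factor over the coordinates; the radial closed form is
  \<open>std_gauss_density_eq\<close>.\<close>

definition std_gauss_density :: "'a::euclidean_space \<Rightarrow> real" where
  "std_gauss_density x = (\<Prod>b\<in>Basis. std_normal_density (x \<bullet> b))"

definition std_gauss :: "'a::euclidean_space measure" where
  "std_gauss = density lborel (\<lambda>x. ennreal (std_gauss_density x))"

lemma std_gauss_density_nonneg [simp]: "0 \<le> std_gauss_density x"
  unfolding std_gauss_density_def by (intro prod_nonneg) simp

lemma std_gauss_density_measurable [measurable]: "std_gauss_density \<in> borel_measurable borel"
  unfolding std_gauss_density_def[abs_def] by measurable

lemma std_gauss_density_eq:
  fixes x :: "'a::euclidean_space"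
  shows "std_gauss_density x = (1 / sqrt (2 * pi)) ^ DIM('a) * exp (- (norm x)\<^sup>2 / 2)"
proof -
  have "std_gauss_density x = (\<Prod>b\<in>(Basis::'a set). 1 / sqrt (2 * pi)) * (\<Prod>b\<in>Basis. exp (- (x \<bullet> b)\<^sup>2 / 2))"
    unfolding std_gauss_density_def std_normal_density_def by (rule prod.distrib)
  also have "(\<Prod>b\<in>Basis. exp (- (x \<bullet> b)\<^sup>2 / 2)) = exp (\<Sum>b\<in>Basis. - (x \<bullet> b)\<^sup>2 / 2)"
    by (simp add: exp_sum)
  also have "(\<Sum>b\<in>Basis. - (x \<bullet> b)\<^sup>2 / 2) = - (norm x)\<^sup>2 / 2"
    unfolding power2_norm_eq_inner euclidean_inner[of x x]
    by (simp add: sum_negf sum_divide_distrib power2_eq_square)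
  finally show ?thesis by simp
qed

lemma sets_std_gauss [simp, measurable_cong]: "sets std_gauss = sets borel"
  by (simp add: std_gauss_def)

lemma space_std_gauss [simp]: "space std_gauss = UNIV"
  by (simp add: std_gauss_def)

lemma prob_space_std_gauss: "prob_space (std_gauss :: 'a::euclidean_space measure)"
proof
  have "(\<integral>\<^sup>+(x::'a). ennreal (std_gauss_density x) \<partial>lborel) =
      (\<integral>\<^sup>+(x::'a). (\<Prod>b\<in>Basis. ennreal (std_normal_density (x \<bullet> b))) \<partial>lborel)"
    unfolding std_gauss_density_def by (simp add: prod_ennreal)
  also have "\<dots> = (\<Prod>b\<in>(Basis::'a set). (\<integral>\<^sup>+x. ennreal (std_normal_density x) \<partial>lborel))"
    by (rule nn_integral_lborel_prod) auto
  also have "(\<integral>\<^sup>+x. ennreal (std_normal_density x) \<partial>lborel) = 1"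
    by (subst nn_integral_eq_integral) auto
  finally show "emeasure (std_gauss :: 'a measure) (space std_gauss) = 1"
    by (simp add: std_gauss_def emeasure_density)
qed

text \<open>\<open>lborel\<close> is the image of a product of one-dimensional Lebesgue measures
  under the map from coordinates to vectors. Complex integrands are needed for characteristic
  functions.\<close>

lemma integral_lborel_prod:
  fixes f :: "'a::euclidean_space \<Rightarrow> real \<Rightarrow> complex"
  assumes "\<And>b. b \<in> Basis \<Longrightarrow> integrable lborel (f b)"
  shows "(\<integral>x. (\<Prod>b\<in>Basis. f b (x \<bullet> b)) \<partial>lborel) = (\<Prod>b\<in>Basis. \<integral>u. f b u \<partial>lborel)"
proof -
  interpret product_sigma_finite "\<lambda>_::'a. lborel :: real measure" ..
  have m: "(\<lambda>x. f b (x \<bullet> b)) \<in> borel_measurable borel" if "b \<in> Basis" for b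
    using borel_measurable_integrable[OF assms[OF that]] by measurable
  have "(\<integral>x. (\<Prod>b\<in>Basis. f b (x \<bullet> b)) \<partial>lborel) =
      (\<integral>x. (\<Prod>b\<in>Basis. f b ((\<Sum>b'\<in>Basis. x b' *\<^sub>R b') \<bullet> b)) \<partial>(\<Pi>\<^sub>M b\<in>Basis. lborel))"
    by (subst lborel_eq, subst integral_distr) (auto intro!: borel_measurable_prod m)
  also have "\<dots> = (\<integral>x. (\<Prod>b\<in>Basis. f b (x b)) \<partial>(\<Pi>\<^sub>M b\<in>Basis. lborel))"
    by (intro Bochner_Integration.integral_cong refl prod.cong) simp
  also have "\<dots> = (\<Prod>b\<in>Basis. \<integral>u. f b u \<partial>lborel)"
    by (rule product_integral_prod) (auto intro: assms)
  finally show ?thesis .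
qed

lemma vchar_std_gauss:
  fixes t :: "'a::euclidean_space"
  shows "vchar std_gauss t = complex_of_real (exp (- (norm t)\<^sup>2 / 2))"
proof -
  let ?f = "\<lambda>b u. complex_of_real (std_normal_density u) * iexp ((t \<bullet> b) * u)"
  interpret std: real_distribution std_normal_distribution by (rule real_dist_normal_dist)
  have int: "integrable lborel (?f b)" for b
    by (rule Bochner_Integration.integrable_bound[of _ std_normal_density]) (auto simp: norm_mult)
  have ch: "(\<integral>u. ?f b u \<partial>lborel) = char std_normal_distribution (t \<bullet> b)" for b
    unfolding char_def
    by (subst integral_density) (auto simp: scaleR_conv_of_real)
  have "vchar std_gauss t = (\<integral>x. std_gauss_density x *\<^sub>R iexp (t \<bullet> x) \<partial>lborel)"
    unfolding vchar_def std_gauss_def by (subst integral_density) auto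
  also have "\<dots> = (\<integral>x. (\<Prod>b\<in>Basis. ?f b (x \<bullet> b)) \<partial>lborel)"
  proof (intro Bochner_Integration.integral_cong refl)
    fix x :: 'a
    have "iexp (t \<bullet> x) = (\<Prod>b\<in>Basis. iexp ((t \<bullet> b) * (x \<bullet> b)))"
      by (subst euclidean_inner) (simp add: exp_sum sum_distrib_left)
    then show "std_gauss_density x *\<^sub>R iexp (t \<bullet> x) = (\<Prod>b\<in>Basis. ?f b (x \<bullet> b))"
      by (simp add: std_gauss_density_def scaleR_conv_of_real prod.distrib)
  qed
  also have "\<dots> = (\<Prod>b\<in>Basis. char std_normal_distribution (t \<bullet> b))"
    by (simp only: integral_lborel_prod[OF int] ch)
  also have "\<dots> = complex_of_real (\<Prod>b\<in>Basis. exp (- (t \<bullet> b)\<^sup>2 / 2))"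
    by (simp add: char_std_normal_distribution)
  also have "(\<Prod>b\<in>Basis. exp (- (t \<bullet> b)\<^sup>2 / 2)) = exp (\<Sum>b\<in>Basis. - (t \<bullet> b)\<^sup>2 / 2)"
    by (simp add: exp_sum)
  also have "(\<Sum>b\<in>Basis. - (t \<bullet> b)\<^sup>2 / 2) = - (norm t)\<^sup>2 / 2"
    unfolding power2_norm_eq_inner euclidean_inner[of t t]
    by (simp add: sum_negf sum_divide_distrib power2_eq_square)
  finally show ?thesis .
qed

section \<open>Levy's continuity theorem on a Euclidean space\<close>

definition gauss_const :: "'a::euclidean_space itself \<Rightarrow> real" where
  "gauss_const _ = (1 / sqrt (2 * pi)) ^ DIM('a)"

lemma gauss_const_bounds: "0 < gauss_const TYPE('a::euclidean_space)" "gauss_const TYPE('a) \<le> 1"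
proof -
  have "1 \<le> sqrt (2 * pi)" using pi_ge_two by (auto intro!: real_le_rsqrt)
  then show "gauss_const TYPE('a) \<le> 1" unfolding gauss_const_def by (intro power_le_one) auto
qed (simp add: gauss_const_def)

text \<open>Self-duality of the Gaussian: this is what turns smoothing with the density into a
  statement about characteristic functions.\<close>

lemma std_gauss_density_vchar:
  fixes x :: "'a::euclidean_space"
  shows "complex_of_real (std_gauss_density x) = gauss_const TYPE('a) * vchar std_gauss x"
  unfolding gauss_const_def vchar_std_gauss std_gauss_density_eq by simp

lemma std_gauss_density_le_1: "std_gauss_density (x :: 'a::euclidean_space) \<le> 1"
  unfolding std_gauss_density_eq
  using gauss_const_bounds[where 'a='a, unfolded gauss_const_def] by (intro mult_le_one) auto

lemma vchar_measurable [measurable]: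
  assumes "prob_space N" and [measurable_cong]: "sets N = sets borel"
  shows "vchar N \<in> borel_measurable borel"
proof -
  interpret prob_space N by fact
  show ?thesis unfolding vchar_def[abs_def] by measurable
qed

text \<open>The kernel is an average of characters over a Gaussian frequency, and Fubini exchanges
  that average with \<open>N\<close>. Hence kernel expectations depend on \<open>N\<close> only
  through \<open>vchar N\<close>.\<close>

lemma expectation_gauss_kernel:
  fixes N :: "'a::euclidean_space measure"
  assumes "prob_space N" and sets [measurable_cong, simp]: "sets N = sets borel"
  shows "complex_of_real (\<integral>x. std_gauss_density (h *\<^sub>R (y - x)) \<partial>N) =
    gauss_const TYPE('a) * (CLINT t|std_gauss. iexp (h * (t \<bullet> y)) * vchar N (- h *\<^sub>R t))"
proof -
  interpret N: prob_space N by fact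
  interpret G: prob_space "std_gauss :: 'a measure" by (rule prob_space_std_gauss)
  interpret P: pair_prob_space N "std_gauss :: 'a measure" ..
  let ?f = "\<lambda>x t. iexp (t \<bullet> (h *\<^sub>R (y - x)))"
  have "complex_of_real (\<integral>x. std_gauss_density (h *\<^sub>R (y - x)) \<partial>N) =
      (\<integral>x. complex_of_real (std_gauss_density (h *\<^sub>R (y - x))) \<partial>N)"
    by (rule integral_complex_of_real[symmetric])
  also have "\<dots> = gauss_const TYPE('a) * (\<integral>x. (\<integral>t. ?f x t \<partial>std_gauss) \<partial>N)"
    unfolding std_gauss_density_vchar vchar_def by (simp add: inner_commute)
  also have "(\<integral>x. (\<integral>t. ?f x t \<partial>std_gauss) \<partial>N) = (\<integral>t. (\<integral>x. ?f x t \<partial>N) \<partial>std_gauss)"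
    by (rule P.Fubini_integral[symmetric])
      (rule P.integrable_const_bound[of _ 1], auto simp: split_beta')
  also have "(\<lambda>t. (\<integral>x. ?f x t \<partial>N)) = (\<lambda>t. iexp (h * (t \<bullet> y)) * vchar N (- h *\<^sub>R t))"
  proof
    fix t
    have "?f x t = iexp (h * (t \<bullet> y)) * iexp ((- h *\<^sub>R t) \<bullet> x)" for x
      by (simp add: exp_add[symmetric] algebra_simps inner_diff_right)
    then show "(\<integral>x. ?f x t \<partial>N) = iexp (h * (t \<bullet> y)) * vchar N (- h *\<^sub>R t)"
      by (simp add: vchar_def)
  qed
  finally show ?thesis .
qed

text \<open>Characteristic functions are bounded by 1, which is integrable over the Gaussian
  frequency, so pointwise convergence passes through the integral of
  \<open>expectation_gauss_kernel\<close>.\<close>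

lemma tendsto_expectation_gauss_kernel:
  fixes N :: "'a::euclidean_space measure"
  assumes "\<And>n. prob_space (\<nu> n)" and sets: "\<And>n. sets (\<nu> n) = sets borel"
    and "prob_space N" "sets N = sets borel"
    and lim: "\<And>t. (\<lambda>n. vchar (\<nu> n) t) \<longlonglongrightarrow> vchar N t"
  shows "(\<lambda>n. \<integral>x. std_gauss_density (h *\<^sub>R (y - x)) \<partial>\<nu> n) \<longlonglongrightarrow> (\<integral>x. std_gauss_density (h *\<^sub>R (y - x)) \<partial>N)"
proof -
  interpret G: prob_space "std_gauss :: 'a measure" by (rule prob_space_std_gauss)
  note [measurable] = vchar_measurable[OF assms(1,2)] vchar_measurable[OF assms(3,4)]
  have "(\<lambda>n. CLINT t|std_gauss. iexp (h * (t \<bullet> y)) * vchar (\<nu> n) (- h *\<^sub>R t)) \<longlonglongrightarrow>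
      (CLINT t|std_gauss. iexp (h * (t \<bullet> y)) * vchar N (- h *\<^sub>R t))"
    by (rule integral_dominated_convergence[where w = "\<lambda>_. 1"])
      (auto intro!: tendsto_intros lim simp: norm_mult norm_vchar_le_1 assms(1))
  then have "(\<lambda>n. complex_of_real (\<integral>x. std_gauss_density (h *\<^sub>R (y - x)) \<partial>\<nu> n)) \<longlonglongrightarrow>
      complex_of_real (\<integral>x. std_gauss_density (h *\<^sub>R (y - x)) \<partial>N)"
    unfolding expectation_gauss_kernel[OF assms(1,2)] expectation_gauss_kernel[OF assms(3,4)]
    by (intro tendsto_intros)
  then show ?thesis by (simp only: tendsto_of_real_iff)
qed

text \<open>Substitute y = x + z / \<open>h\<close>. Here \<open>h\<close> is an inverse bandwidth:
  the larger it is, the smaller the random perturbation of \<open>x\<close>.\<close>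

lemma integral_std_gauss_affine:
  fixes f :: "'a::euclidean_space \<Rightarrow> real"
  assumes "h > 0" and [measurable]: "f \<in> borel_measurable borel"
  shows "(\<integral>z. f (x + (1 / h) *\<^sub>R z) \<partial>std_gauss) =
    h ^ DIM('a) * (\<integral>y. f y * std_gauss_density (h *\<^sub>R (y - x)) \<partial>lborel)"
proof -
  have "(\<integral>y. f y * std_gauss_density (h *\<^sub>R (y - x)) \<partial>lborel) =
      (\<integral>y. f y * std_gauss_density (h *\<^sub>R (y - x))
        \<partial>density (distr lborel borel (\<lambda>z. x + (1 / h) *\<^sub>R z)) (\<lambda>_. ennreal (\<bar>1 / h\<bar> ^ DIM('a))))"
    using assms(1) by (subst lborel_affine[of "1 / h" x]) auto
  also have "\<dots> = (1 / h) ^ DIM('a) * (\<integral>z. std_gauss_density z * f (x + (1 / h) *\<^sub>R z) \<partial>lborel)"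
    using assms(1) by (simp add: integral_density integral_distr mult.commute)
  also have "(\<integral>z. std_gauss_density z * f (x + (1 / h) *\<^sub>R z) \<partial>lborel) =
      (\<integral>z. f (x + (1 / h) *\<^sub>R z) \<partial>std_gauss)"
    unfolding std_gauss_def by (subst integral_density) auto
  finally show ?thesis
    using assms(1) by (simp add: power_one_over)
qed

text \<open>Tightness of a single law, by continuity from above along sets that decrease to the
  empty set.\<close>

lemma (in prob_space) prob_norm_gt_less:
  fixes X :: "'a \<Rightarrow> 'b::real_normed_vector"
  assumes [measurable]: "(\<lambda>x. norm (X x)) \<in> borel_measurable M" and "0 < e"
  obtains L :: nat where "prob {x\<in>space M. real L < norm (X x)} < e"
proof -
  have "(\<lambda>L::nat. prob {x\<in>space M. real L < norm (X x)}) \<longlonglongrightarrow> prob (\<Inter>L::nat. {x\<in>space M. real L < norm (X x)})"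
    by (rule finite_Lim_measure_decseq) (auto simp: decseq_def)
  also have "(\<Inter>L::nat. {x\<in>space M. real L < norm (X x)}) = {}"
    by auto (metis reals_Archimedean2 order_less_asym)
  finally have "(\<lambda>L::nat. prob {x\<in>space M. real L < norm (X x)}) \<longlonglongrightarrow> 0" by simp
  from order_tendstoD(2)[OF this \<open>0 < e\<close>] show ?thesis
    using that by (auto simp: eventually_sequentially)
qed

text \<open>A small Gaussian perturbation changes \<open>f\<close> little by uniform continuity; a
  large one is improbable and costs at most twice the bound of \<open>f\<close>.\<close>

lemma gauss_smoothing_close:
  fixes f :: "'a::euclidean_space \<Rightarrow> real"
  assumes uc: "uniformly_continuous_on UNIV f" and B: "\<And>x. \<bar>f x\<bar> \<le> B" and "0 < e"
  obtains h where "0 < h" "\<And>x. \<bar>(\<integral>z. f (x + (1 / h) *\<^sub>R z) \<partial>std_gauss) - f x\<bar> \<le> e"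
proof -
  interpret G: prob_space "std_gauss :: 'a measure" by (rule prob_space_std_gauss)
  have [measurable]: "f \<in> borel_measurable borel"
    using uniformly_continuous_imp_continuous[OF uc] by (rule borel_measurable_continuous_onI)
  have "0 \<le> B" using B[of 0] by linarith
  obtain d where d: "0 < d" "\<And>x y. dist y x < d \<Longrightarrow> dist (f y) (f x) < e / 2"
    using uc[unfolded uniformly_continuous_on_def, rule_format, of "e / 2"] \<open>0 < e\<close> by auto
  \<comment> \<open>The tail will be weighted by 2 * \<open>B\<close>, which makes it at most
    \<open>e / 2\<close>; the summand 1 keeps the denominator positive when \<open>B\<close> =
    0.\<close>
  obtain L :: nat where L: "G.prob {z\<in>space std_gauss. real L < norm z} < e / (4 * B + 1)"
    using G.prob_norm_gt_less[of "\<lambda>x. x" "e / (4 * B + 1)"] \<open>0 < e\<close> \<open>0 \<le> B\<close> by auto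
  \<comment> \<open>With this choice norm z <= \<open>L\<close> forces norm z / \<open>h\<close> <
    \<open>d\<close>, the scale of uniform continuity.\<close>
  define h where "h = (real L + 1) / d"
  have h: "0 < h" using d by (simp add: h_def)
  let ?A = "{z :: 'a. real L < norm z}"
  have L': "G.prob ?A < e / (4 * B + 1)" using L by simp
  have "\<bar>(\<integral>z. f (x + (1 / h) *\<^sub>R z) \<partial>std_gauss) - f x\<bar> \<le> e" for x
  proof -
    have int: "integrable std_gauss (\<lambda>z. f (x + (1 / h) *\<^sub>R z))"
      by (rule G.integrable_const_bound[of _ B]) (use B in auto)
    have pt: "\<bar>f (x + (1 / h) *\<^sub>R z) - f x\<bar> \<le> e / 2 + 2 * B * indicator ?A z" for z
    proof (cases "z \<in> ?A")
      case True
      then show ?thesis using B[of x] B[of "x + (1 / h) *\<^sub>R z"] \<open>0 < e\<close> by simp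
    next
      case False
      have "norm z / h < d"
        using False h d(1) by (simp add: h_def field_simps) (smt (verit) mult_left_mono)
      then have "dist (x + (1 / h) *\<^sub>R z) x < d"
        using h by (simp add: dist_norm)
      from d(2)[OF this] False show ?thesis by (simp add: dist_real_def)
    qed
    have "\<bar>(\<integral>z. f (x + (1 / h) *\<^sub>R z) \<partial>std_gauss) - f x\<bar> =
        \<bar>\<integral>z. f (x + (1 / h) *\<^sub>R z) - f x \<partial>std_gauss\<bar>"
      using int by (subst Bochner_Integration.integral_diff) (auto simp: G.prob_space[simplified])
    also have "\<dots> \<le> (\<integral>z. \<bar>f (x + (1 / h) *\<^sub>R z) - f x\<bar> \<partial>std_gauss)"
      by (rule integral_abs_bound)
    also have "\<dots> \<le> (\<integral>z. e / 2 + 2 * B * indicator ?A z \<partial>std_gauss)"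
      using int by (intro integral_mono pt) (auto simp: G.emeasure_eq_measure)
    also have "\<dots> = e / 2 + 2 * B * G.prob ?A"
      by (subst Bochner_Integration.integral_add)
        (auto simp: G.prob_space[simplified] G.emeasure_eq_measure)
    also have "2 * B * G.prob ?A \<le> 2 * B * (e / (4 * B + 1))"
      using L' \<open>0 \<le> B\<close> by (intro mult_left_mono) auto
    also have "\<dots> \<le> e / 2" using \<open>0 \<le> B\<close> \<open>0 < e\<close> by (simp add: field_simps)
    finally show ?thesis by simp
  qed
  with h that show ?thesis by blast
qed

text \<open>\<open>f\<close> is replaced by its Gaussian smoothing \<open>g\<close>, uniformly close
  to it, and the integral of \<open>g\<close> is a Lebesgue integral of \<open>f\<close> against
  kernel expectations, which converge. Compact support makes \<open>f\<close> uniformly continuous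
  for the first step and Lebesgue integrable for the second.\<close>

lemma vchar_conv_imp_conv_compact_support:
  fixes N :: "'a::euclidean_space measure" and f :: "'a \<Rightarrow> real"
  assumes prob: "\<And>n. prob_space (\<nu> n)" and sets [measurable_cong, simp]: "\<And>n. sets (\<nu> n) = sets borel"
    and probN: "prob_space N" and setsN [measurable_cong, simp]: "sets N = sets borel"
    and lim: "\<And>t. (\<lambda>n. vchar (\<nu> n) t) \<longlonglongrightarrow> vchar N t"
    and cont: "continuous_on UNIV f" and K: "compact K" "\<And>x. x \<notin> K \<Longrightarrow> f x = 0"
  shows "(\<lambda>n. \<integral>x. f x \<partial>\<nu> n) \<longlonglongrightarrow> (\<integral>x. f x \<partial>N)"
proof (rule LIMSEQ_I)
  fix r :: real assume "0 < r"
  interpret N: prob_space N by fact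
  have [measurable]: "f \<in> borel_measurable borel"
    using cont by (rule borel_measurable_continuous_onI)
  obtain B where B: "\<And>x. \<bar>f x\<bar> \<le> B"
  proof -
    have "compact (f ` K)" using K cont by (meson compact_continuous_image continuous_on_subset subset_UNIV)
    then obtain B where "\<And>x. x \<in> K \<Longrightarrow> \<bar>f x\<bar> \<le> B" by (fastforce dest!: compact_imp_bounded simp: bounded_iff)
    then have "\<bar>f x\<bar> \<le> \<bar>B\<bar>" for x using K(2)[of x] by (cases "x \<in> K") fastforce+
    then show ?thesis using that by blast
  qed
  have uc: "uniformly_continuous_on UNIV f"
  proof -
    obtain L where L: "K \<subseteq> cball 0 L"
      using compact_imp_bounded[OF K(1)] unfolding bounded_pos by (metis mem_cball_0 subsetI)
    have "uniformly_continuous_on (cball 0 (L + 1)) f"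
      using cont by (intro compact_uniformly_continuous) (auto intro: continuous_on_subset)
    then have *: "\<exists>d>0. \<forall>x\<in>cball 0 (L + 1). \<forall>y\<in>cball 0 (L + 1). dist y x < d \<longrightarrow> dist (f y) (f x) < e" if "0 < e" for e
      using that unfolding uniformly_continuous_on_def by blast
    show ?thesis unfolding uniformly_continuous_on_def
    proof (intro allI impI)
      fix e :: real assume "0 < e"
      from *[OF this] obtain d where d: "0 < d"
        "\<And>x y. x \<in> cball 0 (L + 1) \<Longrightarrow> y \<in> cball 0 (L + 1) \<Longrightarrow> dist y x < d \<Longrightarrow> dist (f y) (f x) < e" by blast
      \<comment> \<open>The cap 1 on the distance puts both points into the enlarged ball as soon as
        one of them lies in \<open>K\<close>; if neither does, both values are 0.\<close>
      have "dist (f y) (f x) < e" if "dist y x < min d 1" for x y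
      proof (cases "x \<in> K \<or> y \<in> K")
        case True
        have "norm x \<le> norm y + dist y x" "norm y \<le> norm x + dist y x"
          using norm_triangle_ineq2[of x y] norm_triangle_ineq2[of y x] by (simp_all add: dist_norm norm_minus_commute)
        then have "x \<in> cball 0 (L + 1) \<and> y \<in> cball 0 (L + 1)"
          using True L that by auto
        then show ?thesis using d(2) that by simp
      qed (use K(2) \<open>0 < e\<close> in auto)
      then show "\<exists>d>0. \<forall>x\<in>UNIV. \<forall>x'\<in>UNIV. dist x' x < d \<longrightarrow> dist (f x') (f x) < e"
        using d(1) by (intro exI[of _ "min d 1"]) auto
    qed
  qed
  have intf: "integrable lborel f"
  proof -
    have "integrable lborel (\<lambda>x. indicator K x *\<^sub>R f x)"
      using K(1) cont by (intro borel_integrable_compact) (auto intro: continuous_on_subset)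
    moreover have "(\<lambda>x. indicator K x *\<^sub>R f x) = f" by (rule ext) (auto simp: indicator_def K(2))
    ultimately show ?thesis by simp
  qed
  \<comment> \<open>The smoothing error is paid twice, for \<open>\<nu> n\<close> and for
    \<open>N\<close>, which leaves \<open>r / 2\<close> for the convergence of the smoothed
    integrals.\<close>
  obtain h where h: "0 < h" "\<And>x. \<bar>(\<integral>z. f (x + (1 / h) *\<^sub>R z) \<partial>std_gauss) - f x\<bar> \<le> r / 4"
    using gauss_smoothing_close[OF uc B, of "r / 4"] \<open>0 < r\<close> by auto
  define g where "g x = (\<integral>z. f (x + (1 / h) *\<^sub>R z) \<partial>std_gauss)" for x
  have g: "g x = h ^ DIM('a) * (\<integral>y. f y * std_gauss_density (h *\<^sub>R (y - x)) \<partial>lborel)" for x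
    unfolding g_def by (rule integral_std_gauss_affine) (use h in auto)
  have [measurable]: "g \<in> borel_measurable borel"
    unfolding g[abs_def] by measurable
  have gB: "\<bar>g x\<bar> \<le> B + r / 4" for x
    using h(2)[of x, folded g_def] B[of x] by linarith
  \<comment> \<open>After Fubini the measure enters only through kernel expectations at a fixed
    point \<open>y\<close>, and these lie in [0, 1], so the integrable function
    \<open>\<bar>f y\<bar>\<close> dominates.\<close>
  have swap: "(\<integral>x. g x \<partial>\<mu>) = h ^ DIM('a) * (\<integral>y. f y * (\<integral>x. std_gauss_density (h *\<^sub>R (y - x)) \<partial>\<mu>) \<partial>lborel)"
    if "prob_space \<mu>" and [measurable_cong, simp]: "sets \<mu> = sets borel" for \<mu>
  proof -
    interpret \<mu>: prob_space \<mu> by fact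
    interpret P: pair_sigma_finite lborel \<mu> ..
    have "integrable (lborel \<Otimes>\<^sub>M \<mu>) (\<lambda>(y, x). f y * std_gauss_density (h *\<^sub>R (y - x)))"
    proof (rule Bochner_Integration.integrable_bound)
      show "integrable (lborel \<Otimes>\<^sub>M \<mu>) (\<lambda>(y, x). f y)"
        by (rule P.Fubini_integrable) (use intf \<mu>.prob_space sets_eq_imp_space_eq[OF \<open>sets \<mu> = sets borel\<close>] in auto)
      show "AE p in lborel \<Otimes>\<^sub>M \<mu>. norm (case p of (y, x) \<Rightarrow> f y * std_gauss_density (h *\<^sub>R (y - x)))
          \<le> norm (case p of (y, x) \<Rightarrow> f y)"
        by (intro AE_I2) (auto simp: abs_mult intro!: mult_left_le std_gauss_density_le_1)
    qed measurable
    from P.Fubini_integral[OF this] show ?thesis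
      by (simp add: g)
  qed
  have "(\<lambda>n. \<integral>x. g x \<partial>\<nu> n) \<longlonglongrightarrow> (\<integral>x. g x \<partial>N)"
    unfolding swap[OF prob sets] swap[OF probN setsN]
  proof (intro tendsto_intros integral_dominated_convergence[where w = "\<lambda>y. \<bar>f y\<bar>"] AE_I2)
    have meas: "(\<lambda>y. \<integral>x. std_gauss_density (h *\<^sub>R (y - x)) \<partial>\<mu>) \<in> borel_measurable borel"
      if "prob_space \<mu>" and [measurable_cong]: "sets \<mu> = sets borel" for \<mu> :: "'a measure"
    proof -
      interpret prob_space \<mu> by fact
      show ?thesis by measurable
    qed
    note [measurable] = meas[OF prob sets] meas[OF probN setsN]
    show "(\<lambda>y. f y * (\<integral>x. std_gauss_density (h *\<^sub>R (y - x)) \<partial>N)) \<in> borel_measurable lborel"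
      "(\<lambda>y. f y * (\<integral>x. std_gauss_density (h *\<^sub>R (y - x)) \<partial>\<nu> n)) \<in> borel_measurable lborel" for n
      by measurable
    show "norm (f y * (\<integral>x. std_gauss_density (h *\<^sub>R (y - x)) \<partial>\<nu> n)) \<le> \<bar>f y\<bar>" for n y
    proof -
      interpret n: prob_space "\<nu> n" by fact
      have "\<bar>\<integral>x. std_gauss_density (h *\<^sub>R (y - x)) \<partial>\<nu> n\<bar> \<le> (\<integral>x. 1 \<partial>\<nu> n)"
        by (intro order_trans[OF integral_abs_bound] integral_mono n.integrable_const_bound[of _ 1])
          (auto simp: std_gauss_density_le_1)
      then show ?thesis by (auto simp: abs_mult n.prob_space intro!: mult_left_le)
    qed
  qed (use intf in \<open>auto intro: tendsto_expectation_gauss_kernel[OF prob sets probN setsN lim]\<close>)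
  from LIMSEQ_D[OF this, of "r / 2"] \<open>0 < r\<close> obtain n0 where
    n0: "\<And>n. n \<ge> n0 \<Longrightarrow> \<bar>(\<integral>x. g x \<partial>\<nu> n) - (\<integral>x. g x \<partial>N)\<bar> < r / 2" by auto
  have close: "\<bar>(\<integral>x. f x \<partial>\<mu>) - (\<integral>x. g x \<partial>\<mu>)\<bar> \<le> r / 4"
    if "prob_space \<mu>" and [measurable_cong, simp]: "sets \<mu> = sets borel" for \<mu> :: "'a measure"
  proof -
    interpret \<mu>: prob_space \<mu> by fact
    have i: "integrable \<mu> f" "integrable \<mu> g"
      by (rule \<mu>.integrable_const_bound[of _ B], simp_all add: B)
        (rule \<mu>.integrable_const_bound[of _ "B + r / 4"], simp_all add: gB)
    have "\<bar>(\<integral>x. f x \<partial>\<mu>) - (\<integral>x. g x \<partial>\<mu>)\<bar> = \<bar>\<integral>x. f x - g x \<partial>\<mu>\<bar>" using i by simp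
    also have "\<dots> \<le> (\<integral>x. \<bar>f x - g x\<bar> \<partial>\<mu>)" by (rule integral_abs_bound)
    also have "\<dots> \<le> (\<integral>x. r / 4 \<partial>\<mu>)"
      using i h(2)[folded g_def] by (intro integral_mono) (auto simp: abs_minus_commute)
    finally show ?thesis by (simp add: \<mu>.prob_space)
  qed
  show "\<exists>n0. \<forall>n\<ge>n0. norm ((\<integral>x. f x \<partial>\<nu> n) - (\<integral>x. f x \<partial>N)) < r"
  proof (intro exI allI impI)
    fix n assume "n0 \<le> n"
    then show "norm ((\<integral>x. f x \<partial>\<nu> n) - (\<integral>x. f x \<partial>N)) < r"
      using n0[of n] close[OF prob[of n] sets] close[OF probN setsN] by (simp add: abs_if split: if_splits)
  qed
qed


text \<open>A cutoff \<open>c\<close> reduces bounded \<open>f\<close> to compact support. The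
  integral of \<open>c\<close> itself converges, so the concentration of \<open>N\<close> on a ball
  carries over to \<open>\<nu> n\<close> for large \<open>n\<close>; this yields the tightness that
  bounds the loss caused by the cutoff.\<close>

theorem vchar_conv_imp_expectation_conv:
  fixes N :: "'a::euclidean_space measure" and f :: "'a \<Rightarrow> real"
  assumes prob: "\<And>n. prob_space (\<nu> n)" and sets [measurable_cong, simp]: "\<And>n. sets (\<nu> n) = sets borel"
    and probN: "prob_space N" and setsN [measurable_cong, simp]: "sets N = sets borel"
    and lim: "\<And>t. (\<lambda>n. vchar (\<nu> n) t) \<longlonglongrightarrow> vchar N t"
    and cont: "continuous_on UNIV f" and B: "bounded (range f)"
  shows "(\<lambda>n. \<integral>x. f x \<partial>\<nu> n) \<longlonglongrightarrow> (\<integral>x. f x \<partial>N)"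
proof (rule LIMSEQ_I)
  fix r :: real assume "0 < r"
  interpret N: prob_space N by fact
  have sp [simp]: "space N = UNIV" "space (\<nu> n) = UNIV" for n
    using sets_eq_imp_space_eq[OF setsN] sets_eq_imp_space_eq[OF sets] by auto
  have [measurable]: "f \<in> borel_measurable borel"
    using cont by (rule borel_measurable_continuous_onI)
  obtain B where B: "0 < B" "\<And>x. \<bar>f x\<bar> \<le> B"
    using B by (auto simp: bounded_pos)
  \<comment> \<open>Budget: \<open>r / 2\<close> for the truncated integrals, and
    \<open>B * e\<close> = \<open>r / 8\<close> from each of the two limit laws' bounds on a single
    cutoff error, one for \<open>\<nu> n\<close> and one for \<open>N\<close>.\<close>
  define e where "e = r / (8 * B)"
  have "0 < e" using B \<open>0 < r\<close> by (simp add: e_def)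
  obtain L :: nat where L: "N.prob {x\<in>space N. real L < norm x} < e"
    using N.prob_norm_gt_less[of "\<lambda>x. x" e] \<open>0 < e\<close> by auto
  \<comment> \<open>Equal to 1 on the ball of radius \<open>L\<close>, to 0 outside the ball of
    radius \<open>L\<close> + 1, and continuous in between.\<close>
  define c where "c x = max 0 (min 1 (real L + 1 - norm x))" for x :: 'a
  have c: "0 \<le> c x" "c x \<le> 1" for x by (auto simp: c_def)
  have c0: "c x = 0" if "x \<notin> cball 0 (real L + 1)" for x using that by (simp add: c_def)
  have contc: "continuous_on UNIV c" unfolding c_def[abs_def] by (intro continuous_intros)
  then have [measurable]: "c \<in> borel_measurable borel" by (rule borel_measurable_continuous_onI)
  have limc: "(\<lambda>n. \<integral>x. c x \<partial>\<nu> n) \<longlonglongrightarrow> (\<integral>x. c x \<partial>N)"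
    by (rule vchar_conv_imp_conv_compact_support[OF prob sets probN setsN lim contc, of "cball 0 (real L + 1)"])
      (auto simp: c0)
  have limf: "(\<lambda>n. \<integral>x. f x * c x \<partial>\<nu> n) \<longlonglongrightarrow> (\<integral>x. f x * c x \<partial>N)"
    by (rule vchar_conv_imp_conv_compact_support[OF prob sets probN setsN lim, of _ "cball 0 (real L + 1)"])
      (auto simp: c0 intro!: continuous_intros cont contc)
  have diff: "\<bar>(\<integral>x. f x \<partial>\<mu>) - (\<integral>x. f x * c x \<partial>\<mu>)\<bar> \<le> B * (1 - (\<integral>x. c x \<partial>\<mu>))"
    if "prob_space \<mu>" and [measurable_cong, simp]: "sets \<mu> = sets borel" for \<mu>
  proof -
    interpret \<mu>: prob_space \<mu> by fact
    have fc: "\<bar>f x * c x\<bar> \<le> B" for x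
      using B(2)[of x] c[of x] by (simp add: abs_mult) (meson abs_ge_zero mult_left_le order_trans)
    have i: "integrable \<mu> f" "integrable \<mu> c" "integrable \<mu> (\<lambda>x. f x * c x)"
      using c by (auto intro: \<mu>.integrable_const_bound[of _ B] \<mu>.integrable_const_bound[of _ 1] simp: B fc)
    have "\<bar>(\<integral>x. f x \<partial>\<mu>) - (\<integral>x. f x * c x \<partial>\<mu>)\<bar> = \<bar>\<integral>x. f x - f x * c x \<partial>\<mu>\<bar>" using i by simp
    also have "\<dots> \<le> (\<integral>x. \<bar>f x - f x * c x\<bar> \<partial>\<mu>)" by (rule integral_abs_bound)
    also have "\<dots> \<le> (\<integral>x. B * (1 - c x) \<partial>\<mu>)"
    proof (intro integral_mono)
      fix x
      have "\<bar>f x - f x * c x\<bar> = \<bar>f x * (1 - c x)\<bar>" by (simp add: algebra_simps)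
      then have "\<bar>f x - f x * c x\<bar> = \<bar>f x\<bar> * (1 - c x)"
        using c[of x] by (simp add: abs_mult)
      then show "\<bar>f x - f x * c x\<bar> \<le> B * (1 - c x)"
        using B(2)[of x] c[of x] by (simp add: mult_right_mono)
    qed (use i in auto)
    also have "\<dots> = B * (1 - (\<integral>x. c x \<partial>\<mu>))" using i by (simp add: \<mu>.prob_space)
    finally show ?thesis .
  qed
  have "1 - N.prob {x. real L < norm x} = (\<integral>x. 1 - indicator {x. real L < norm x} x \<partial>N)"
    using N.prob_space by (simp add: N.emeasure_eq_measure)
  also have "\<dots> \<le> (\<integral>x. c x \<partial>N)"
    using c by (intro integral_mono N.integrable_const_bound[of _ 1])
      (auto simp: c_def indicator_def N.emeasure_eq_measure)
  finally have cN: "1 - (\<integral>x. c x \<partial>N) < e" using L by simp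
  then have "- e + 1 < (\<integral>x. c x \<partial>N)" by simp
  \<comment> \<open>Here tightness is transferred: eventually the integral of \<open>c\<close> under
    \<open>\<nu> n\<close> also exceeds 1 - \<open>e\<close>.\<close>
  from order_tendstoD(1)[OF limc this] LIMSEQ_D[OF limf, of "r / 2"] \<open>0 < r\<close>
  have "\<forall>\<^sub>F n in sequentially. - e + 1 < (\<integral>x. c x \<partial>\<nu> n) \<and>
      \<bar>(\<integral>x. f x * c x \<partial>\<nu> n) - (\<integral>x. f x * c x \<partial>N)\<bar> < r / 2"
    by (intro eventually_conj) (auto simp: eventually_sequentially)
  then have "\<forall>\<^sub>F n in sequentially. norm ((\<integral>x. f x \<partial>\<nu> n) - (\<integral>x. f x \<partial>N)) < r"
  proof eventually_elim
    case (elim n)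
    have "B * (1 - (\<integral>x. c x \<partial>\<nu> n)) \<le> B * e" "B * (1 - (\<integral>x. c x \<partial>N)) \<le> B * e"
      using elim cN B(1) by (auto intro!: mult_left_mono)
    moreover have "B * e = r / 8" using B(1) by (simp add: e_def)
    ultimately show ?case
      using elim diff[OF prob[of n] sets] diff[OF probN setsN] \<open>0 < r\<close> by (simp add: abs_if split: if_splits)
  qed
  then show "\<exists>n0. \<forall>n\<ge>n0. norm ((\<integral>x. f x \<partial>\<nu> n) - (\<integral>x. f x \<partial>N)) < r"
    by (simp add: eventually_sequentially)
qed

section \<open>Recognising Gaussian laws by their characteristic functions\<close>

lemma distr_std_normal_scale:
  assumes "0 \<le> s"
  shows "normal_law (distr std_normal_distribution borel (\<lambda>x. s * x))"
proof -
  interpret std: real_distribution std_normal_distribution by (rule real_dist_normal_dist)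
  show ?thesis
  proof (cases "s = 0")
    case True
    then show ?thesis by (auto simp: normal_law_def std.distr_const)
  next
    case False
    have "distributed std_normal_distribution lborel (\<lambda>x. x) (normal_density 0 1)"
      by (simp add: distributed_def distr_id2)
    from std.normal_density_affine[OF this, of s 0] False assms
    have "distr std_normal_distribution lborel (\<lambda>x. s * x) = density lborel (normal_density 0 s)"
      by (simp add: distributed_def)
    moreover have "distr std_normal_distribution lborel (\<lambda>x. s * x) = distr std_normal_distribution borel (\<lambda>x. s * x)"
      by (rule distr_cong) auto
    ultimately show ?thesis using False assms unfolding normal_law_def by (metis less_eq_real_def)
  qed
qed

lemma normal_char_imp_distr:
  assumes "real_distribution N" "0 \<le> v" and ch: "\<And>t. char N t = complex_of_real (exp (- v * t\<^sup>2 / 2))"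
  shows "N = distr std_normal_distribution borel (\<lambda>x. sqrt v * x)"
proof (rule Levy_uniqueness)
  interpret std: real_distribution std_normal_distribution by (rule real_dist_normal_dist)
  show "real_distribution (distr std_normal_distribution borel (\<lambda>x. sqrt v * x))"
    by simp
  have "char (distr std_normal_distribution borel (\<lambda>x. sqrt v * x)) t = char std_normal_distribution (sqrt v * t)" for t
    unfolding char_def by (subst integral_distr) (auto simp: mult_ac)
  then show "char N = char (distr std_normal_distribution borel (\<lambda>x. sqrt v * x))"
    using \<open>0 \<le> v\<close> by (auto simp: ch char_std_normal_distribution power_mult_distrib)
qed fact

lemma moments_scaled_std_normal:
  fixes s :: real
  defines "N \<equiv> distr std_normal_distribution borel (\<lambda>x. s * x)"
  shows "integrable N (\<lambda>x. x)" "(\<integral>x. x \<partial>N) = 0" "integrable N (\<lambda>x. x\<^sup>2)" "(\<integral>x. x\<^sup>2 \<partial>N) = s\<^sup>2"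
proof -
  have m1: "integrable std_normal_distribution (\<lambda>x. s * x)" "(\<integral>x. s * x \<partial>std_normal_distribution) = s * 0"
    using integrable_std_normal_distribution_moment[of 1] integral_std_normal_distribution_moment_odd[OF odd_one]
    by (simp_all only: integrable_mult_right integral_mult_right_zero power_one_right)
  have m2: "integrable std_normal_distribution (\<lambda>x. s\<^sup>2 * x\<^sup>2)" "(\<integral>x. s\<^sup>2 * x\<^sup>2 \<partial>std_normal_distribution) = s\<^sup>2 * 1"
    using std_normal_distribution_even_moments[of 1]
    by (simp_all only: integrable_mult_right integral_mult_right_zero) (simp_all add: fact_numeral)
  show "integrable N (\<lambda>x. x)" unfolding N_def
    by (subst integrable_distr_eq) (use m1 in simp_all)
  show "(\<integral>x. x \<partial>N) = 0" unfolding N_def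
    by (subst integral_distr) (use m1 in simp_all)
  show "integrable N (\<lambda>x. x\<^sup>2)" unfolding N_def
    by (subst integrable_distr_eq) (use m2 in \<open>simp_all add: power_mult_distrib\<close>)
  show "(\<integral>x. x\<^sup>2 \<partial>N) = s\<^sup>2" unfolding N_def
    by (subst integral_distr) (use m2 in \<open>simp_all add: power_mult_distrib\<close>)
qed

text \<open>Along each direction \<open>a\<close> the characteristic function is that of a scaled
  standard normal variable, so by Levy uniqueness every \<open>a \<bullet> x\<close> has that law,
  and its moments give mean and variance.\<close>

lemma multivariate_normal_if_vchar:
  fixes N :: "(real^'k) measure" and V :: "real^'k^'k"
  assumes "prob_space N" and sets [measurable_cong, simp]: "sets N = sets borel"
    and sym: "transpose V = V"
    and ch: "\<And>a. vchar N a = complex_of_real (exp (- (a \<bullet> (V *v a)) / 2))"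
  shows "multivariate_normal N 0 V"
proof -
  interpret N: prob_space N by fact
  interpret std: real_distribution std_normal_distribution by (rule real_dist_normal_dist)
  have sp [simp]: "space N = UNIV" using sets_eq_imp_space_eq[OF sets] by simp
  \<comment> \<open>A characteristic function has modulus at most 1, which forces the exponent to be
    nonpositive.\<close>
  have nn: "0 \<le> a \<bullet> (V *v a)" for a
  proof -
    have "cmod (vchar N a) \<le> 1" by (rule norm_vchar_le_1) fact
    then show ?thesis by (simp add: ch norm_exp_eq_Re)
  qed
  have law: "distr N borel (\<lambda>x. a \<bullet> x) = distr std_normal_distribution borel (\<lambda>x. sqrt (a \<bullet> (V *v a)) * x)" for a
  proof (rule normal_char_imp_distr[OF _ nn])
    show "real_distribution (distr N borel (\<lambda>x. a \<bullet> x))" by simp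
    fix t
    have "char (distr N borel (\<lambda>x. a \<bullet> x)) t = vchar N (t *\<^sub>R a)"
      unfolding char_def vchar_def by (subst integral_distr) auto
    then show "char (distr N borel (\<lambda>x. a \<bullet> x)) t = complex_of_real (exp (- (a \<bullet> (V *v a)) * t\<^sup>2 / 2))"
      by (simp add: ch matrix_vector_mult_scaleR power2_eq_square mult_ac)
  qed
  note mom = moments_scaled_std_normal[of "sqrt (a \<bullet> (V *v a))" for a, folded law]
  have e1: "integrable N (\<lambda>x. a \<bullet> x)" "(\<integral>x. a \<bullet> x \<partial>N) = 0" for a
    using mom(1,2)[of a] by (simp_all add: integrable_distr_eq integral_distr)
  have e2: "integrable N (\<lambda>x. (a \<bullet> x)\<^sup>2)" "(\<integral>x. (a \<bullet> x)\<^sup>2 \<partial>N) = a \<bullet> (V *v a)" for a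
    using mom(3,4)[of a] nn[of a] by (simp_all add: integrable_distr_eq integral_distr)
  have ax: "axis i 1 \<bullet> x = x $ i" for i and x :: "real^'k"
    by (simp add: inner_axis inner_commute)
  have mean: "(\<integral>x. x $ i \<partial>N) = 0" for i
    using e1(2)[of "axis i 1"] by (simp add: ax)
  have "cov N (\<lambda>x. x $ i) (\<lambda>x. x $ j) = V $ i $ j" for i j
  proof -
    have Vij: "axis i 1 \<bullet> (V *v axis j 1) = V $ i $ j" for i j
      by (simp add: ax matrix_vector_mul_component inner_axis)
    have "V $ j $ i = V $ i $ j" using sym by (metis transpose_def vec_lambda_beta)
    then have q: "(axis i 1 + axis j 1) \<bullet> (V *v (axis i 1 + axis j 1)) = V $ i $ i + V $ j $ j + 2 * V $ i $ j"
      by (simp add: matrix_vector_right_distrib inner_add_left inner_add_right Vij)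
    have "cov N (\<lambda>x. x $ i) (\<lambda>x. x $ j) = (\<integral>x. x $ i * x $ j \<partial>N)"
      by (simp add: cov_def mean)
    \<comment> \<open>Polarisation: mixed moments are recovered from the second moments of the
      directions e_i, e_j and e_i + e_j.\<close>
    also have "\<dots> = (\<integral>x. (((axis i 1 + axis j 1) \<bullet> x)\<^sup>2 - (axis i 1 \<bullet> x)\<^sup>2 - (axis j 1 \<bullet> x)\<^sup>2) / 2 \<partial>N)"
      by (intro Bochner_Integration.integral_cong refl)
        (simp add: ax inner_add_left power2_eq_square algebra_simps)
    also have "\<dots> = V $ i $ j"
      using e2(1) by (simp add: e2(2) q Vij)
    finally show ?thesis .
  qed
  then show ?thesis
    unfolding multivariate_normal_def
    by (auto simp: mean law intro!: distr_std_normal_scale N.prob_space_axioms nn)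
qed

section \<open>Weak law of large numbers for triangular arrays\<close>

text \<open>Independence and centring remove the mixed second moments, so the sum has second moment
  at most card I * c^2 and thus L^1 norm of order sqrt (card I).\<close>

lemma (in prob_space) expectation_abs_sum_le:
  fixes Y :: "'i \<Rightarrow> 'a \<Rightarrow> real"
  assumes fin: "finite I" "I \<noteq> {}" and indep: "indep_vars (\<lambda>_. borel) Y I"
    and bnd: "\<And>i \<omega>. i \<in> I \<Longrightarrow> \<omega> \<in> space M \<Longrightarrow> \<bar>Y i \<omega>\<bar> \<le> c"
    and mean: "\<And>i. i \<in> I \<Longrightarrow> expectation (Y i) = 0"
  shows "expectation (\<lambda>\<omega>. \<bar>\<Sum>i\<in>I. Y i \<omega>\<bar>) \<le> (c\<^sup>2 + 1) / 2 * sqrt (card I)"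
proof -
  have m [measurable]: "Y i \<in> borel_measurable M" if "i \<in> I" for i
    using indep that by (simp add: indep_vars_def2)
  have int: "integrable M (Y i)" if "i \<in> I" for i
    using bnd[OF that] m[OF that] by (intro integrable_const_bound[of _ c]) auto
  have int2: "integrable M (\<lambda>\<omega>. Y i \<omega> * Y j \<omega>)" if "i \<in> I" "j \<in> I" for i j
  proof (rule integrable_const_bound[of _ "c * c"])
    show "AE \<omega> in M. norm (Y i \<omega> * Y j \<omega>) \<le> c * c"
      using bnd[OF that(1)] bnd[OF that(2)]
      by (intro AE_I2) (simp add: abs_mult, meson abs_ge_zero mult_mono order_trans)
  qed (use m[OF that(1)] m[OF that(2)] in simp)
  have cross: "expectation (\<lambda>\<omega>. Y i \<omega> * Y j \<omega>) \<le> (if i = j then c\<^sup>2 else 0)" if ij: "i \<in> I" "j \<in> I" for i j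
  proof (cases "i = j")
    case True
    have "expectation (\<lambda>\<omega>. Y i \<omega> * Y j \<omega>) \<le> expectation (\<lambda>_. c\<^sup>2)"
    proof (rule integral_mono)
      fix \<omega> assume "\<omega> \<in> space M"
      from power_mono[OF bnd[OF ij(1) this], of 2] True show "Y i \<omega> * Y j \<omega> \<le> c\<^sup>2"
        by (simp add: power2_eq_square)
    qed (use int2 ij in auto)
    then show ?thesis using True by (simp add: prob_space)
  next
    case False
    have "indep_vars (\<lambda>_. borel) Y {i, j}"
      using indep by (rule indep_vars_subset) (use ij in auto)
    from indep_vars_lebesgue_integral[OF _ this] int ij
    have "expectation (\<lambda>\<omega>. \<Prod>k\<in>{i, j}. Y k \<omega>) = (\<Prod>k\<in>{i, j}. expectation (Y k))" by auto
    with False mean ij show ?thesis by simp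
  qed
  have sqr: "(\<Sum>i\<in>I. Y i \<omega>)\<^sup>2 = (\<Sum>i\<in>I. \<Sum>j\<in>I. Y i \<omega> * Y j \<omega>)" for \<omega>
    by (simp add: power2_eq_square sum_product)
  have "expectation (\<lambda>\<omega>. (\<Sum>i\<in>I. Y i \<omega>)\<^sup>2) = (\<Sum>i\<in>I. \<Sum>j\<in>I. expectation (\<lambda>\<omega>. Y i \<omega> * Y j \<omega>))"
    unfolding sqr using int2 by (simp add: Bochner_Integration.integral_sum)
  also have "\<dots> \<le> (\<Sum>i\<in>I. \<Sum>j\<in>I. if i = j then c\<^sup>2 else 0)"
    by (intro sum_mono cross)
  also have "\<dots> = card I * c\<^sup>2" using fin by simp
  finally have var: "expectation (\<lambda>\<omega>. (\<Sum>i\<in>I. Y i \<omega>)\<^sup>2) \<le> card I * c\<^sup>2" .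
  define s where "s = sqrt (card I)"
  have s: "0 < s" "s\<^sup>2 = card I" using fin by (auto simp: s_def card_gt_0_iff)
  have i2: "integrable M (\<lambda>\<omega>. (\<Sum>i\<in>I. Y i \<omega>)\<^sup>2)" unfolding sqr using int2 by auto
  \<comment> \<open>\<open>2 |S| \<le> S\<^sup>2 / s + s\<close> replaces the Cauchy-Schwarz inequality.\<close>
  have "expectation (\<lambda>\<omega>. \<bar>\<Sum>i\<in>I. Y i \<omega>\<bar>) \<le> expectation (\<lambda>\<omega>. ((\<Sum>i\<in>I. Y i \<omega>)\<^sup>2 / s + s) / 2)"
  proof (rule integral_mono)
    fix \<omega>
    have "0 \<le> (\<bar>\<Sum>i\<in>I. Y i \<omega>\<bar> - s)\<^sup>2" by simp
    then have "2 * s * \<bar>\<Sum>i\<in>I. Y i \<omega>\<bar> \<le> (\<Sum>i\<in>I. Y i \<omega>)\<^sup>2 + s\<^sup>2"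
      by (simp add: power2_diff mult_ac)
    then show "\<bar>\<Sum>i\<in>I. Y i \<omega>\<bar> \<le> ((\<Sum>i\<in>I. Y i \<omega>)\<^sup>2 / s + s) / 2"
      using s(1) by (simp add: field_simps power2_eq_square)
  qed (use int i2 in auto)
  also have "\<dots> = (expectation (\<lambda>\<omega>. (\<Sum>i\<in>I. Y i \<omega>)\<^sup>2) / s + s) / 2"
    using i2 by (simp add: prob_space)
  also have "\<dots> \<le> (card I * c\<^sup>2 / s + s) / 2"
    using var s(1) by (simp add: divide_right_mono)
  also have "\<dots> = (c\<^sup>2 + 1) / 2 * s"
    unfolding s(2)[symmetric] using s(1) by (simp add: field_simps power2_eq_square)
  finally show ?thesis by (simp add: s_def)
qed

text \<open>The truncated function \<open>g\<close> has all moments, and \<open>g - \<mu>\<close> is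
  bounded by 2 * \<open>k\<close>, whence the constant 4 * k^2 + 1. The discarded part
  \<open>h\<close> - \<open>g\<close> is paid for twice in L^1: once in the sample average and once
  in the mean.\<close>

lemma (in prob_space) iid_average_truncation_bound:
  fixes X :: "nat \<Rightarrow> 'a \<Rightarrow> 'b::euclidean_space" and h :: "'b \<Rightarrow> real"
  assumes indep: "indep_vars (\<lambda>_. borel) X {..<n}" and law: "\<And>i. i < n \<Longrightarrow> distr M borel (X i) = F"
    and F: "prob_space F" and sets [measurable_cong, simp]: "sets F = sets borel"
    and [measurable]: "h \<in> borel_measurable borel" and h: "integrable F h"
    and "0 < n" "0 \<le> k"
  defines "g x \<equiv> if \<bar>h x\<bar> \<le> k then h x else 0"
  shows "expectation (\<lambda>\<omega>. \<bar>(\<Sum>i<n. h (X i \<omega>)) / n - (\<integral>x. h x \<partial>F)\<bar>) \<le>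
    2 * (\<integral>x. \<bar>h x - g x\<bar> \<partial>F) + (4 * k\<^sup>2 + 1) / 2 * (1 / sqrt n)"
proof -
  interpret F: prob_space F by fact
  have [measurable]: "g \<in> borel_measurable borel" unfolding g_def[abs_def] by measurable
  have m [measurable]: "X i \<in> borel_measurable M" if "i < n" for i
    using indep that by (simp add: indep_vars_def2)
  have gk: "\<bar>g x\<bar> \<le> k" for x using \<open>0 \<le> k\<close> by (simp add: g_def)
  have g: "integrable F g" by (rule F.integrable_const_bound[of _ k]) (auto simp: gk)
  have tr: "integrable M (\<lambda>\<omega>. u (X i \<omega>))" "expectation (\<lambda>\<omega>. u (X i \<omega>)) = (\<integral>x. u x \<partial>F)"
    if "i < n" "integrable F u" and [measurable]: "u \<in> borel_measurable borel" for i and u :: "'b \<Rightarrow> real"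
    using that(2) m[OF that(1)] unfolding law[OF that(1), symmetric]
    by (simp_all add: integrable_distr_eq integral_distr)
  define \<mu> where "\<mu> = (\<integral>x. g x \<partial>F)"
  have \<mu>k: "\<bar>\<mu>\<bar> \<le> k"
  proof -
    have "\<bar>\<mu>\<bar> \<le> (\<integral>x. \<bar>g x\<bar> \<partial>F)" unfolding \<mu>_def by (rule integral_abs_bound)
    also have "\<dots> \<le> (\<integral>x. k \<partial>F)" using g gk by (intro integral_mono) auto
    finally show ?thesis by (simp add: F.prob_space)
  qed
  have ind: "indep_vars (\<lambda>_. borel) (\<lambda>i \<omega>. g (X i \<omega>) - \<mu>) {..<n}"
    by (rule indep_vars_compose2[OF indep]) simp
  have main: "expectation (\<lambda>\<omega>. \<bar>\<Sum>i<n. (g (X i \<omega>) - \<mu>)\<bar>) \<le> ((2 * k)\<^sup>2 + 1) / 2 * sqrt (card {..<n})"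
  proof (rule expectation_abs_sum_le[OF _ _ ind])
    show "\<bar>g (X i \<omega>) - \<mu>\<bar> \<le> 2 * k" for i \<omega> using gk[of "X i \<omega>"] \<mu>k by linarith
    show "expectation (\<lambda>\<omega>. g (X i \<omega>) - \<mu>) = 0" if "i \<in> {..<n}" for i
      using tr[OF _ g, of i] that by (simp add: \<mu>_def prob_space)
  qed (use \<open>0 < n\<close> in auto)
  have i1: "integrable M (\<lambda>\<omega>. (\<Sum>i<n. \<bar>h (X i \<omega>) - g (X i \<omega>)\<bar>) / n)"
    and i2: "integrable M (\<lambda>\<omega>. \<bar>\<Sum>i<n. (g (X i \<omega>) - \<mu>)\<bar> / n)"
    and i3: "\<And>i. i < n \<Longrightarrow> integrable M (\<lambda>\<omega>. \<bar>h (X i \<omega>) - g (X i \<omega>)\<bar>)"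
    by (auto intro!: integrable_abs Bochner_Integration.integrable_sum Bochner_Integration.integrable_diff
        integrable_divide tr(1) h g)
  have hg: "integrable F (\<lambda>x. \<bar>h x - g x\<bar>)" using h g by auto
  have "expectation (\<lambda>\<omega>. \<bar>(\<Sum>i<n. h (X i \<omega>)) / n - (\<integral>x. h x \<partial>F)\<bar>) \<le>
      expectation (\<lambda>\<omega>. (\<Sum>i<n. \<bar>h (X i \<omega>) - g (X i \<omega>)\<bar>) / n + \<bar>\<Sum>i<n. (g (X i \<omega>) - \<mu>)\<bar> / n
        + (\<integral>x. \<bar>h x - g x\<bar> \<partial>F))"
  proof (rule integral_mono)
    fix \<omega>
    have "(\<Sum>i<n. h (X i \<omega>)) / n - (\<integral>x. h x \<partial>F) =
        (\<Sum>i<n. h (X i \<omega>) - g (X i \<omega>)) / n + (\<Sum>i<n. (g (X i \<omega>) - \<mu>)) / n - (\<integral>x. h x - g x \<partial>F)"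
      using h g \<open>0 < n\<close> by (simp add: \<mu>_def sum_subtractf field_simps)
    moreover have "\<bar>(\<Sum>i<n. h (X i \<omega>) - g (X i \<omega>)) / n\<bar> \<le> (\<Sum>i<n. \<bar>h (X i \<omega>) - g (X i \<omega>)\<bar>) / n"
      by (simp add: divide_right_mono)
    moreover have "\<bar>\<integral>x. h x - g x \<partial>F\<bar> \<le> (\<integral>x. \<bar>h x - g x\<bar> \<partial>F)" by (rule integral_abs_bound)
    moreover have "\<bar>(\<Sum>i<n. (g (X i \<omega>) - \<mu>)) / n\<bar> = \<bar>\<Sum>i<n. (g (X i \<omega>) - \<mu>)\<bar> / n" by simp
    ultimately show "\<bar>(\<Sum>i<n. h (X i \<omega>)) / n - (\<integral>x. h x \<partial>F)\<bar> \<le>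
        (\<Sum>i<n. \<bar>h (X i \<omega>) - g (X i \<omega>)\<bar>) / n + \<bar>\<Sum>i<n. (g (X i \<omega>) - \<mu>)\<bar> / n + (\<integral>x. \<bar>h x - g x\<bar> \<partial>F)"
      by linarith
  qed (auto intro!: integrable_abs Bochner_Integration.integrable_sum Bochner_Integration.integrable_diff
      Bochner_Integration.integrable_add integrable_divide tr(1) h g)
  also have "\<dots> = (\<Sum>i<n. expectation (\<lambda>\<omega>. \<bar>h (X i \<omega>) - g (X i \<omega>)\<bar>)) / n
      + expectation (\<lambda>\<omega>. \<bar>\<Sum>i<n. (g (X i \<omega>) - \<mu>)\<bar>) / n + (\<integral>x. \<bar>h x - g x\<bar> \<partial>F)"
    using i1 i2 i3 by (simp add: prob_space Bochner_Integration.integral_sum Bochner_Integration.integral_add)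
  also have "(\<Sum>i<n. expectation (\<lambda>\<omega>. \<bar>h (X i \<omega>) - g (X i \<omega>)\<bar>)) = n * (\<integral>x. \<bar>h x - g x\<bar> \<partial>F)"
    using tr(2)[OF _ hg] by simp
  also have "expectation (\<lambda>\<omega>. \<bar>\<Sum>i<n. (g (X i \<omega>) - \<mu>)\<bar>) / n \<le> ((2 * k)\<^sup>2 + 1) / 2 * sqrt n / n"
    using main by (intro divide_right_mono) auto
  also have "\<dots> = (4 * k\<^sup>2 + 1) / 2 * (1 / sqrt n)"
  proof -
    have "((2 * k)\<^sup>2 + 1) / 2 * sqrt n / n = (4 * k\<^sup>2 + 1) / 2 * (sqrt n / n)"
      by (simp add: power_mult_distrib)
    then show ?thesis by (simp only: sqrt_divide_self_eq[OF of_nat_0_le_iff] inverse_eq_divide)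
  qed
  finally show ?thesis using \<open>0 < n\<close> by simp
qed

text \<open>The truncation level is fixed before the sample size: it brings the discarded part below
  \<open>e / 4\<close>, counted twice, and for that fixed level the variance term vanishes as n
  grows.\<close>

theorem (in prob_space) iid_average_L1:
  fixes X :: "nat \<Rightarrow> nat \<Rightarrow> 'a \<Rightarrow> 'b::euclidean_space" and h :: "'b \<Rightarrow> real"
  assumes iid: "\<forall>\<^sub>F n in sequentially. indep_vars (\<lambda>_. borel) (X n) {..<n} \<and> (\<forall>i<n. distr M borel (X n i) = F)"
    and F: "prob_space F" and sets [measurable_cong, simp]: "sets F = sets borel"
    and h_meas [measurable]: "h \<in> borel_measurable borel" and h: "integrable F h"
  shows "(\<lambda>n. expectation (\<lambda>\<omega>. \<bar>(\<Sum>i<n. h (X n i \<omega>)) / n - (\<integral>x. h x \<partial>F)\<bar>)) \<longlonglongrightarrow> 0"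
proof (rule tendstoI)
  fix e :: real assume "0 < e"
  let ?g = "\<lambda>k x. if \<bar>h x\<bar> \<le> real k then h x else 0"
  have "(\<lambda>k. \<integral>x. \<bar>h x - ?g k x\<bar> \<partial>F) \<longlonglongrightarrow> (\<integral>x. 0 \<partial>F)"
  proof (rule integral_dominated_convergence[where w = "\<lambda>x. \<bar>h x\<bar>"])
    have "(\<lambda>k. \<bar>h x - ?g k x\<bar>) \<longlonglongrightarrow> 0" for x
    proof (rule tendsto_eventually)
      obtain k0 :: nat where "\<bar>h x\<bar> \<le> real k0" using real_arch_simple by blast
      then show "\<forall>\<^sub>F k in sequentially. \<bar>h x - ?g k x\<bar> = 0"
        by (intro eventually_sequentiallyI[of k0]) auto
    qed
    then show "AE x in F. (\<lambda>k. \<bar>h x - ?g k x\<bar>) \<longlonglongrightarrow> 0" by simp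
  qed (use h in auto)
  then have "(\<lambda>k. \<integral>x. \<bar>h x - ?g k x\<bar> \<partial>F) \<longlonglongrightarrow> 0" by simp
  from order_tendstoD(2)[OF this, of "e / 4"] \<open>0 < e\<close> obtain k :: nat where
    k: "(\<integral>x. \<bar>h x - ?g k x\<bar> \<partial>F) < e / 4" by (auto simp: eventually_sequentially)
  have "(\<lambda>n. (4 * (real k)\<^sup>2 + 1) / 2 * (1 / sqrt (real n))) \<longlonglongrightarrow> 0"
    by real_asymp
  from order_tendstoD(2)[OF this, of "e / 2"] \<open>0 < e\<close>
  have "\<forall>\<^sub>F n in sequentially. (4 * (real k)\<^sup>2 + 1) / 2 * (1 / sqrt (real n)) < e / 2" by simp
  with iid eventually_gt_at_top[of 0]
  show "\<forall>\<^sub>F n in sequentially. dist (expectation (\<lambda>\<omega>. \<bar>(\<Sum>i<n. h (X n i \<omega>)) / n - (\<integral>x. h x \<partial>F)\<bar>)) 0 < e"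
  proof eventually_elim
    case (elim n)
    then have "expectation (\<lambda>\<omega>. \<bar>(\<Sum>i<n. h (X n i \<omega>)) / n - (\<integral>x. h x \<partial>F)\<bar>) \<le>
        2 * (\<integral>x. \<bar>h x - ?g k x\<bar> \<partial>F) + (4 * (real k)\<^sup>2 + 1) / 2 * (1 / sqrt n)"
      by (intro iid_average_truncation_bound[OF _ _ F sets h_meas h]) auto
    also have "\<dots> < e" using elim k by linarith
    finally have "expectation (\<lambda>\<omega>. \<bar>(\<Sum>i<n. h (X n i \<omega>)) / n - (\<integral>x. h x \<partial>F)\<bar>) < e" .
    moreover have "0 \<le> expectation (\<lambda>\<omega>. \<bar>(\<Sum>i<n. h (X n i \<omega>)) / n - (\<integral>x. h x \<partial>F)\<bar>)" by simp
    ultimately show ?case by simp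
  qed
qed

section \<open>Central limit theorem for weighted sums of independent identically distributed vectors\<close>

text \<open>The one-dimensional third-order bound for the law of \<open>w \<bullet> x\<close>, taken
  at frequency 1. Splitting off the square of norm \<open>w\<close> leaves a remainder that depends
  on \<open>w\<close> only through its norm; the minimum with 6 * (norm x)^2 makes it integrable
  without a third moment.\<close>

lemma vchar_second_order:
  fixes F :: "'a::euclidean_space measure"
  assumes "prob_space F" and sets [measurable_cong, simp]: "sets F = sets borel"
    and sq: "integrable F (\<lambda>x. (norm x)\<^sup>2)" and mean: "\<And>a. (\<integral>x. a \<bullet> x \<partial>F) = 0"
  shows "cmod (vchar F w - (1 - (\<integral>x. (w \<bullet> x)\<^sup>2 \<partial>F) / 2)) \<le>
    (norm w)\<^sup>2 * ((\<integral>x. min (6 * (norm x)\<^sup>2) (norm w * norm x ^ 3) \<partial>F) / 6)"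
proof -
  interpret prob_space F by fact
  have [simp]: "space F = UNIV" using sets_eq_imp_space_eq[OF sets] by simp
  have le: "(w \<bullet> x)\<^sup>2 \<le> (norm w)\<^sup>2 * (norm x)\<^sup>2" for x
    using power_mono[OF Cauchy_Schwarz_ineq2[of w x], of 2] by (simp add: power_mult_distrib)
  have i2: "integrable F (\<lambda>x. (w \<bullet> x)\<^sup>2)"
    by (rule Bochner_Integration.integrable_bound[OF integrable_mult_right[OF sq, of "(norm w)\<^sup>2"]])
      (auto simp: le)
  have i1: "integrable F (\<lambda>x. w \<bullet> x)"
    by (rule square_integrable_imp_integrable[OF _ i2]) simp
  have "cmod (char (distr F borel (\<lambda>x. w \<bullet> x)) 1 - (1 - 1\<^sup>2 * complex_of_real (\<integral>x. (w \<bullet> x)\<^sup>2 \<partial>F) / 2))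
      \<le> (1\<^sup>2 / 6) * expectation (\<lambda>x. min (6 * (w \<bullet> x)\<^sup>2) (\<bar>1\<bar> * \<bar>w \<bullet> x\<bar> ^ 3))"
    using char_approx3'[where X = "\<lambda>x. w \<bullet> x" and t = 1, OF _ i1 i2 mean refl refl]
    by (simp add: mean)
  also have "char (distr F borel (\<lambda>x. w \<bullet> x)) 1 = vchar F w"
    unfolding char_def vchar_def by (subst integral_distr) auto
  also have "expectation (\<lambda>x. min (6 * (w \<bullet> x)\<^sup>2) (\<bar>1\<bar> * \<bar>w \<bullet> x\<bar> ^ 3)) \<le>
      expectation (\<lambda>x. (norm w)\<^sup>2 * min (6 * (norm x)\<^sup>2) (norm w * norm x ^ 3))"
  proof (rule integral_mono)
    show "integrable F (\<lambda>x. min (6 * (w \<bullet> x)\<^sup>2) (\<bar>1\<bar> * \<bar>w \<bullet> x\<bar> ^ 3))"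
      by (rule Bochner_Integration.integrable_bound[OF integrable_mult_right[OF i2, of 6]]) auto
    show "integrable F (\<lambda>x. (norm w)\<^sup>2 * min (6 * (norm x)\<^sup>2) (norm w * norm x ^ 3))"
      by (rule integrable_mult_right, rule Bochner_Integration.integrable_bound[OF integrable_mult_right[OF sq, of 6]]) auto
    fix x
    have "\<bar>w \<bullet> x\<bar> ^ 3 \<le> (norm w * norm x) ^ 3"
      by (rule power_mono[OF Cauchy_Schwarz_ineq2]) simp
    then show "min (6 * (w \<bullet> x)\<^sup>2) (\<bar>1\<bar> * \<bar>w \<bullet> x\<bar> ^ 3) \<le> (norm w)\<^sup>2 * min (6 * (norm x)\<^sup>2) (norm w * norm x ^ 3)"
      using le[of x] by (auto simp: min_def algebra_simps power2_eq_square power3_eq_cube)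
  qed
  finally show ?thesis by simp
qed

text \<open>Both sides come from exp u >= 1 + u, at u = - \<open>s\<close> for the lower bound and
  at u = \<open>s\<close>, inverted, for the upper one.\<close>

lemma exp_minus_first_order:
  fixes s :: real
  assumes "0 \<le> s"
  shows "\<bar>exp (- s) - (1 - s)\<bar> \<le> s\<^sup>2"
proof -
  have "exp (- s) \<le> 1 / (1 + s)"
    using exp_ge_add_one_self[of s] assms by (simp add: exp_minus field_simps)
  also have "\<dots> \<le> 1 - s + s\<^sup>2"
    using assms by (simp add: field_simps power2_eq_square)
  finally show ?thesis using exp_ge_add_one_self[of "- s"] by simp
qed

lemma (in prob_space) vchar_weighted_sum:
  fixes X :: "'i \<Rightarrow> 'a \<Rightarrow> 'b::euclidean_space"
  assumes "indep_vars (\<lambda>_. borel) X I" "\<And>i. i \<in> I \<Longrightarrow> distr M borel (X i) = F"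
  shows "(CLINT \<omega>|M. iexp (\<Sum>i\<in>I. w i \<bullet> X i \<omega>)) = (\<Prod>i\<in>I. vchar F (w i))"
proof -
  have m [measurable]: "X i \<in> borel_measurable M" if "i \<in> I" for i
    using assms(1) that by (simp add: indep_vars_def2)
  have "indep_vars (\<lambda>_. borel) (\<lambda>i \<omega>. w i \<bullet> X i \<omega>) I"
    by (rule indep_vars_compose2[OF assms(1)]) simp
  from char_distr_sum[OF this, of 1]
  have "char (distr M borel (\<lambda>\<omega>. \<Sum>i\<in>I. w i \<bullet> X i \<omega>)) 1 = (\<Prod>i\<in>I. char (distr M borel (\<lambda>\<omega>. w i \<bullet> X i \<omega>)) 1)" .
  moreover have "char (distr M borel (\<lambda>\<omega>. w i \<bullet> X i \<omega>)) 1 = vchar F (w i)" if "i \<in> I" for i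
    unfolding char_def vchar_def assms(2)[OF that, symmetric]
    using m[OF that] by (subst (1 2) integral_distr) auto
  moreover have "char (distr M borel (\<lambda>\<omega>. \<Sum>i\<in>I. w i \<bullet> X i \<omega>)) 1 = (CLINT \<omega>|M. iexp (\<Sum>i\<in>I. w i \<bullet> X i \<omega>))"
    unfolding char_def by (subst integral_distr) (auto intro!: borel_measurable_sum borel_measurable_inner m)
  ultimately show ?thesis by simp
qed

text \<open>Each factor \<open>vchar F (w n i)\<close> is compared with the Gaussian factor of equal
  variance. All factors have modulus at most 1, so the products differ by at most the sum of the
  single errors, and each error is the squared norm of a weight times a quantity that is small once
  all weights are.\<close>

theorem weighted_iid_clt:
  fixes F :: "'a::euclidean_space measure" and \<epsilon> :: "nat \<Rightarrow> nat \<Rightarrow> 'w \<Rightarrow> 'a" and w :: "nat \<Rightarrow> nat \<Rightarrow> 'a"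
  assumes "prob_space M"
    and iid: "\<forall>\<^sub>F n in sequentially. prob_space.indep_vars M (\<lambda>_. borel) (\<epsilon> n) {..<n} \<and>
      (\<forall>i<n. distr M borel (\<epsilon> n i) = F)"
    and F: "prob_space F" and sets [measurable_cong, simp]: "sets F = sets borel"
    and sq: "integrable F (\<lambda>x. (norm x)\<^sup>2)" and mean: "\<And>a. (\<integral>x. a \<bullet> x \<partial>F) = 0"
    and var: "(\<lambda>n. \<Sum>i<n. \<integral>x. (w n i \<bullet> x)\<^sup>2 \<partial>F) \<longlonglongrightarrow> v"
    and bnd: "\<forall>\<^sub>F n in sequentially. (\<Sum>i<n. (norm (w n i))\<^sup>2) \<le> K"
    and negl: "\<And>d. 0 < d \<Longrightarrow> \<forall>\<^sub>F n in sequentially. \<forall>i<n. norm (w n i) \<le> d"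
  shows "(\<lambda>n. CLINT \<omega>|M. iexp (\<Sum>i<n. w n i \<bullet> \<epsilon> n i \<omega>)) \<longlonglongrightarrow> complex_of_real (exp (- v / 2))"
proof -
  interpret M: prob_space M by fact
  interpret F: prob_space F by fact
  have [simp]: "space F = UNIV" using sets_eq_imp_space_eq[OF sets] by simp
  define q where "q w = (\<integral>x. (w \<bullet> x)\<^sup>2 \<partial>F)" for w
  define \<rho> where "\<rho> u = (\<integral>x. min (6 * (norm x)\<^sup>2) (u * norm x ^ 3) \<partial>F) / 6" for u :: real
  define V where "V = (\<integral>x. (norm x)\<^sup>2 \<partial>F)"
  have int\<rho>: "integrable F (\<lambda>x. min (6 * (norm x)\<^sup>2) (u * norm x ^ 3))" if "0 \<le> u" for u
    by (rule Bochner_Integration.integrable_bound[OF integrable_mult_right[OF sq, of 6]]) (use that in auto)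
  have \<rho>_mono: "\<rho> u \<le> \<rho> u'" if "0 \<le> u" "u \<le> u'" for u u'
    unfolding \<rho>_def using that
    by (intro divide_right_mono integral_mono int\<rho> min.mono mult_right_mono) auto
  have q: "0 \<le> q w" "q w \<le> (norm w)\<^sup>2 * V" for w
  proof -
    have le: "(w \<bullet> x)\<^sup>2 \<le> (norm w)\<^sup>2 * (norm x)\<^sup>2" for x
      using power_mono[OF Cauchy_Schwarz_ineq2[of w x], of 2] by (simp add: power_mult_distrib)
    have "q w \<le> (\<integral>x. (norm w)\<^sup>2 * (norm x)\<^sup>2 \<partial>F)" unfolding q_def
      by (intro integral_mono integrable_mult_right[OF sq]
          Bochner_Integration.integrable_bound[OF integrable_mult_right[OF sq, of "(norm w)\<^sup>2"]]) (auto simp: le)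
    then show "q w \<le> (norm w)\<^sup>2 * V" by (simp add: V_def)
    show "0 \<le> q w" by (simp add: q_def)
  qed
  \<comment> \<open>The Lindeberg argument: the cubic branch makes the integrand tend to 0
    pointwise, and the quadratic branch dominates it using second moments only.\<close>
  have "(\<lambda>k. \<integral>x. min (6 * (norm x)\<^sup>2) (inverse (real (Suc k)) * norm x ^ 3) \<partial>F) \<longlonglongrightarrow> (\<integral>x. 0 \<partial>F)"
  proof (rule integral_dominated_convergence[where w = "\<lambda>x. 6 * (norm x)\<^sup>2"])
    have "(\<lambda>k. min (6 * (norm x)\<^sup>2) (inverse (real (Suc k)) * norm x ^ 3)) \<longlonglongrightarrow> min (6 * (norm x)\<^sup>2) (0 * norm x ^ 3)" for x :: 'a
      by (intro tendsto_intros LIMSEQ_inverse_real_of_nat)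
    then show "AE x in F. (\<lambda>k. min (6 * (norm x)\<^sup>2) (inverse (real (Suc k)) * norm x ^ 3)) \<longlonglongrightarrow> 0"
      by (simp add: min_absorb2)
  qed (use sq in auto)
  then have \<rho>_lim: "(\<lambda>k. \<rho> (inverse (real (Suc k)))) \<longlonglongrightarrow> 0"
    unfolding \<rho>_def by (auto intro!: tendsto_divide_zero)
  have factor: "cmod (vchar F w - exp (- q w / 2)) \<le> (norm w)\<^sup>2 * (\<rho> d + d\<^sup>2 * V\<^sup>2 / 4)" if "norm w \<le> d" for w d
  proof -
    have "cmod (vchar F w - (1 - q w / 2)) \<le> (norm w)\<^sup>2 * \<rho> (norm w)"
      using vchar_second_order[OF F sets sq mean, of w] by (simp add: q_def \<rho>_def)
    also have "\<dots> \<le> (norm w)\<^sup>2 * \<rho> d"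
      using that by (intro mult_left_mono \<rho>_mono) auto
    finally have 1: "cmod (vchar F w - (1 - q w / 2)) \<le> (norm w)\<^sup>2 * \<rho> d" .
    have "\<bar>exp (- (q w / 2)) - (1 - q w / 2)\<bar> \<le> (q w / 2)\<^sup>2"
      by (rule exp_minus_first_order) (use q in simp)
    also have "\<dots> \<le> ((norm w)\<^sup>2 * V / 2)\<^sup>2"
      using q by (intro power_mono) auto
    also have "\<dots> = (norm w)\<^sup>2 * ((norm w)\<^sup>2 * V\<^sup>2 / 4)"
      by (simp add: power2_eq_square)
    also have "\<dots> \<le> (norm w)\<^sup>2 * (d\<^sup>2 * V\<^sup>2 / 4)"
      using that by (intro mult_left_mono divide_right_mono mult_right_mono power_mono) auto
    finally have "cmod (complex_of_real (exp (- (q w / 2)) - (1 - q w / 2))) \<le> (norm w)\<^sup>2 * (d\<^sup>2 * V\<^sup>2 / 4)"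
      by (simp only: norm_of_real)
    then have 2: "cmod (exp (- q w / 2) - (1 - complex_of_real (q w) / 2)) \<le> (norm w)\<^sup>2 * (d\<^sup>2 * V\<^sup>2 / 4)"
      by (simp add: exp_of_real[symmetric])
    have "cmod (vchar F w - exp (- q w / 2)) \<le> cmod (vchar F w - (1 - q w / 2)) + cmod (exp (- q w / 2) - (1 - complex_of_real (q w) / 2))"
      using norm_triangle_ineq4[of "vchar F w - (1 - q w / 2)" "exp (- q w / 2) - (1 - complex_of_real (q w) / 2)"] by simp
    with 1 2 show ?thesis by (simp add: algebra_simps)
  qed
  have cmod_vchar: "cmod (vchar F w) \<le> 1" for w by (rule norm_vchar_le_1) fact
  have "(\<lambda>n. (CLINT \<omega>|M. iexp (\<Sum>i<n. w n i \<bullet> \<epsilon> n i \<omega>)) - complex_of_real (exp (- (\<Sum>i<n. q (w n i)) / 2))) \<longlonglongrightarrow> 0"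
  proof (rule tendstoI)
    fix e :: real assume "0 < e"
    \<comment> \<open>The weight threshold \<open>d\<close> = 1 / (k + 1) is fixed here, before n;
      \<open>negl\<close> then puts all weights below it eventually. The factor
      \<open>\<bar>K\<bar> + 1\<close> is a positive upper bound for the sum of squared
      weights.\<close>
    have "(\<lambda>k. (\<bar>K\<bar> + 1) * (\<rho> (inverse (real (Suc k))) + (inverse (real (Suc k)))\<^sup>2 * V\<^sup>2 / 4)) \<longlonglongrightarrow> (\<bar>K\<bar> + 1) * (0 + 0\<^sup>2 * V\<^sup>2 / 4)"
      by (intro tendsto_intros \<rho>_lim LIMSEQ_inverse_real_of_nat) simp_all
    then have "(\<lambda>k. (\<bar>K\<bar> + 1) * (\<rho> (inverse (real (Suc k))) + (inverse (real (Suc k)))\<^sup>2 * V\<^sup>2 / 4)) \<longlonglongrightarrow> 0"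
      by simp
    from order_tendstoD(2)[OF this \<open>0 < e\<close>] obtain k where
      k: "(\<bar>K\<bar> + 1) * (\<rho> (inverse (real (Suc k))) + (inverse (real (Suc k)))\<^sup>2 * V\<^sup>2 / 4) < e"
      by (auto simp: eventually_sequentially)
    define d where "d = inverse (real (Suc k))"
    have "0 < d" by (simp add: d_def)
    have \<rho>0: "0 \<le> \<rho> d" using \<open>0 < d\<close> unfolding \<rho>_def by (auto intro!: integral_nonneg_AE)
    from iid bnd negl[OF \<open>0 < d\<close>]
    show "\<forall>\<^sub>F n in sequentially. dist ((CLINT \<omega>|M. iexp (\<Sum>i<n. w n i \<bullet> \<epsilon> n i \<omega>))
        - complex_of_real (exp (- (\<Sum>i<n. q (w n i)) / 2))) 0 < e"
    proof eventually_elim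
      case (elim n)
      have "(CLINT \<omega>|M. iexp (\<Sum>i<n. w n i \<bullet> \<epsilon> n i \<omega>)) = (\<Prod>i<n. vchar F (w n i))"
        by (rule M.vchar_weighted_sum) (use elim in auto)
      moreover have "complex_of_real (exp (- (\<Sum>i<n. q (w n i)) / 2)) = (\<Prod>i<n. complex_of_real (exp (- q (w n i) / 2)))"
        unfolding of_real_prod[symmetric] exp_sum[OF finite_lessThan, symmetric]
        by (simp add: sum_negf sum_divide_distrib)
      moreover have "cmod ((\<Prod>i<n. vchar F (w n i)) - (\<Prod>i<n. complex_of_real (exp (- q (w n i) / 2)))) \<le>
          (\<Sum>i<n. cmod (vchar F (w n i) - complex_of_real (exp (- q (w n i) / 2))))"
        by (rule norm_prod_diff) (auto simp: cmod_vchar q norm_of_real simp del: of_real_exp)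
      moreover have "\<dots> \<le> (\<Sum>i<n. (norm (w n i))\<^sup>2 * (\<rho> d + d\<^sup>2 * V\<^sup>2 / 4))"
        using elim by (intro sum_mono order_trans[OF _ factor[of _ d]]) (auto simp: exp_of_real)
      moreover have "\<dots> = (\<Sum>i<n. (norm (w n i))\<^sup>2) * (\<rho> d + d\<^sup>2 * V\<^sup>2 / 4)"
        by (simp add: sum_distrib_right)
      moreover have "\<dots> \<le> (\<bar>K\<bar> + 1) * (\<rho> d + d\<^sup>2 * V\<^sup>2 / 4)"
        using elim \<rho>0 by (intro mult_right_mono) auto
      ultimately show ?case using k by (simp only: d_def[symmetric] dist_0_norm dist_commute)
    qed
  qed
  moreover have "(\<lambda>n. complex_of_real (exp (- (\<Sum>i<n. q (w n i)) / 2))) \<longlonglongrightarrow> complex_of_real (exp (- v / 2))"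
    using var unfolding q_def by (intro tendsto_intros) auto
  ultimately show ?thesis by (rule Lim_transform[rotated])
qed

section \<open>Convergence in probability as a filter\<close>

text \<open>
  \<open>W n \<omega>\<close> tends to \<open>c\<close> along this filter iff \<open>W n\<close> converges to \<open>c\<close> in (outer) probability, so that
  the limit calculus for filters covers the continuous mapping theorem for constant limits.
\<close>

definition in_prob :: "'w measure \<Rightarrow> (nat \<times> 'w) filter" where
  "in_prob M = Abs_filter (\<lambda>P. \<forall>d>0. \<forall>\<^sub>F n in sequentially.
     \<exists>A\<in>sets M. measure M A \<le> d \<and> (\<forall>\<omega>\<in>space M - A. P (n, \<omega>)))"

text \<open>The only filter law with content is closure under conjunction: two exceptional sets of
  probability at most d / 2 are united.\<close>

lemma (in prob_space) eventually_in_prob: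
  "eventually P (in_prob M) \<longleftrightarrow> (\<forall>d>0. \<forall>\<^sub>F n in sequentially.
     \<exists>A\<in>sets M. prob A \<le> d \<and> (\<forall>\<omega>\<in>space M - A. P (n, \<omega>)))"
  unfolding in_prob_def
proof (rule eventually_Abs_filter, rule is_filter.intro)
  show "\<forall>d>0. \<forall>\<^sub>F n in sequentially. \<exists>A\<in>sets M. prob A \<le> d \<and> (\<forall>\<omega>\<in>space M - A. True)"
    by (intro allI impI always_eventually bexI[of _ "{}"]) auto
next
  fix P Q :: "nat \<times> 'a \<Rightarrow> bool"
  assume P: "\<forall>d>0. \<forall>\<^sub>F n in sequentially. \<exists>A\<in>sets M. prob A \<le> d \<and> (\<forall>\<omega>\<in>space M - A. P (n, \<omega>))"
    and Q: "\<forall>d>0. \<forall>\<^sub>F n in sequentially. \<exists>A\<in>sets M. prob A \<le> d \<and> (\<forall>\<omega>\<in>space M - A. Q (n, \<omega>))"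
  show "\<forall>d>0. \<forall>\<^sub>F n in sequentially. \<exists>A\<in>sets M. prob A \<le> d \<and> (\<forall>\<omega>\<in>space M - A. P (n, \<omega>) \<and> Q (n, \<omega>))"
  proof (intro allI impI)
    fix d :: real assume "0 < d"
    then have "0 < d / 2" by simp
    with P Q have "\<forall>\<^sub>F n in sequentially. \<exists>A\<in>sets M. prob A \<le> d / 2 \<and> (\<forall>\<omega>\<in>space M - A. P (n, \<omega>))"
      "\<forall>\<^sub>F n in sequentially. \<exists>A\<in>sets M. prob A \<le> d / 2 \<and> (\<forall>\<omega>\<in>space M - A. Q (n, \<omega>))" by blast+
    then show "\<forall>\<^sub>F n in sequentially. \<exists>A\<in>sets M. prob A \<le> d \<and> (\<forall>\<omega>\<in>space M - A. P (n, \<omega>) \<and> Q (n, \<omega>))"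
    proof eventually_elim
      case (elim n)
      then obtain A B where AB: "A \<in> sets M" "prob A \<le> d / 2" "\<forall>\<omega>\<in>space M - A. P (n, \<omega>)"
        "B \<in> sets M" "prob B \<le> d / 2" "\<forall>\<omega>\<in>space M - B. Q (n, \<omega>)" by blast
      then have "prob (A \<union> B) \<le> d" using measure_Un_le[of A M B] by simp
      with AB show ?case by (intro bexI[of _ "A \<union> B"]) auto
    qed
  qed
next
  fix P Q :: "nat \<times> 'a \<Rightarrow> bool"
  assume "\<forall>x. P x \<longrightarrow> Q x"
    and "\<forall>d>0. \<forall>\<^sub>F n in sequentially. \<exists>A\<in>sets M. prob A \<le> d \<and> (\<forall>\<omega>\<in>space M - A. P (n, \<omega>))"
  then show "\<forall>d>0. \<forall>\<^sub>F n in sequentially. \<exists>A\<in>sets M. prob A \<le> d \<and> (\<forall>\<omega>\<in>space M - A. Q (n, \<omega>))"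
    by (blast intro: eventually_mono)
qed

lemma (in prob_space) filterlim_fst_in_prob: "filterlim fst sequentially (in_prob M)"
  unfolding filterlim_iff eventually_in_prob
  by (auto elim!: eventually_mono intro!: bexI[of _ "{}"])

lemma (in prob_space) tendsto_in_prob_const:
  "(f \<longlongrightarrow> l) sequentially \<Longrightarrow> ((\<lambda>p. f (fst p)) \<longlongrightarrow> l) (in_prob M)"
  by (rule filterlim_compose[OF _ filterlim_fst_in_prob])

text \<open>One null set serves every tolerance. This lets identities that hold only almost surely,
  such as those needing a positive definite covariance estimate, be used inside limits.\<close>

lemma (in prob_space) eventually_in_prob_AE:
  assumes "\<forall>\<^sub>F n in sequentially. AE \<omega> in M. P n \<omega>"
  shows "\<forall>\<^sub>F p in in_prob M. P (fst p) (snd p)"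
  unfolding eventually_in_prob
proof (intro allI impI)
  fix d :: real assume "0 < d"
  from assms show "\<forall>\<^sub>F n in sequentially. \<exists>A\<in>sets M. prob A \<le> d \<and> (\<forall>\<omega>\<in>space M - A. P (fst (n, \<omega>)) (snd (n, \<omega>)))"
  proof eventually_elim
    case (elim n)
    then obtain A where "{\<omega> \<in> space M. \<not> P n \<omega>} \<subseteq> A" "emeasure M A = 0" "A \<in> sets M"
      by (rule AE_E)
    with \<open>0 < d\<close> show ?case by (intro bexI[of _ A]) (auto simp: measure_def)
  qed
qed

lemma (in prob_space) tendsto_in_prob_L1:
  fixes W :: "nat \<Rightarrow> 'a \<Rightarrow> real"
  assumes int: "\<forall>\<^sub>F n in sequentially. integrable M (W n)"
    and lim: "(\<lambda>n. expectation (\<lambda>\<omega>. \<bar>W n \<omega>\<bar>)) \<longlonglongrightarrow> 0"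
  shows "((\<lambda>p. W (fst p) (snd p)) \<longlongrightarrow> 0) (in_prob M)"
proof (rule tendstoI)
  fix e :: real assume "0 < e"
  show "\<forall>\<^sub>F p in in_prob M. dist (W (fst p) (snd p)) 0 < e"
    unfolding eventually_in_prob
  proof (intro allI impI)
    fix d :: real assume "0 < d"
    with \<open>0 < e\<close> have "0 < d * e" by simp
    from int order_tendstoD(2)[OF lim this]
    show "\<forall>\<^sub>F n in sequentially. \<exists>A\<in>sets M. prob A \<le> d \<and> (\<forall>\<omega>\<in>space M - A. dist (W (fst (n, \<omega>)) (snd (n, \<omega>))) 0 < e)"
    proof eventually_elim
      case (elim n)
      have [measurable]: "W n \<in> borel_measurable M" using elim by auto
      have "prob {\<omega>\<in>space M. e \<le> \<bar>W n \<omega>\<bar>} \<le> expectation (\<lambda>\<omega>. \<bar>W n \<omega>\<bar>) / e"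
        by (rule integral_Markov_inequality_measure[where A = "{}"]) (use elim \<open>0 < e\<close> in auto)
      also have "\<dots> \<le> d" using elim \<open>0 < e\<close> by (simp add: field_simps)
      finally show ?case by (intro bexI[of _ "{\<omega>\<in>space M. e \<le> \<bar>W n \<omega>\<bar>}"]) auto
    qed
  qed
qed

text \<open>By Markov's inequality an L^2 bound keeps \<open>U\<close> below a fixed level off a set
  of small probability, uniformly in n, so a factor that vanishes in probability wins. No
  measurability of \<open>V\<close> is assumed, in keeping with outer probability.\<close>

lemma (in prob_space) tendsto_in_prob_mult_bounded:
  fixes U V :: "nat \<Rightarrow> 'a \<Rightarrow> real"
  assumes U: "\<forall>\<^sub>F n in sequentially. integrable M (\<lambda>\<omega>. (U n \<omega>)\<^sup>2) \<and> expectation (\<lambda>\<omega>. (U n \<omega>)\<^sup>2) \<le> B"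
    and V: "((\<lambda>p. V (fst p) (snd p)) \<longlongrightarrow> 0) (in_prob M)"
  shows "((\<lambda>p. U (fst p) (snd p) * V (fst p) (snd p)) \<longlongrightarrow> 0) (in_prob M)"
proof (rule tendstoI)
  fix e :: real assume "0 < e"
  show "\<forall>\<^sub>F p in in_prob M. dist (U (fst p) (snd p) * V (fst p) (snd p)) 0 < e"
    unfolding eventually_in_prob
  proof (intro allI impI)
    fix d :: real assume "0 < d"
    \<comment> \<open>The level for the square of \<open>U\<close> at which Markov's inequality
      gives exactly d / 2; \<open>\<bar>B\<bar> + 1\<close> ensures that it is positive.\<close>
    define c where "c = 2 * (\<bar>B\<bar> + 1) / d"
    have "0 < c" using \<open>0 < d\<close> by (simp add: c_def)
    have "0 < e / sqrt c" using \<open>0 < e\<close> \<open>0 < c\<close> by simp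
    from tendstoD[OF V this] \<open>0 < d\<close>
    have "\<forall>\<^sub>F n in sequentially. \<exists>A\<in>sets M. prob A \<le> d / 2 \<and> (\<forall>\<omega>\<in>space M - A. \<bar>V n \<omega>\<bar> < e / sqrt c)"
      unfolding eventually_in_prob by (auto dest!: spec[of _ "d / 2"])
    with U show "\<forall>\<^sub>F n in sequentially. \<exists>A\<in>sets M. prob A \<le> d \<and>
        (\<forall>\<omega>\<in>space M - A. dist (U (fst (n, \<omega>)) (snd (n, \<omega>)) * V (fst (n, \<omega>)) (snd (n, \<omega>))) 0 < e)"
    proof eventually_elim
      case (elim n)
      then obtain A where A: "A \<in> sets M" "prob A \<le> d / 2" "\<And>\<omega>. \<omega> \<in> space M - A \<Longrightarrow> \<bar>V n \<omega>\<bar> < e / sqrt c" by blast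
      have [measurable]: "(\<lambda>\<omega>. (U n \<omega>)\<^sup>2) \<in> borel_measurable M" using elim by auto
      let ?A' = "{\<omega>\<in>space M. c \<le> (U n \<omega>)\<^sup>2}"
      have "prob ?A' \<le> expectation (\<lambda>\<omega>. (U n \<omega>)\<^sup>2) / c"
        by (rule integral_Markov_inequality_measure[where A = "{}"]) (use elim \<open>0 < c\<close> in auto)
      also have "\<dots> \<le> (\<bar>B\<bar> + 1) / c" using elim \<open>0 < c\<close> by (intro divide_right_mono) auto
      also have "\<dots> = d / 2" using \<open>0 < d\<close> by (simp add: c_def field_simps)
      finally have "prob (A \<union> ?A') \<le> d" using A measure_Un_le[of A M ?A'] by simp
      moreover have "\<bar>U n \<omega> * V n \<omega>\<bar> < e" if "\<omega> \<in> space M - (A \<union> ?A')" for \<omega>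
      proof -
        have "\<bar>U n \<omega>\<bar> < sqrt c" using that by (simp add: real_less_rsqrt not_le)
        moreover have "\<bar>V n \<omega>\<bar> < e / sqrt c" using A(3) that by simp
        ultimately have "\<bar>U n \<omega>\<bar> * \<bar>V n \<omega>\<bar> < sqrt c * (e / sqrt c)"
          by (intro mult_strict_mono') auto
        then show ?thesis using \<open>0 < c\<close> by (simp add: abs_mult)
      qed
      ultimately show ?case using A(1) by (intro bexI[of _ "A \<union> ?A'"]) auto
    qed
  qed
qed

text \<open>Bounded convergence: off the exceptional set the integrand is below e / 2, and on it the
  uniform bound \<open>B\<close> is multiplied by a small probability.\<close>

lemma (in prob_space) expectation_tendsto_in_prob:
  fixes W :: "nat \<Rightarrow> 'a \<Rightarrow> 'b::{banach, second_countable_topology}"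
  assumes meas: "\<forall>\<^sub>F n in sequentially. W n \<in> borel_measurable M"
    and B: "\<And>n \<omega>. norm (W n \<omega>) \<le> B"
    and lim: "((\<lambda>p. W (fst p) (snd p)) \<longlongrightarrow> 0) (in_prob M)"
  shows "(\<lambda>n. expectation (W n)) \<longlonglongrightarrow> 0"
proof (rule tendstoI)
  fix e :: real assume "0 < e"
  have "0 \<le> B" using B[of 0 undefined] norm_ge_zero order_trans by blast
  have d: "0 < e / (2 * (B + 1))" using \<open>0 < e\<close> \<open>0 \<le> B\<close> by simp
  from tendstoD[OF lim, of "e / 2"] \<open>0 < e\<close> d
  have "\<forall>\<^sub>F n in sequentially. \<exists>A\<in>sets M. prob A \<le> e / (2 * (B + 1)) \<and> (\<forall>\<omega>\<in>space M - A. norm (W n \<omega>) < e / 2)"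
    unfolding eventually_in_prob by auto
  with meas show "\<forall>\<^sub>F n in sequentially. dist (expectation (W n)) 0 < e"
  proof eventually_elim
    case (elim n)
    then obtain A where A: "A \<in> sets M" "prob A \<le> e / (2 * (B + 1))" "\<And>\<omega>. \<omega> \<in> space M - A \<Longrightarrow> norm (W n \<omega>) < e / 2" by blast
    have int: "integrable M (W n)" using elim B by (intro integrable_const_bound[of _ B]) auto
    have "norm (expectation (W n)) \<le> expectation (\<lambda>\<omega>. norm (W n \<omega>))" by (rule integral_norm_bound)
    also have "\<dots> \<le> expectation (\<lambda>\<omega>. e / 2 + B * indicator A \<omega>)"
    proof (rule integral_mono)
      fix \<omega> assume "\<omega> \<in> space M"
      then show "norm (W n \<omega>) \<le> e / 2 + B * indicator A \<omega>"
        using A(3)[of \<omega>] B[of n \<omega>] \<open>0 < e\<close> by (cases "\<omega> \<in> A") auto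
    qed (use int A(1) in \<open>auto simp: emeasure_eq_measure\<close>)
    also have "\<dots> = e / 2 + B * prob A"
      using A(1) by (simp add: prob_space emeasure_eq_measure)
    also have "B * prob A \<le> B * (e / (2 * (B + 1)))" using A(2) \<open>0 \<le> B\<close> by (rule mult_left_mono)
    also have "\<dots> < e / 2" using \<open>0 \<le> B\<close> \<open>0 < e\<close> by (simp add: field_simps)
    finally show ?case by simp
  qed
qed

section \<open>Matrices\<close>

lemma matrix_inv:
  fixes A :: "real^'n^'n"
  assumes "invertible A"
  shows "A ** matrix_inv A = mat 1" "matrix_inv A ** A = mat 1"
proof -
  have "A ** matrix_inv A = mat 1 \<and> matrix_inv A ** A = mat 1"
    using assms unfolding invertible_def matrix_inv_def by (rule someI_ex)
  then show "A ** matrix_inv A = mat 1" "matrix_inv A ** A = mat 1" by auto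
qed

text \<open>Cramer's rule presents the inverse as a rational function of the entries, from which
  both its continuity and its measurability are derived.\<close>

lemma matrix_inv_cramer:
  fixes A :: "real^'n^'n"
  assumes "det A \<noteq> 0"
  shows "matrix_inv A = (\<chi> k l. det (\<chi> i j. if j = k then (if i = l then 1 else 0) else A $ i $ j) / det A)"
proof -
  have "A ** matrix_inv A = mat 1"
    using assms by (simp add: invertible_det_nz[symmetric] matrix_inv)
  then have "A *v (matrix_inv A *v axis l 1) = axis l 1" for l
    by (simp add: matrix_vector_mul_assoc)
  then have "matrix_inv A *v axis l 1 = (\<chi> k. det (\<chi> i j. if j = k then (axis l 1) $ i else A $ i $ j) / det A)" for l
    by (simp only: cramer[OF assms])
  then have "matrix_inv A $ k $ l = det (\<chi> i j. if j = k then (axis l 1) $ i else A $ i $ j) / det A" for k l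
    by (metis (lifting) matrix_vector_mult_basis column_def vec_lambda_beta)
  then show ?thesis by (simp add: vec_eq_iff axis_def cong: if_cong)
qed

lemma tendsto_det:
  fixes f :: "'b \<Rightarrow> real^'n^'n"
  shows "(f \<longlongrightarrow> A) G \<Longrightarrow> ((\<lambda>x. det (f x)) \<longlongrightarrow> det A) G"
  unfolding det_def by (intro tendsto_intros)

text \<open>A nonzero limit determinant keeps the determinants along the filter eventually nonzero,
  so the Cramer formula is eventually valid there as well.\<close>

lemma tendsto_matrix_inv:
  fixes f :: "'b \<Rightarrow> real^'n^'n"
  assumes f: "(f \<longlongrightarrow> A) G" and "invertible A"
  shows "((\<lambda>x. matrix_inv (f x)) \<longlongrightarrow> matrix_inv A) G"
proof -
  have A: "det A \<noteq> 0" using assms by (simp add: invertible_det_nz)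
  let ?c = "\<lambda>A::real^'n^'n. \<chi> k l. det (\<chi> i j. if j = k then (if i = l then 1 else 0) else A $ i $ j) / det A"
  have "((\<lambda>x. if j = k then (if i = l then 1 else 0) else f x $ i $ j) \<longlongrightarrow>
      (if j = k then (if i = l then 1 else 0) else A $ i $ j)) G" for i j k l
    using f by (auto intro!: tendsto_intros)
  then have "((\<lambda>x. ?c (f x)) \<longlongrightarrow> ?c A) G"
    by (intro vec_tendstoI) (simp, intro tendsto_divide tendsto_det f A vec_tendstoI, simp)
  moreover have "\<forall>\<^sub>F x in G. ?c (f x) = matrix_inv (f x)"
    using tendsto_imp_eventually_ne[OF tendsto_det[OF f] A]
    by eventually_elim (simp add: matrix_inv_cramer)
  ultimately have "((\<lambda>x. matrix_inv (f x)) \<longlongrightarrow> ?c A) G" by (rule Lim_transform_eventually)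
  then show ?thesis by (simp only: matrix_inv_cramer[OF A])
qed

section \<open>Measurability of matrix operations\<close>

lemma borel_measurable_cartI:
  fixes f :: "'w \<Rightarrow> 'a::euclidean_space^'n"
  assumes "\<And>i. (\<lambda>x. f x $ i) \<in> borel_measurable M"
  shows "f \<in> borel_measurable M"
proof (rule borel_measurable_euclidean_space[THEN iffD2], rule ballI)
  fix b :: "'a^'n" assume "b \<in> Basis"
  then obtain i u where "b = axis i u" by (auto simp: Basis_vec_def)
  then have "(\<lambda>x. f x \<bullet> b) = (\<lambda>x. f x $ i \<bullet> u)" by (simp add: inner_axis)
  moreover have "(\<lambda>x. f x $ i \<bullet> u) \<in> borel_measurable M"
    by (rule borel_measurable_inner[OF assms borel_measurable_const])
  ultimately show "(\<lambda>x. f x \<bullet> b) \<in> borel_measurable M" by (simp only:)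
qed

lemma borel_measurable_cart_nth:
  fixes f :: "'w \<Rightarrow> 'a::euclidean_space^'n"
  assumes "f \<in> borel_measurable M"
  shows "(\<lambda>x. f x $ i) \<in> borel_measurable M"
proof -
  have "(\<lambda>y::'a^'n. y $ i) \<in> borel_measurable borel"
    by (intro borel_measurable_continuous_onI continuous_intros)
  from measurable_compose[OF assms this] show ?thesis .
qed

lemma borel_measurable_matrix_iff:
  fixes f :: "'w \<Rightarrow> real^'n^'m"
  shows "f \<in> borel_measurable M \<longleftrightarrow> (\<forall>i j. (\<lambda>x. f x $ i $ j) \<in> borel_measurable M)"
proof (intro iffI allI)
  show "(\<lambda>x. f x $ i $ j) \<in> borel_measurable M" if "f \<in> borel_measurable M" for i j
    by (rule borel_measurable_cart_nth[OF borel_measurable_cart_nth[OF that]])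
  show "f \<in> borel_measurable M" if "\<forall>i j. (\<lambda>x. f x $ i $ j) \<in> borel_measurable M"
    by (rule borel_measurable_cartI, rule borel_measurable_cartI) (rule that[rule_format])
qed

lemma borel_measurable_matrix_mult:
  fixes f :: "'w \<Rightarrow> real^'n^'m" and g :: "'w \<Rightarrow> real^'k^'n"
  assumes "f \<in> borel_measurable M" "g \<in> borel_measurable M"
  shows "(\<lambda>x. f x ** g x) \<in> borel_measurable M"
proof -
  have m: "(\<lambda>x. f x $ i $ j) \<in> borel_measurable M" "(\<lambda>x. g x $ j $ k) \<in> borel_measurable M" for i j k
    by (rule borel_measurable_cart_nth[OF borel_measurable_cart_nth[OF assms(1)]]
        borel_measurable_cart_nth[OF borel_measurable_cart_nth[OF assms(2)]])+
  show ?thesis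
    unfolding borel_measurable_matrix_iff matrix_matrix_mult_def vec_lambda_beta
  proof (intro allI)
    show "(\<lambda>x. \<Sum>k\<in>UNIV. f x $ i $ k * g x $ k $ j) \<in> borel_measurable M" for i j
      by (rule borel_measurable_sum) (rule borel_measurable_times[OF m])
  qed
qed

lemma borel_measurable_det:
  fixes f :: "'w \<Rightarrow> real^'n^'n"
  assumes "f \<in> borel_measurable M"
  shows "(\<lambda>x. det (f x)) \<in> borel_measurable M"
  unfolding det_def
proof (rule borel_measurable_sum)
  fix p
  have 1: "(\<lambda>x. \<Prod>i\<in>UNIV. f x $ i $ p i) \<in> borel_measurable M"
    by (rule borel_measurable_prod) (rule borel_measurable_cart_nth[OF borel_measurable_cart_nth[OF assms]])
  have 2: "(\<lambda>x. of_int (sign p) :: real) \<in> borel_measurable M"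
    by (rule borel_measurable_const)
  show "(\<lambda>x. of_int (sign p) * (\<Prod>i\<in>UNIV. f x $ i $ p i)) \<in> borel_measurable M"
    by (rule borel_measurable_times[OF 2 1])
qed
lemma borel_measurable_matrix_inv:
  fixes f :: "'w \<Rightarrow> real^'n^'n"
  assumes f: "f \<in> borel_measurable M"
  shows "(\<lambda>x. matrix_inv (f x)) \<in> borel_measurable M"
proof -
  let ?c = "\<lambda>A::real^'n^'n. \<chi> k l. det (\<chi> i j. if j = k then (if i = l then 1 else 0) else A $ i $ j) / det A"
  let ?z = "SOME A' :: real^'n^'n. False"
  \<comment> \<open>On singular matrices \<open>matrix_inv\<close> is a constant, being \<open>SOME\<close> of the empty predicate.\<close>
  have eq: "matrix_inv A = (if det A \<noteq> 0 then ?c A else ?z)" for A :: "real^'n^'n"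
  proof (cases "det A = 0")
    case True
    then have "(\<lambda>A'. A ** A' = mat 1 \<and> A' ** A = mat 1) = (\<lambda>A'. False)"
      using invertible_det_nz[of A] unfolding invertible_def by blast
    with True show ?thesis by (simp only: matrix_inv_def) simp
  qed (simp add: matrix_inv_cramer)
  have "(\<lambda>x. (\<chi> i j. if j = k then (if i = l then 1 else 0) else f x $ i $ j) :: real^'n^'n) \<in> borel_measurable M" for k l
    unfolding borel_measurable_matrix_iff vec_lambda_beta
  proof (intro allI)
    show "(\<lambda>x. if j = k then (if i = l then 1 else 0) else f x $ i $ j) \<in> borel_measurable M" for i j
      using borel_measurable_cart_nth[OF borel_measurable_cart_nth[OF f]] by (cases "j = k") simp_all
  qed
  then have d: "(\<lambda>x. det (\<chi> i j. if j = k then (if i = l then 1 else 0) else f x $ i $ j)) \<in> borel_measurable M" for k l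
    by (rule borel_measurable_det)
  have "(\<lambda>x. ?c (f x)) \<in> borel_measurable M"
    unfolding borel_measurable_matrix_iff vec_lambda_beta
    by (intro allI, rule borel_measurable_divide[OF d borel_measurable_det[OF f]])
  moreover have "{x \<in> space M. det (f x) \<noteq> 0} \<in> sets M"
    by (rule borel_measurable_neq[OF borel_measurable_det[OF f] borel_measurable_const])
  ultimately show ?thesis
    unfolding eq by (intro measurable_If borel_measurable_const)
qed

lemma tendsto_matrix_mult:
  fixes f :: "'b \<Rightarrow> real^'n^'m" and g :: "'b \<Rightarrow> real^'k^'n"
  assumes "(f \<longlongrightarrow> A) G" "(g \<longlongrightarrow> B) G"
  shows "((\<lambda>x. f x ** g x) \<longlongrightarrow> A ** B) G"
  unfolding matrix_matrix_mult_def using assms by (intro tendsto_intros)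

section \<open>Adjoints for the entrywise inner product of matrices, and the Kronecker
  product\<close>

lemma inner_matrix_mult_left:
  fixes A :: "real^'n^'m" and B :: "real^'k^'n" and C :: "real^'k^'m"
  shows "(A ** B) \<bullet> C = B \<bullet> (transpose A ** C)"
proof -
  have "(A ** B) \<bullet> C = (\<Sum>i\<in>UNIV. \<Sum>j\<in>UNIV. \<Sum>k\<in>UNIV. A $ i $ k * B $ k $ j * C $ i $ j)"
    by (simp add: inner_vec_def matrix_matrix_mult_def sum_distrib_right)
  also have "\<dots> = (\<Sum>k\<in>UNIV. \<Sum>j\<in>UNIV. \<Sum>i\<in>UNIV. A $ i $ k * B $ k $ j * C $ i $ j)"
    by (subst (2) sum.swap, subst sum.swap, subst (2) sum.swap, rule refl)
  also have "\<dots> = B \<bullet> (transpose A ** C)"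
    by (simp add: inner_vec_def matrix_matrix_mult_def transpose_def sum_distrib_left mult_ac)
  finally show ?thesis .
qed

lemma inner_transpose:
  fixes A B :: "real^'n^'m"
  shows "transpose A \<bullet> transpose B = A \<bullet> B"
  by (simp add: inner_vec_def transpose_def) (rule sum.swap)

lemma inner_matrix_mult_right:
  fixes A :: "real^'n^'m" and B :: "real^'k^'n" and C :: "real^'k^'m"
  shows "(A ** B) \<bullet> C = A \<bullet> (C ** transpose B)"
proof -
  have "(A ** B) \<bullet> C = (transpose B ** transpose A) \<bullet> transpose C"
    by (metis inner_transpose matrix_transpose_mul)
  also have "\<dots> = transpose A \<bullet> transpose (C ** transpose B)"
    by (simp add: inner_matrix_mult_left matrix_transpose_mul)
  finally show ?thesis by (simp only: inner_transpose)
qed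

lemma sum_UNIV_prod: "(\<Sum>p\<in>UNIV. f p) = (\<Sum>i\<in>UNIV. \<Sum>j\<in>UNIV. f (i, j))"
  by (simp add: sum.cartesian_product)

lemma vec_rows_inner: "vec_rows A \<bullet> vec_rows B = A \<bullet> B"
  by (simp add: vec_rows_def inner_vec_def sum_UNIV_prod)

text \<open>With \<open>vec_rows_inner\<close> this turns quadratic forms of a Kronecker product
  into inner products of ordinary matrices, so the proof of the limit theorem can stay with
  matrices.\<close>

lemma kronecker_vec_rows: "kronecker A B *v vec_rows T = vec_rows (A ** T ** transpose B)"
proof -
  have "(\<Sum>i\<in>UNIV. \<Sum>j\<in>UNIV. A $ a $ i * B $ b $ j * T $ i $ j) =
      (\<Sum>j\<in>UNIV. (\<Sum>i\<in>UNIV. A $ a $ i * T $ i $ j) * B $ b $ j)" for a b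
    by (subst sum.swap) (simp add: sum_distrib_left mult_ac)
  then show ?thesis
    by (simp add: vec_eq_iff vec_rows_def kronecker_def matrix_vector_mult_def matrix_matrix_mult_def
        transpose_def sum_UNIV_prod)
qed

lemma transpose_kronecker: "transpose (kronecker A B) = kronecker (transpose A) (transpose B)"
  by (simp add: vec_eq_iff kronecker_def transpose_def)

subsection \<open>Positive definite matrices\<close>

lemma symmetric_inner_commute:
  fixes A :: "real^'n^'n"
  assumes "transpose A = A"
  shows "x \<bullet> (A *v y) = (A *v x) \<bullet> y"
  by (metis assms dot_lmul_matrix vector_transpose_matrix)

text \<open>Cholesky factorisation by removing one pivot at a time. The induction runs over a set
  \<open>I\<close> outside which all rows vanish, and it needs semidefiniteness rather than
  definiteness because removing a pivot leaves a zero row.\<close>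

lemma psd_gram:
  fixes A :: "real^'n^'n"
  assumes "finite I" "transpose A = A" "\<And>v. 0 \<le> v \<bullet> (A *v v)" "\<And>i j. i \<notin> I \<Longrightarrow> A $ i $ j = 0"
  shows "\<exists>b :: 'n \<Rightarrow> real^'n. \<forall>i j. A $ i $ j = (\<Sum>k\<in>I. b k $ i * b k $ j)"
  using assms
proof (induction I arbitrary: A rule: finite_induct)
  case empty
  then show ?case by auto
next
  case (insert k I)
  have sym: "A $ i $ j = A $ j $ i" for i j
    using insert.prems(1) by (metis transpose_def vec_lambda_beta)
  have comm: "x \<bullet> (A *v y) = (A *v x) \<bullet> y" for x y
    using insert.prems(1) by (rule symmetric_inner_commute)
  have Aax: "A *v axis j 1 = A $ j" for j
    by (simp add: vec_eq_iff matrix_vector_mult_basis column_def sym)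
  show ?case
  proof (cases "A $ k $ k = 0")
    case True
    have "A $ k $ j = 0" for j
    proof (rule ccontr)
      assume nz: "A $ k $ j \<noteq> 0"
      \<comment> \<open>Since the pivot is 0, the form at e_j + \<open>t\<close> e_k is affine in
        \<open>t\<close>; this value of \<open>t\<close> makes it -1, contradicting
        semidefiniteness.\<close>
      define t where "t = - (A $ j $ j + 1) / (2 * A $ k $ j)"
      have "(axis j 1 + t *\<^sub>R axis k 1) \<bullet> (A *v (axis j 1 + t *\<^sub>R axis k 1)) = A $ j $ j + 2 * t * A $ k $ j"
        by (simp add: matrix_vector_right_distrib matrix_vector_mult_scaleR Aax inner_add_left inner_add_right
            inner_axis' True sym[of j k])
      also have "\<dots> = - 1" using nz by (simp add: t_def field_simps)
      finally show False using insert.prems(2)[of "axis j 1 + t *\<^sub>R axis k 1"] by simp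
    qed
    then have "A $ i $ j = 0" if "i \<notin> I" for i j
      using insert.prems(3)[of i j] that by (cases "i = k") auto
    from insert.IH[OF insert.prems(1,2) this] obtain b :: "'n \<Rightarrow> real^'n" where
      b: "\<And>i j. A $ i $ j = (\<Sum>k\<in>I. b k $ i * b k $ j)" by blast
    have "A $ i $ j = (\<Sum>l\<in>insert k I. (b(k := 0)) l $ i * (b(k := 0)) l $ j)" for i j
      unfolding b using insert.hyps by (auto intro!: sum.cong)
    then show ?thesis by blast
  next
    case False
    define \<alpha> where "\<alpha> = A $ k $ k"
    have "0 \<le> \<alpha>" using insert.prems(2)[of "axis k 1"] by (simp add: Aax inner_axis' \<alpha>_def)
    then have "0 < \<alpha>" using False by (simp add: \<alpha>_def)
    \<comment> \<open>The Schur complement of the pivot \<open>\<alpha>\<close>; it clears row and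
      column \<open>k\<close>.\<close>
    define A' :: "real^'n^'n" where "A' = (\<chi> i j. A $ i $ j - A $ i $ k * A $ k $ j / \<alpha>)"
    have tr: "transpose A' = A'" by (simp add: vec_eq_iff transpose_def A'_def sym mult.commute)
    have psd: "0 \<le> v \<bullet> (A' *v v)" for v
    proof -
      \<comment> \<open>Completing the square: \<open>c\<close> minimises the form of
        \<open>A\<close> along v - c e_k, and the minimum is the value of the form of
        \<open>A'\<close> at \<open>v\<close>.\<close>
      define c where "c = (A $ k \<bullet> v) / \<alpha>"
      have "A' *v v = A *v v - c *\<^sub>R A $ k"
      proof (rule vec_eq_iff[THEN iffD2], rule allI)
        fix i
        have "(A' *v v) $ i = (\<Sum>j\<in>UNIV. A $ i $ j * v $ j - A $ i $ k / \<alpha> * (A $ k $ j * v $ j))"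
          by (simp add: matrix_vector_mult_def A'_def algebra_simps)
        also have "\<dots> = (A *v v) $ i - A $ i $ k / \<alpha> * (A $ k \<bullet> v)"
          by (simp add: sum_subtractf sum_distrib_left matrix_vector_mult_def inner_vec_def)
        finally show "(A' *v v) $ i = (A *v v - c *\<^sub>R A $ k) $ i" by (simp add: c_def sym)
      qed
      then have "v \<bullet> (A' *v v) = v \<bullet> (A *v v) - c * c * \<alpha>"
        using \<open>0 < \<alpha>\<close> by (simp add: inner_diff_right c_def inner_commute)
      also have "\<dots> = (v - c *\<^sub>R axis k 1) \<bullet> (A *v (v - c *\<^sub>R axis k 1))"
      proof -
        have 1: "axis k 1 \<bullet> (A *v v) = c * \<alpha>"
          unfolding comm[of "axis k 1"] Aax using \<open>0 < \<alpha>\<close> by (simp add: c_def)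
        have 2: "v \<bullet> A $ k = c * \<alpha>" using \<open>0 < \<alpha>\<close> by (simp add: c_def inner_commute)
        have 3: "axis k 1 \<bullet> A $ k = \<alpha>" by (simp add: inner_axis' \<alpha>_def)
        have "A *v (v - c *\<^sub>R axis k 1) = A *v v - c *\<^sub>R A $ k"
          by (simp add: matrix_vector_mult_diff_distrib matrix_vector_mult_scaleR Aax)
        then show ?thesis
          by (simp add: inner_diff_left inner_diff_right 1 2 3)
      qed
      finally show ?thesis using insert.prems(2) by simp
    qed
    have "A' $ i $ j = 0" if "i \<notin> I" for i j
      using insert.prems(3)[of i] that \<open>0 < \<alpha>\<close> by (cases "i = k") (auto simp: A'_def \<alpha>_def)
    from insert.IH[OF tr psd this] obtain b :: "'n \<Rightarrow> real^'n" where
      b: "\<And>i j. A' $ i $ j = (\<Sum>k\<in>I. b k $ i * b k $ j)" by blast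
    \<comment> \<open>The rank-one part removed by the Schur complement is the outer square of this
      vector.\<close>
    define b' where "b' = b(k := (1 / sqrt \<alpha>) *\<^sub>R A $ k)"
    have "A $ i $ j = (\<Sum>l\<in>insert k I. b' l $ i * b' l $ j)" for i j
    proof -
      have "(\<Sum>l\<in>insert k I. b' l $ i * b' l $ j) = A $ k $ i * A $ k $ j / \<alpha> + (\<Sum>l\<in>I. b' l $ i * b' l $ j)"
        using insert.hyps \<open>0 < \<alpha>\<close> by (simp add: b'_def)
      also have "(\<Sum>l\<in>I. b' l $ i * b' l $ j) = (\<Sum>l\<in>I. b l $ i * b l $ j)"
        using insert.hyps by (intro sum.cong) (auto simp: b'_def)
      also have "\<dots> = A' $ i $ j" by (simp add: b)
      finally show ?thesis by (simp add: A'_def sym)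
    qed
    then show ?thesis by blast
  qed
qed

lemma pos_def_psd: "pos_def A \<Longrightarrow> 0 \<le> v \<bullet> (A *v v)"
  unfolding pos_def_def by (cases "v = 0") (auto intro: less_imp_le)

text \<open>The Gram vectors become the columns of the factor. It serves to write the limit law as a
  linear image of a standard Gaussian matrix.\<close>

lemma pos_def_factor:
  fixes A :: "real^'n^'n"
  assumes "pos_def A"
  obtains B :: "real^'n^'n" where "A = B ** transpose B"
proof -
  have "\<exists>b :: 'n \<Rightarrow> real^'n. \<forall>i j. A $ i $ j = (\<Sum>k\<in>UNIV. b k $ i * b k $ j)"
    using assms by (intro psd_gram pos_def_psd) (auto simp: pos_def_def)
  then obtain b :: "'n \<Rightarrow> real^'n" where "\<And>i j. A $ i $ j = (\<Sum>k\<in>UNIV. b k $ i * b k $ j)" by blast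
  then have "A = (\<chi> i k. b k $ i) ** transpose (\<chi> i k. b k $ i)"
    by (simp add: vec_eq_iff matrix_matrix_mult_def transpose_def)
  then show ?thesis by (rule that)
qed

lemma pos_def_invertible:
  fixes A :: "real^'n^'n"
  assumes "pos_def A"
  shows "invertible A"
  unfolding invertible_left_inverse matrix_left_invertible_ker
  using assms by (metis inner_zero_right less_irrefl pos_def_def)

lemma pos_def_matrix_inv:
  fixes A :: "real^'n^'n"
  assumes "pos_def A"
  shows "pos_def (matrix_inv A)"
proof -
  note inv = matrix_inv[OF pos_def_invertible[OF assms]]
  have tr: "transpose A = A" using assms by (simp add: pos_def_def)
  have "transpose (matrix_inv A) = transpose (matrix_inv A) ** (A ** matrix_inv A)"
    by (simp add: inv)
  also have "\<dots> = transpose (A ** matrix_inv A) ** matrix_inv A"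
    by (simp add: matrix_transpose_mul tr matrix_mul_assoc)
  finally have sym: "transpose (matrix_inv A) = matrix_inv A" by (simp add: inv)
  have "0 < v \<bullet> (matrix_inv A *v v)" if "v \<noteq> 0" for v
  proof -
    define u where "u = matrix_inv A *v v"
    have v: "v = A *v u" by (simp add: u_def matrix_vector_mul_assoc inv)
    then have "u \<noteq> 0" using that by auto
    then have "0 < u \<bullet> (A *v u)" using assms by (simp add: pos_def_def)
    then show ?thesis by (simp add: v[symmetric] u_def[symmetric] inner_commute)
  qed
  with sym show ?thesis by (simp add: pos_def_def)
qed

lemma pos_def_congruence:
  fixes A :: "real^'n^'n" and Z :: "real^'k^'n"
  assumes "pos_def A" "rank Z = CARD('k)"
  shows "pos_def (transpose Z ** A ** Z)"
proof -
  have "0 < v \<bullet> ((transpose Z ** A ** Z) *v v)" if "v \<noteq> 0" for v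
  proof -
    have "inj ((*v) Z)" using assms(2) by (simp add: full_rank_injective)
    then have "Z *v v \<noteq> 0" using that by (metis injD matrix_vector_mult_0_right)
    then have "0 < (Z *v v) \<bullet> (A *v (Z *v v))" using assms(1) by (simp add: pos_def_def)
    also have "\<dots> = v \<bullet> (transpose Z *v (A *v (Z *v v)))"
      by (metis dot_lmul_matrix inner_commute vector_transpose_matrix)
    finally show ?thesis by (simp add: matrix_vector_mul_assoc matrix_mul_assoc)
  qed
  then show ?thesis using assms(1) by (simp add: pos_def_def matrix_transpose_mul matrix_mul_assoc)
qed

section \<open>The growth curve estimators\<close>

lemma matrix_mult_scaleR_left: "(c *\<^sub>R A) ** B = c *\<^sub>R (A ** B)" for A :: "real^'n^'m"
  by (simp add: vec_eq_iff matrix_matrix_mult_def sum_distrib_left mult_ac)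

lemma matrix_mult_scaleR_right: "A ** (c *\<^sub>R B) = c *\<^sub>R (A ** B)" for A :: "real^'n^'m"
  by (simp add: vec_eq_iff matrix_matrix_mult_def sum_distrib_left mult_ac)

lemma matrix_mult_add_left: "(A + B) ** C = A ** C + B ** C" for A :: "real^'n^'m"
  by (simp add: vec_eq_iff matrix_matrix_mult_def algebra_simps sum.distrib)

lemma matrix_inv_unique:
  fixes A :: "real^'n^'n"
  assumes "A ** B = mat 1"
  shows "matrix_inv A = B"
proof -
  have "invertible A" using assms invertible_right_inverse by blast
  then have "matrix_inv A ** (A ** B) = B"
    by (simp add: matrix_mul_assoc matrix_inv)
  then show ?thesis by (simp add: assms)
qed

lemma matrix_inv_scaleR:
  fixes A :: "real^'n^'n"
  assumes "invertible A" "c \<noteq> 0"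
  shows "matrix_inv (c *\<^sub>R A) = (1 / c) *\<^sub>R matrix_inv A"
  using assms by (intro matrix_inv_unique)
    (simp add: matrix_mult_scaleR_left matrix_mult_scaleR_right matrix_inv)

section \<open>Cross products of matrices with a variable number of rows\<close>

lemma tmult_nth: "tmult n A B $ a $ b = (\<Sum>i<n. A i $ a * B i $ b)"
  by (simp add: tmult_def)

lemma tmult_cong: "(\<And>i. i < n \<Longrightarrow> A i = A' i) \<Longrightarrow> (\<And>i. i < n \<Longrightarrow> B i = B' i) \<Longrightarrow> tmult n A B = tmult n A' B'"
  by (simp add: tmult_def)

lemma transpose_tmult: "transpose (tmult n A B) = tmult n B A"
  by (simp add: vec_eq_iff transpose_def tmult_nth mult.commute)

lemma tmult_add_right: "tmult n A (\<lambda>i. B i + C i) = tmult n A B + tmult n A C"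
  by (simp add: vec_eq_iff tmult_nth algebra_simps sum.distrib)

lemma tmult_diff_right: "tmult n A (\<lambda>i. B i - C i) = tmult n A B - tmult n A C"
  by (simp add: vec_eq_iff tmult_nth algebra_simps sum_subtractf)

lemma tmult_scaleR_right: "tmult n A (\<lambda>i. c *\<^sub>R B i) = c *\<^sub>R tmult n A B"
  by (simp add: vec_eq_iff tmult_nth sum_distrib_left mult_ac)

lemma tmult_matrix_right: "tmult n A (\<lambda>i. B i v* K) = tmult n A B ** K"
  unfolding vec_eq_iff tmult_nth vector_matrix_mult_def matrix_matrix_mult_def vec_lambda_beta sum_distrib_left
    sum_distrib_right
  by (subst sum.swap) (simp add: mult_ac)

lemma tmult_add_left: "tmult n (\<lambda>i. A i + B i) C = tmult n A C + tmult n B C"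
  by (simp add: vec_eq_iff tmult_nth algebra_simps sum.distrib)

lemma tmult_matrix_left: "tmult n (\<lambda>i. A i v* K) B = transpose K ** tmult n A B"
  by (metis matrix_transpose_mul tmult_matrix_right transpose_tmult)

lemma inner_tmult: "A \<bullet> tmult n X E = (\<Sum>i<n. (X i v* A) \<bullet> E i)"
proof -
  have "A \<bullet> tmult n X E = (\<Sum>a\<in>UNIV. \<Sum>b\<in>UNIV. \<Sum>i<n. A $ a $ b * (X i $ a * E i $ b))"
    by (simp add: inner_vec_def tmult_nth sum_distrib_left)
  also have "\<dots> = (\<Sum>i<n. \<Sum>b\<in>UNIV. \<Sum>a\<in>UNIV. A $ a $ b * (X i $ a * E i $ b))"
    by (subst sum.swap, subst (2) sum.swap, subst sum.swap, rule refl)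
  also have "\<dots> = (\<Sum>i<n. (X i v* A) \<bullet> E i)"
    by (simp add: inner_vec_def vector_matrix_mult_def sum_distrib_left mult_ac)
  finally show ?thesis .
qed

text \<open>The form at \<open>v\<close> is the sum of the squares of
  \<open>X i \<bullet> v\<close>; if all of these vanish, \<open>v\<close> is orthogonal to a
  spanning set and hence 0.\<close>

lemma pos_def_tmult:
  fixes X :: "nat \<Rightarrow> real^'m"
  assumes "rows_rank n X = CARD('m)"
  shows "pos_def (tmult n X X)"
proof -
  have "0 < v \<bullet> (tmult n X X *v v)" if "v \<noteq> 0" for v
  proof -
    have "(tmult n X X *v v) = (\<Sum>i<n. (X i \<bullet> v) *\<^sub>R X i)"
    proof -
      have "(tmult n X X *v v) $ a = (\<Sum>i<n. (X i \<bullet> v) *\<^sub>R X i) $ a" for a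
        unfolding matrix_vector_mult_def tmult_nth vec_lambda_beta sum_distrib_right
        by (subst sum.swap) (simp add: inner_vec_def sum_distrib_left mult_ac)
      then show ?thesis by (simp add: vec_eq_iff)
    qed
    then have eq: "v \<bullet> (tmult n X X *v v) = (\<Sum>i<n. (X i \<bullet> v)\<^sup>2)"
      by (simp add: inner_sum_right power2_eq_square inner_commute)
    have "\<exists>i<n. X i \<bullet> v \<noteq> 0"
    proof (rule ccontr)
      assume "\<not> (\<exists>i<n. X i \<bullet> v \<noteq> 0)"
      then have "\<And>x. x \<in> X ` {..<n} \<Longrightarrow> orthogonal v x" by (auto simp: orthogonal_def inner_commute)
      moreover have "span (X ` {..<n}) = UNIV"
        using assms by (simp add: rows_rank_def dim_eq_full[symmetric])
      ultimately have "orthogonal v v" using orthogonal_to_span[of v "X ` {..<n}" v] by auto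
      with that show False by (simp add: orthogonal_self)
    qed
    then show ?thesis unfolding eq by (auto intro!: sum_pos2)
  qed
  then show ?thesis by (simp add: pos_def_def transpose_tmult)
qed

lemma sqmult_proj_mat:
  "sqmult n (proj_mat n X) A i = X i v* (matrix_inv (tmult n X X) ** tmult n X A)"
proof -
  let ?H = "matrix_inv (tmult n X X)"
  have "sqmult n (proj_mat n X) A i $ b = ((X i v* ?H) v* tmult n X A) $ b" for b
  proof -
    have "sqmult n (proj_mat n X) A i $ b = (\<Sum>j<n. ((X i v* ?H) \<bullet> X j) * A j $ b)"
      by (simp add: sqmult_def proj_mat_def dot_lmul_matrix)
    also have "\<dots> = (\<Sum>k\<in>UNIV. \<Sum>j<n. (X i v* ?H) $ k * X j $ k * A j $ b)"
      unfolding inner_vec_def by (subst sum.swap) (simp add: sum_distrib_right)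
    also have "\<dots> = ((X i v* ?H) v* tmult n X A) $ b"
      by (subst (3) vector_matrix_mult_def) (simp add: tmult_nth sum_distrib_left mult_ac)
    finally show ?thesis .
  qed
  then show ?thesis by (simp add: vec_eq_iff vector_matrix_mul_assoc)
qed

text \<open>Eliminates the n x n weight matrix in favour of products of fixed size, to which the
  results on limits and measurability apply.\<close>

lemma Sigma_hat_eq:
  "Sigma_hat n X Y = (1 / real (n - rows_rank n X)) *\<^sub>R
     (tmult n Y Y - tmult n Y X ** matrix_inv (tmult n X X) ** tmult n X Y)"
proof -
  have "sqmult n (weight_mat n X) Y i =
      (1 / real (n - rows_rank n X)) *\<^sub>R (Y i - X i v* (matrix_inv (tmult n X X) ** tmult n X Y))" if "i < n" for i
  proof -
    have "sqmult n (weight_mat n X) Y i = (\<Sum>j<n. (1 / real (n - rows_rank n X)) *\<^sub>R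
        ((if i = j then Y j else 0) - proj_mat n X i j *\<^sub>R Y j))"
      unfolding sqmult_def weight_mat_def
      by (intro sum.cong refl) (auto simp: algebra_simps)
    also have "\<dots> = (1 / real (n - rows_rank n X)) *\<^sub>R ((\<Sum>j<n. if i = j then Y j else 0) - sqmult n (proj_mat n X) Y i)"
      by (simp only: scaleR_sum_right[symmetric] sum_subtractf sqmult_def)
    finally show ?thesis using that by (simp add: sqmult_proj_mat)
  qed
  then have "Sigma_hat n X Y = tmult n Y (\<lambda>i. (1 / real (n - rows_rank n X)) *\<^sub>R
      (Y i - X i v* (matrix_inv (tmult n X X) ** tmult n X Y)))"
    unfolding Sigma_hat_def by (intro tmult_cong) auto
  then show ?thesis
    by (simp only: tmult_scaleR_right tmult_diff_right tmult_matrix_right matrix_mul_assoc)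
qed

definition gls_gain :: "real^'q^'p \<Rightarrow> real^'p^'p \<Rightarrow> real^'q^'p" where
  "gls_gain Z S = matrix_inv S ** Z ** matrix_inv (transpose Z ** matrix_inv S ** Z)"

lemma gls_gain_left_inverse:
  fixes Z :: "real^'q^'p"
  assumes "pos_def S" "rank Z = CARD('q)"
  shows "transpose Z ** gls_gain Z S = mat 1"
proof -
  have "invertible (transpose Z ** matrix_inv S ** Z)"
    by (intro pos_def_invertible pos_def_congruence pos_def_matrix_inv assms)
  from matrix_inv(1)[OF this] show ?thesis by (simp add: gls_gain_def matrix_mul_assoc)
qed

text \<open>The sandwich collapses: with H the inverse on the right, the transposed gain is H Z'
  S^-1, so S cancels and Z' times the gain is the identity.\<close>

lemma gls_gain_covariance:
  fixes Z :: "real^'q^'p"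
  assumes "pos_def S" "rank Z = CARD('q)"
  shows "transpose (gls_gain Z S) ** S ** gls_gain Z S = matrix_inv (transpose Z ** matrix_inv S ** Z)"
proof -
  let ?H = "matrix_inv (transpose Z ** matrix_inv S ** Z)"
  have "pos_def ?H" "pos_def (matrix_inv S)"
    by (intro pos_def_congruence pos_def_matrix_inv assms)+
  then have "transpose (gls_gain Z S) = ?H ** transpose Z ** matrix_inv S"
    by (simp add: gls_gain_def matrix_transpose_mul matrix_mul_assoc pos_def_def)
  then have "transpose (gls_gain Z S) ** S ** gls_gain Z S = ?H ** transpose Z ** (matrix_inv S ** S) ** gls_gain Z S"
    by (simp only: matrix_mul_assoc)
  also have "\<dots> = ?H ** (transpose Z ** gls_gain Z S)"
    by (simp add: matrix_inv[OF pos_def_invertible[OF assms(1)]] matrix_mul_assoc)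
  finally show ?thesis by (simp add: gls_gain_left_inverse[OF assms])
qed

text \<open>Both inversions are continuous at a positive definite limit; the values of
  \<open>f\<close> themselves may be arbitrary matrices.\<close>

lemma tendsto_gls_gain:
  fixes Z :: "real^'q^'p"
  assumes f: "(f \<longlongrightarrow> S) G" and "pos_def S" "rank Z = CARD('q)"
  shows "((\<lambda>x. gls_gain Z (f x)) \<longlongrightarrow> gls_gain Z S) G"
  unfolding gls_gain_def
  by (intro tendsto_matrix_mult tendsto_matrix_inv tendsto_const f pos_def_invertible pos_def_congruence
      pos_def_matrix_inv assms)

section \<open>Exact identities for one sample size and one realisation \<open>e\<close> of the
  errors\<close>

context
  fixes n :: nat and X :: "nat \<Rightarrow> real^'m" and Z :: "real^'q^'p" and \<Theta> :: "real^'q^'m"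
    and Y e :: "nat \<Rightarrow> real^'p"
  assumes rank_X: "rows_rank n X = CARD('m)"
    and model: "\<And>i. i < n \<Longrightarrow> Y i = X i v* (\<Theta> ** transpose Z) + e i"
    and n: "0 < n"
begin

lemma tmult_X_Y: "tmult n X Y = tmult n X X ** (\<Theta> ** transpose Z) + tmult n X e"
proof -
  have "tmult n X Y = tmult n X (\<lambda>i. X i v* (\<Theta> ** transpose Z) + e i)"
    by (rule tmult_cong) (simp_all add: model)
  then show ?thesis by (simp add: tmult_add_right tmult_matrix_right)
qed

lemma gamma_hat_error:
  fixes C :: "real^'m^'s" and D :: "real^'q^'t"
  assumes "pos_def (Sigma_hat n X Y)" "rank Z = CARD('q)"
  shows "sqrt (real n) *\<^sub>R (gamma_hat C D Z n X Y - C ** \<Theta> ** transpose D) =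
    C ** matrix_inv ((1 / real n) *\<^sub>R tmult n X X) ** ((1 / sqrt (real n)) *\<^sub>R tmult n X e)
      ** gls_gain Z (Sigma_hat n X Y) ** transpose D"
proof -
  let ?G = "gls_gain Z (Sigma_hat n X Y)"
  note inv = pos_def_invertible[OF pos_def_tmult[OF rank_X]]
  have "gamma_hat C D Z n X Y = C ** (matrix_inv (tmult n X X) ** tmult n X Y) ** ?G ** transpose D"
    by (simp add: gamma_hat_def gls_gain_def Let_def matrix_mul_assoc)
  also have "matrix_inv (tmult n X X) ** tmult n X Y =
      \<Theta> ** transpose Z + matrix_inv (tmult n X X) ** tmult n X e"
    by (simp add: tmult_X_Y matrix_add_ldistrib matrix_mul_assoc matrix_inv[OF inv])
  finally have "gamma_hat C D Z n X Y = C ** \<Theta> ** (transpose Z ** ?G) ** transpose D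
      + C ** (matrix_inv (tmult n X X) ** tmult n X e) ** ?G ** transpose D"
    by (simp add: matrix_add_ldistrib matrix_mult_add_left matrix_mul_assoc)
  then have "gamma_hat C D Z n X Y - C ** \<Theta> ** transpose D =
      C ** (matrix_inv (tmult n X X) ** tmult n X e) ** ?G ** transpose D"
    by (simp add: gls_gain_left_inverse[OF assms])
  moreover have "matrix_inv ((1 / real n) *\<^sub>R tmult n X X) = real n *\<^sub>R matrix_inv (tmult n X X)"
    using n by (simp add: matrix_inv_scaleR[OF inv])
  \<comment> \<open>The factor n normalises the inverse of X'X, and the remaining 1 / sqrt n
    normalises X'e.\<close>
  moreover have "sqrt (real n) = real n * (1 / sqrt (real n))"
    using n by (simp add: real_div_sqrt)
  ultimately show ?thesis
    by (simp add: matrix_mult_scaleR_left matrix_mult_scaleR_right matrix_mul_assoc)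
qed

text \<open>The mean of the observations lies in the column space of X, which the residual
  projection annihilates, so the unknown \<open>\<Theta>\<close> drops out. In terms of
  \<open>U\<close> the correction carries an explicit factor 1 / n.\<close>

lemma Sigma_hat_error:
  defines "U \<equiv> (1 / sqrt (real n)) *\<^sub>R tmult n X e"
  shows "Sigma_hat n X Y = (real n / real (n - CARD('m))) *\<^sub>R
    ((1 / real n) *\<^sub>R tmult n e e
      - (1 / real n) *\<^sub>R (transpose U ** matrix_inv ((1 / real n) *\<^sub>R tmult n X X) ** U))"
proof -
  let ?K = "\<Theta> ** transpose Z" and ?A = "tmult n X X" and ?B = "tmult n X e"
  note inv = matrix_inv[OF pos_def_invertible[OF pos_def_tmult[OF rank_X]]]
  have YX: "tmult n Y X = transpose ?K ** ?A + transpose ?B"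
  proof -
    have "tmult n Y X = transpose (?A ** ?K + ?B)"
      by (simp only: tmult_X_Y[symmetric] transpose_tmult)
    also have "\<dots> = transpose (?A ** ?K) + transpose ?B"
      by (simp add: transpose_def vec_eq_iff)
    also have "transpose (?A ** ?K) = transpose ?K ** ?A"
      by (simp only: matrix_transpose_mul[of ?A ?K] transpose_tmult)
    finally show ?thesis .
  qed
  have "tmult n Y Y = tmult n Y (\<lambda>i. X i v* ?K + e i)"
    by (rule tmult_cong) (simp_all add: model)
  also have "\<dots> = tmult n Y X ** ?K + tmult n Y e"
    by (simp add: tmult_add_right tmult_matrix_right)
  also have "tmult n Y e = tmult n (\<lambda>i. X i v* ?K + e i) e"
    by (rule tmult_cong) (simp_all add: model)
  also have "\<dots> = transpose ?K ** ?B + tmult n e e"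
    by (simp only: tmult_add_left tmult_matrix_left)
  finally have YY: "tmult n Y Y = tmult n Y X ** ?K + (transpose ?K ** ?B + tmult n e e)" .
  have "tmult n Y X ** matrix_inv ?A = transpose ?K + transpose ?B ** matrix_inv ?A"
    by (simp add: YX matrix_mult_add_left inv flip: matrix_mul_assoc)
  then have "tmult n Y X ** matrix_inv ?A ** tmult n X Y =
      tmult n Y X ** matrix_inv ?A ** ?A ** ?K + (transpose ?K + transpose ?B ** matrix_inv ?A) ** ?B"
    by (simp add: tmult_X_Y matrix_add_ldistrib matrix_mul_assoc)
  also have "tmult n Y X ** matrix_inv ?A ** ?A ** ?K = tmult n Y X ** ?K"
    by (metis inv(2) matrix_mul_assoc matrix_mul_rid)
  finally have "tmult n Y Y - tmult n Y X ** matrix_inv ?A ** tmult n X Y =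
      tmult n e e - transpose ?B ** matrix_inv ?A ** ?B"
    by (simp add: YY matrix_mult_add_left)
  then have *: "Sigma_hat n X Y = (1 / real (n - CARD('m))) *\<^sub>R (tmult n e e - transpose ?B ** matrix_inv ?A ** ?B)"
    by (simp add: Sigma_hat_eq rank_X)
  have "matrix_inv ((1 / real n) *\<^sub>R ?A) = real n *\<^sub>R matrix_inv ?A"
    using n by (simp add: matrix_inv_scaleR[OF pos_def_invertible[OF pos_def_tmult[OF rank_X]]])
  moreover have "transpose U = (1 / sqrt (real n)) *\<^sub>R transpose ?B"
    by (simp add: U_def vec_eq_iff transpose_def)
  ultimately have "transpose U ** matrix_inv ((1 / real n) *\<^sub>R ?A) ** U = transpose ?B ** matrix_inv ?A ** ?B"
    using n by (simp add: U_def matrix_mult_scaleR_left matrix_mult_scaleR_right)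
  then show ?thesis
    using n by (simp add: * scaleR_diff_right)
qed

end

section \<open>The normalised score\<close>

lemma abs_mult_le_sum_squares: "\<bar>u * v\<bar> \<le> \<bar>u\<^sup>2 + v\<^sup>2\<bar>" for u v :: real
proof -
  have "2 * (\<bar>u\<bar> * \<bar>v\<bar>) \<le> u\<^sup>2 + v\<^sup>2" using sum_squares_bound[of "\<bar>u\<bar>" "\<bar>v\<bar>"] by (simp add: mult.assoc)
  moreover have "0 \<le> \<bar>u\<bar> * \<bar>v\<bar>" by simp
  ultimately show ?thesis unfolding abs_mult by linarith
qed

text \<open>Row 0 of a nonempty sample represents the common law, so the moment assumptions on
  \<open>M\<close> become statements about \<open>F\<close>, free of n.\<close>

lemma growth_errors_law:
  fixes \<epsilon> :: "nat \<Rightarrow> nat \<Rightarrow> 'w \<Rightarrow> real^'p"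
  assumes "prob_space M" and ge: "growth_errors M n \<epsilon> F \<Sigma>" and n: "0 < n"
  shows "prob_space F" "sets F = sets borel" "integrable F (\<lambda>x. (norm x)\<^sup>2)" "(\<integral>x. a \<bullet> x \<partial>F) = 0"
    "integrable F (\<lambda>x. x $ k * x $ l)" "(\<integral>x. x $ k * x $ l \<partial>F) = \<Sigma> $ k $ l"
    "(\<integral>x. (w \<bullet> x)\<^sup>2 \<partial>F) = w \<bullet> (\<Sigma> *v w)"
proof -
  interpret prob_space M by fact
  have m [measurable]: "\<epsilon> n 0 \<in> borel_measurable M"
    using ge n by (simp add: growth_errors_def indep_vars_def2)
  have F: "F = distr M borel (\<epsilon> n 0)" using ge n by (simp add: growth_errors_def)
  have mean: "(\<integral>\<omega>. \<epsilon> n 0 \<omega> $ k \<partial>M) = 0" for k using ge n by (simp add: growth_errors_def)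
  have sqM: "integrable M (\<lambda>\<omega>. (\<epsilon> n 0 \<omega> $ k)\<^sup>2)" for k using ge n by (simp add: growth_errors_def)
  interpret F: prob_space F unfolding F by (rule prob_space_distr) simp
  show "prob_space F" "sets F = sets borel" by (rule F.prob_space_axioms) (simp add: F)
  have sq: "integrable F (\<lambda>x. (x $ k)\<^sup>2)" for k
    unfolding F using sqM by (subst integrable_distr_eq) auto
  have "(\<lambda>x :: real^'p. (norm x)\<^sup>2) = (\<lambda>x. \<Sum>k\<in>UNIV. (x $ k)\<^sup>2)"
    unfolding power2_norm_eq_inner by (simp add: inner_vec_def power2_eq_square)
  then show "integrable F (\<lambda>x. (norm x)\<^sup>2)" using sq by auto
  have prod: "integrable F (\<lambda>x. x $ k * x $ l)" for k l
  proof (rule Bochner_Integration.integrable_bound)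
    show "integrable F (\<lambda>x. (x $ k)\<^sup>2 + (x $ l)\<^sup>2)" using sq by auto
    show "(\<lambda>x. x $ k * x $ l) \<in> borel_measurable F" unfolding F by simp
    show "AE x in F. norm (x $ k * x $ l) \<le> norm ((x $ k)\<^sup>2 + (x $ l)\<^sup>2)"
      unfolding real_norm_def by (intro AE_I2 abs_mult_le_sum_squares)
  qed
  then show "integrable F (\<lambda>x. x $ k * x $ l)" .
  have lin: "integrable F (\<lambda>x. x $ k)" for k
    by (rule F.square_integrable_imp_integrable[OF _ sq]) (simp add: F)
  have meanF: "(\<integral>x. x $ k \<partial>F) = 0" for k unfolding F by (subst integral_distr) (auto simp: mean)
  have "(\<integral>x. a \<bullet> x \<partial>F) = (\<integral>x. (\<Sum>k\<in>UNIV. a $ k * x $ k) \<partial>F)" by (simp add: inner_vec_def)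
  also have "\<dots> = 0" using lin by (subst Bochner_Integration.integral_sum) (auto simp: meanF)
  finally show "(\<integral>x. a \<bullet> x \<partial>F) = 0" .
  have cv: "(\<integral>x. x $ k * x $ l \<partial>F) = \<Sigma> $ k $ l" for k l
  proof -
    have "(\<integral>x. x $ k * x $ l \<partial>F) = (\<integral>\<omega>. \<epsilon> n 0 \<omega> $ k * \<epsilon> n 0 \<omega> $ l \<partial>M)"
      unfolding F by (subst integral_distr) auto
    also have "\<dots> = cov M (\<lambda>\<omega>. \<epsilon> n 0 \<omega> $ k) (\<lambda>\<omega>. \<epsilon> n 0 \<omega> $ l)" by (simp add: cov_def mean)
    also have "\<dots> = \<Sigma> $ k $ l" using ge n by (simp add: growth_errors_def)
    finally show ?thesis .
  qed
  then show "(\<integral>x. x $ k * x $ l \<partial>F) = \<Sigma> $ k $ l" .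
  have "(\<integral>x. (w \<bullet> x)\<^sup>2 \<partial>F) = (\<integral>x. (\<Sum>k\<in>UNIV. \<Sum>l\<in>UNIV. w $ k * w $ l * (x $ k * x $ l)) \<partial>F)"
    by (simp add: inner_vec_def power2_eq_square sum_product mult_ac)
  also have "\<dots> = (\<Sum>k\<in>UNIV. \<Sum>l\<in>UNIV. w $ k * w $ l * \<Sigma> $ k $ l)"
    using prod by (simp add: Bochner_Integration.integral_sum cv)
  also have "\<dots> = w \<bullet> (\<Sigma> *v w)"
    by (simp add: inner_vec_def matrix_vector_mult_def sum_distrib_left mult_ac)
  finally show "(\<integral>x. (w \<bullet> x)\<^sup>2 \<partial>F) = w \<bullet> (\<Sigma> *v w)" .
qed

text \<open>Late indices satisfy the bound because i + 1 <= n; the finitely many early ones are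
  bounded by a constant, which d * n eventually exceeds.\<close>

lemma eventually_le_linear:
  fixes b :: "nat \<Rightarrow> real"
  assumes lim: "(\<lambda>n. b n / real (Suc n)) \<longlonglongrightarrow> 0" and "0 < d"
  shows "\<forall>\<^sub>F n in sequentially. \<forall>i<n. b i \<le> d * real n"
proof -
  from order_tendstoD(2)[OF lim \<open>0 < d\<close>] obtain N where N: "\<And>i. i \<ge> N \<Longrightarrow> b i / real (Suc i) < d"
    by (auto simp: eventually_sequentially)
  \<comment> \<open>The inserted 0 keeps the set nonempty when \<open>N\<close> = 0.\<close>
  define B where "B = Max (insert 0 (b ` {..<N}))"
  have B: "b i \<le> B" if "i < N" for i using that unfolding B_def by (intro Max_ge) auto
  obtain K :: nat where K: "B / d \<le> real K" using real_arch_simple by blast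
  show ?thesis
  proof (rule eventually_sequentiallyI[of K], intro allI impI)
    fix n i :: nat assume "K \<le> n" "i < n"
    show "b i \<le> d * real n"
    proof (cases "i < N")
      case True
      have "B \<le> d * real K" using K \<open>0 < d\<close> by (simp add: field_simps)
      also have "\<dots> \<le> d * real n" using \<open>K \<le> n\<close> \<open>0 < d\<close> by simp
      finally show ?thesis using B[OF True] by simp
    next
      case False
      then have "b i \<le> d * real (Suc i)" using N[of i] by (simp add: field_simps)
      also have "\<dots> \<le> d * real n" using \<open>i < n\<close> \<open>0 < d\<close> by (intro mult_left_mono) auto
      finally show ?thesis .
    qed
  qed
qed

text \<open>Since the rows of \<open>X\<close> do not depend on \<open>n\<close>, convergence of \<open>X'X / n\<close> makes every single row negligible.\<close>

lemma rows_negligible: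
  fixes X :: "nat \<Rightarrow> real^'m"
  assumes R: "(\<lambda>n. (1 / real n) *\<^sub>R tmult n X X) \<longlonglongrightarrow> R" and "0 < d"
  shows "\<forall>\<^sub>F n in sequentially. \<forall>i<n. (norm (X i))\<^sup>2 \<le> d * real n"
proof -
  define s where "s n = (\<Sum>i<n. (norm (X i))\<^sup>2)" for n
  \<comment> \<open>The inner product with the identity is the trace, so \<open>s n / n\<close>
    converges to the trace of \<open>R\<close>.\<close>
  have s: "s n = mat 1 \<bullet> tmult n X X" for n
    by (simp add: inner_tmult s_def power2_norm_eq_inner)
  have "(\<lambda>n. mat 1 \<bullet> ((1 / real n) *\<^sub>R tmult n X X)) \<longlonglongrightarrow> mat 1 \<bullet> R"
    by (intro tendsto_intros R)
  then have lim: "(\<lambda>n. s n / real n) \<longlonglongrightarrow> mat 1 \<bullet> R" by (simp add: s)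
  \<comment> \<open>A convergent sequence of averages has increments of smaller order: the last
    summand divided by n + 1 is the difference of two expressions with the same limit.\<close>
  have "(\<lambda>n. s (Suc n) / real (Suc n) - (real n / real (Suc n)) * (s n / real n)) \<longlonglongrightarrow> mat 1 \<bullet> R - 1 * (mat 1 \<bullet> R)"
    by (intro tendsto_intros lim LIMSEQ_Suc[OF lim] LIMSEQ_n_over_Suc_n)
  moreover have "s (Suc n) / real (Suc n) - (real n / real (Suc n)) * (s n / real n) = (norm (X n))\<^sup>2 / real (Suc n)" for n
    by (cases "n = 0") (simp_all add: s_def diff_divide_distrib[symmetric])
  ultimately have "(\<lambda>n. (norm (X n))\<^sup>2 / real (Suc n)) \<longlonglongrightarrow> 0" by simp
  then show ?thesis using \<open>0 < d\<close> by (rule eventually_le_linear)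
qed

definition score :: "(nat \<Rightarrow> real^'m) \<Rightarrow> (nat \<Rightarrow> nat \<Rightarrow> 'w \<Rightarrow> real^'p) \<Rightarrow> nat \<Rightarrow> 'w \<Rightarrow> real^'p^'m" where
  "score X \<epsilon> n \<omega> = (1 / sqrt (real n)) *\<^sub>R tmult n X (\<lambda>i. \<epsilon> n i \<omega>)"

text \<open>Expresses the variance of the weighted sum through X'X / n. It is applied with the error
  covariance for the limiting variance, and with the identity for the sum of squared
  weights.\<close>

lemma sum_scaled_rows_quadratic:
  fixes X :: "nat \<Rightarrow> real^'m" and A :: "real^'p^'m"
  assumes "transpose \<Sigma> = \<Sigma>"
  defines "w n i \<equiv> (1 / sqrt (real n)) *\<^sub>R (X i v* A)"
  shows "(\<Sum>i<n. w n i \<bullet> (\<Sigma> *v w n i)) = A \<bullet> ((1 / real n) *\<^sub>R tmult n X X ** (A ** \<Sigma>))"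
proof -
  have "\<Sigma> *v y = y v* \<Sigma>" for y by (metis assms(1) vector_transpose_matrix)
  then have "w n i \<bullet> (\<Sigma> *v w n i) = (1 / real n) * ((X i v* A) \<bullet> (X i v* (A ** \<Sigma>)))" for i
    by (simp add: w_def matrix_vector_mult_scaleR vector_matrix_mul_assoc divide_simps)
  then have "(\<Sum>i<n. w n i \<bullet> (\<Sigma> *v w n i)) = (1 / real n) * (\<Sum>i<n. (X i v* A) \<bullet> (X i v* (A ** \<Sigma>)))"
    by (simp only: sum_distrib_left)
  also have "(\<Sum>i<n. (X i v* A) \<bullet> (X i v* (A ** \<Sigma>))) = A \<bullet> (tmult n X X ** (A ** \<Sigma>))"
    by (simp only: inner_tmult[symmetric] tmult_matrix_right)
  finally show ?thesis by (simp add: matrix_mult_scaleR_left)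
qed

text \<open>A linear functional of the score is a weighted sum of the error rows, with weights A'X_i
  / sqrt n. Convergence of X'X / n supplies the variance limit, the bound on the weights and their
  negligibility.\<close>

lemma score_clt:
  fixes X :: "nat \<Rightarrow> real^'m" and \<epsilon> :: "nat \<Rightarrow> nat \<Rightarrow> 'w \<Rightarrow> real^'p" and A :: "real^'p^'m"
  assumes "prob_space M" and ge: "\<And>n. n > m \<Longrightarrow> growth_errors M n \<epsilon> F \<Sigma>"
    and sym: "transpose \<Sigma> = \<Sigma>"
    and R: "(\<lambda>n. (1 / real n) *\<^sub>R tmult n X X) \<longlonglongrightarrow> R"
  shows "(\<lambda>n. CLINT \<omega>|M. iexp (A \<bullet> score X \<epsilon> n \<omega>)) \<longlonglongrightarrow> complex_of_real (exp (- (A \<bullet> (R ** (A ** \<Sigma>))) / 2))"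
proof -
  define w where "w n i = (1 / sqrt (real n)) *\<^sub>R (X i v* A)" for n i
  \<comment> \<open>Any admissible sample size serves to read off the moments of
    \<open>F\<close>.\<close>
  note law = growth_errors_law[OF assms(1) ge[of "Suc m"]]
  have eq: "A \<bullet> score X \<epsilon> n \<omega> = (\<Sum>i<n. w n i \<bullet> \<epsilon> n i \<omega>)" for n \<omega>
    by (simp add: score_def w_def inner_tmult sum_distrib_left)
  have lim: "(\<lambda>n. A \<bullet> ((1 / real n) *\<^sub>R tmult n X X ** B)) \<longlonglongrightarrow> A \<bullet> (R ** B)" for B :: "real^'p^'m"
    by (intro tendsto_intros tendsto_matrix_mult R)
  have "(\<Sum>i<n. (norm (w n i))\<^sup>2) = A \<bullet> ((1 / real n) *\<^sub>R tmult n X X ** (A ** mat 1))" for n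
    using sum_scaled_rows_quadratic[of "mat 1", where A = A and X = X and n = n]
    unfolding w_def[symmetric] power2_norm_eq_inner by (simp add: transpose_mat)
  then have "(\<lambda>n. \<Sum>i<n. (norm (w n i))\<^sup>2) \<longlonglongrightarrow> A \<bullet> (R ** (A ** mat 1))"
    using lim by simp
  from order_tendstoD(2)[OF this, of "A \<bullet> (R ** (A ** mat 1)) + 1"]
  have bnd: "\<forall>\<^sub>F n in sequentially. (\<Sum>i<n. (norm (w n i))\<^sup>2) \<le> A \<bullet> (R ** (A ** mat 1)) + 1"
    by (auto elim: eventually_mono)
  obtain K where K: "0 < K" "\<And>x. norm (x v* A) \<le> norm x * K"
  proof -
    have "bounded_linear (\<lambda>x. transpose A *v x)" by (rule matrix_vector_mul_bounded_linear)
    from bounded_linear.pos_bounded[OF this] show ?thesis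
      using that by (auto simp: vector_transpose_matrix[symmetric])
  qed
  have negl: "\<forall>\<^sub>F n in sequentially. \<forall>i<n. norm (w n i) \<le> d" if "0 < d" for d
  proof -
    \<comment> \<open>The weights are bounded by \<open>K\<close> * norm (X i) / sqrt n, so it
      suffices that each row is at most (\<open>d\<close> / \<open>K\<close>) * sqrt n.\<close>
    have "0 < (d / K)\<^sup>2" using that K(1) by simp
    from rows_negligible[OF R this] eventually_gt_at_top[of 0] show ?thesis
    proof eventually_elim
      case (elim n)
      show ?case
      proof (intro allI impI)
        fix i assume "i < n"
        with elim have "(norm (X i))\<^sup>2 \<le> (d / K)\<^sup>2 * (sqrt (real n))\<^sup>2" by simp
        then have "(norm (X i))\<^sup>2 \<le> (d / K * sqrt (real n))\<^sup>2" by (simp only: power_mult_distrib)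
        then have "norm (X i) \<le> d / K * sqrt (real n)"
          by (rule power2_le_imp_le) (use that K(1) in simp)
        then have "norm (X i) * K \<le> d * sqrt (real n)" using K(1) by (simp add: field_simps)
        with K(2)[of "X i"] have "norm (X i v* A) \<le> d * sqrt (real n)" by linarith
        then show "norm (w n i) \<le> d" using elim by (simp add: w_def field_simps)
      qed
    qed
  qed
  have "(\<lambda>n. \<Sum>i<n. \<integral>x. (w n i \<bullet> x)\<^sup>2 \<partial>F) \<longlonglongrightarrow> A \<bullet> (R ** (A ** \<Sigma>))"
    unfolding law(7)[OF lessI zero_less_Suc] w_def sum_scaled_rows_quadratic[OF sym] by (rule lim)
  moreover have "\<forall>\<^sub>F n in sequentially. prob_space.indep_vars M (\<lambda>_. borel) (\<epsilon> n) {..<n} \<and> (\<forall>i<n. distr M borel (\<epsilon> n i) = F)"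
    using eventually_gt_at_top[of m] by eventually_elim (use ge in \<open>auto simp: growth_errors_def\<close>)
  ultimately show ?thesis
    unfolding eq using law
    by (intro weighted_iid_clt[where F = F and K = "A \<bullet> (R ** (A ** mat 1)) + 1"] assms(1) bnd negl) auto
qed

text \<open>Distinct rows are uncorrelated, so only the diagonal terms survive. As X'X / n
  converges, the score entries are bounded in L^2.\<close>

lemma score_second_moment:
  fixes X :: "nat \<Rightarrow> real^'m" and \<epsilon> :: "nat \<Rightarrow> nat \<Rightarrow> 'w \<Rightarrow> real^'p"
  assumes "prob_space M" and ge: "growth_errors M n \<epsilon> F \<Sigma>"
  shows "integrable M (\<lambda>\<omega>. (score X \<epsilon> n \<omega> $ k $ l)\<^sup>2)"
    "(\<integral>\<omega>. (score X \<epsilon> n \<omega> $ k $ l)\<^sup>2 \<partial>M) = ((1 / real n) *\<^sub>R tmult n X X) $ k $ k * \<Sigma> $ l $ l"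
proof -
  interpret prob_space M by fact
  have m: "\<epsilon> n i \<in> borel_measurable M" if "i < n" for i
    using ge that by (simp add: growth_errors_def indep_vars_def2)
  have mean: "(\<integral>\<omega>. \<epsilon> n i \<omega> $ l \<partial>M) = 0" if "i < n" for i using ge that by (simp add: growth_errors_def)
  have sq: "integrable M (\<lambda>\<omega>. (\<epsilon> n i \<omega> $ l)\<^sup>2)" if "i < n" for i using ge that by (simp add: growth_errors_def)
  have prod: "integrable M (\<lambda>\<omega>. \<epsilon> n i \<omega> $ l * \<epsilon> n j \<omega> $ l)" if "i < n" "j < n" for i j
  proof (rule Bochner_Integration.integrable_bound)
    show "integrable M (\<lambda>\<omega>. (\<epsilon> n i \<omega> $ l)\<^sup>2 + (\<epsilon> n j \<omega> $ l)\<^sup>2)" using sq that by auto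
    show "(\<lambda>\<omega>. \<epsilon> n i \<omega> $ l * \<epsilon> n j \<omega> $ l) \<in> borel_measurable M"
      using m[OF that(1)] m[OF that(2)] by (intro borel_measurable_times borel_measurable_cart_nth)
    show "AE \<omega> in M. norm (\<epsilon> n i \<omega> $ l * \<epsilon> n j \<omega> $ l) \<le> norm ((\<epsilon> n i \<omega> $ l)\<^sup>2 + (\<epsilon> n j \<omega> $ l)\<^sup>2)"
      unfolding real_norm_def by (intro AE_I2 abs_mult_le_sum_squares)
  qed
  have cv: "(\<integral>\<omega>. \<epsilon> n i \<omega> $ l * \<epsilon> n j \<omega> $ l \<partial>M) = (if i = j then \<Sigma> $ l $ l else 0)" if "i < n" "j < n" for i j
  proof -
    have "(\<integral>\<omega>. \<epsilon> n i \<omega> $ l * \<epsilon> n j \<omega> $ l \<partial>M) = cov M (\<lambda>\<omega>. \<epsilon> n i \<omega> $ l) (\<lambda>\<omega>. \<epsilon> n j \<omega> $ l)"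
      using that by (simp add: cov_def mean)
    also have "\<dots> = (if i = j then 1 else 0) * \<Sigma> $ l $ l" using ge that by (simp add: growth_errors_def)
    finally show ?thesis by simp
  qed
  have sc: "(score X \<epsilon> n \<omega> $ k $ l)\<^sup>2 =
      (1 / real n) * (\<Sum>i<n. \<Sum>j<n. X i $ k * X j $ k * (\<epsilon> n i \<omega> $ l * \<epsilon> n j \<omega> $ l))" for \<omega>
  proof -
    have "(score X \<epsilon> n \<omega> $ k $ l)\<^sup>2 = (1 / real n) * (\<Sum>i<n. X i $ k * \<epsilon> n i \<omega> $ l)\<^sup>2"
      by (simp add: score_def tmult_nth power_divide)
    also have "(\<Sum>i<n. X i $ k * \<epsilon> n i \<omega> $ l)\<^sup>2 = (\<Sum>i<n. \<Sum>j<n. X i $ k * X j $ k * (\<epsilon> n i \<omega> $ l * \<epsilon> n j \<omega> $ l))"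
      by (simp add: power2_eq_square sum_product mult_ac)
    finally show ?thesis .
  qed
  show "integrable M (\<lambda>\<omega>. (score X \<epsilon> n \<omega> $ k $ l)\<^sup>2)"
    unfolding sc by (intro integrable_mult_right Bochner_Integration.integrable_sum prod) auto
  have "(\<integral>\<omega>. (\<Sum>i<n. \<Sum>j<n. X i $ k * X j $ k * (\<epsilon> n i \<omega> $ l * \<epsilon> n j \<omega> $ l)) \<partial>M) =
      (\<Sum>i<n. \<integral>\<omega>. (\<Sum>j<n. X i $ k * X j $ k * (\<epsilon> n i \<omega> $ l * \<epsilon> n j \<omega> $ l)) \<partial>M)"
    by (rule Bochner_Integration.integral_sum) (auto intro!: integrable_mult_right prod)
  also have "\<dots> = (\<Sum>i<n. \<Sum>j<n. \<integral>\<omega>. X i $ k * X j $ k * (\<epsilon> n i \<omega> $ l * \<epsilon> n j \<omega> $ l) \<partial>M)"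
    by (intro sum.cong refl Bochner_Integration.integral_sum) (auto intro!: integrable_mult_right prod)
  finally have "(\<integral>\<omega>. (score X \<epsilon> n \<omega> $ k $ l)\<^sup>2 \<partial>M) =
      (1 / real n) * (\<Sum>i<n. \<Sum>j<n. X i $ k * X j $ k * (if i = j then \<Sigma> $ l $ l else 0))"
    unfolding sc by (simp add: cv)
  also have "\<dots> = (1 / real n) * (\<Sum>i<n. X i $ k * X i $ k * \<Sigma> $ l $ l)"
    by (simp add: if_distrib[of "\<lambda>x. _ * x"] cong: if_cong)
  also have "\<dots> = ((1 / real n) *\<^sub>R tmult n X X) $ k $ k * \<Sigma> $ l $ l"
    by (simp add: tmult_nth sum_distrib_right)
  finally show "(\<integral>\<omega>. (score X \<epsilon> n \<omega> $ k $ l)\<^sup>2 \<partial>M) = ((1 / real n) *\<^sub>R tmult n X X) $ k $ k * \<Sigma> $ l $ l" .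
qed

section \<open>Asymptotic normality\<close>

lemma inner_matrix_sandwich:
  fixes P :: "real^'m^'s" and U :: "real^'p^'m" and Q :: "real^'t^'p"
  shows "(P ** U ** Q) \<bullet> A = U \<bullet> (transpose P ** A ** transpose Q)"
  by (subst inner_matrix_mult_right, subst inner_matrix_mult_left) (simp only: matrix_mul_assoc)

text \<open>With S = P P' and T = Q Q', the law of P z Q' for a standard Gaussian matrix z has
  exponent a \<bullet> (S a T), which is the Kronecker form after stacking rows. The characteristic
  function is returned as well, because the continuity theorem identifies the limit through
  it.\<close>

lemma exists_matrix_normal:
  fixes C :: "real^'m^'s" and D :: "real^'q^'t"
  assumes "pos_def A" "pos_def B"
  obtains N where "matrix_normal N 0 (kronecker (C ** A ** transpose C) (D ** B ** transpose D))"
    "\<And>a. vchar N a = complex_of_real (exp (- (a \<bullet> ((C ** A ** transpose C) ** a ** (D ** B ** transpose D))) / 2))"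
proof -
  obtain b :: "real^'m^'m" where b: "A = b ** transpose b" by (rule pos_def_factor[OF assms(1)])
  obtain c :: "real^'q^'q" where c: "B = c ** transpose c" by (rule pos_def_factor[OF assms(2)])
  define S where "S = C ** A ** transpose C"
  define T where "T = D ** B ** transpose D"
  define P where "P = C ** b"
  define Q where "Q = D ** c"
  have S: "S = P ** transpose P" by (simp add: S_def P_def b matrix_transpose_mul matrix_mul_assoc)
  have T: "T = Q ** transpose Q" by (simp add: T_def Q_def c matrix_transpose_mul matrix_mul_assoc)
  define N :: "(real^'t^'s) measure" where "N = distr std_gauss borel (\<lambda>z. P ** z ** transpose Q)"
  interpret G: prob_space "std_gauss :: (real^'q^'m) measure" by (rule prob_space_std_gauss)
  have meas: "(\<lambda>z. P ** z ** transpose Q) \<in> borel_measurable std_gauss"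
    by (intro borel_measurable_matrix_mult borel_measurable_const) (simp add: measurable_def sets_eq_imp_space_eq)
  have N: "prob_space N" "sets N = sets borel" unfolding N_def using meas by (auto intro: G.prob_space_distr)
  have ch: "vchar N a = complex_of_real (exp (- (a \<bullet> (S ** a ** T)) / 2))" for a
  proof -
    have "a \<bullet> (P ** z ** transpose Q) = (transpose P ** a ** Q) \<bullet> z" for z
      by (metis inner_commute inner_matrix_sandwich transpose_transpose)
    then have "vchar N a = vchar std_gauss (transpose P ** a ** Q)"
      unfolding N_def vchar_def using meas by (subst integral_distr) auto
    moreover have "(norm (transpose P ** a ** Q))\<^sup>2 = a \<bullet> (S ** a ** T)"
      by (simp add: power2_norm_eq_inner inner_matrix_sandwich S T matrix_mul_assoc)
    ultimately show ?thesis by (simp add: vchar_std_gauss)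
  qed
  have vec_meas: "vec_rows \<in> borel_measurable (borel :: (real^'t^'s) measure)"
    unfolding vec_rows_def
    by (rule borel_measurable_cartI, simp)
      (intro borel_measurable_cart_nth, simp add: measurable_def)
  have "multivariate_normal (distr N borel vec_rows) 0 (kronecker S T)"
  proof (rule multivariate_normal_if_vchar)
    interpret N: prob_space N by fact
    have vm: "vec_rows \<in> borel_measurable N" using vec_meas N(2) by (simp cong: measurable_cong_sets)
    show "prob_space (distr N borel vec_rows)" using vm by (rule N.prob_space_distr)
    show "transpose (kronecker S T) = kronecker S T"
      by (simp add: transpose_kronecker S T matrix_transpose_mul)
    fix y :: "real^('s \<times> 't)"
    \<comment> \<open>Every vector indexed by pairs is a stacked matrix, so the Kronecker form can
      be evaluated in matrix terms.\<close>
    define a :: "real^'t^'s" where "a = (\<chi> i j. y $ (i, j))"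
    have y: "y = vec_rows a" by (simp add: a_def vec_rows_def vec_eq_iff)
    have "transpose T = T" by (simp add: T matrix_transpose_mul)
    then have "y \<bullet> (kronecker S T *v y) = a \<bullet> (S ** a ** T)"
      by (simp add: y kronecker_vec_rows vec_rows_inner)
    moreover have "vchar (distr N borel vec_rows) y = vchar N a"
      unfolding vchar_def using vm by (subst integral_distr) (auto simp: y vec_rows_inner)
    ultimately show "vchar (distr N borel vec_rows) y = complex_of_real (exp (- (y \<bullet> (kronecker S T *v y)) / 2))"
      by (simp add: ch)
  qed simp
  moreover have "vec_rows (0 :: real^'t^'s) = 0" by (simp add: vec_rows_def vec_eq_iff)
  ultimately have "matrix_normal N 0 (kronecker S T)" using N by (simp add: matrix_normal_def)
  then show ?thesis using that ch unfolding S_def T_def by blast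
qed

section \<open>The growth curve model with its standing assumptions, and consistency of the
  covariance estimator\<close>

locale growth_curve = prob_space M
  for M :: "'w measure" +
  fixes X :: "nat \<Rightarrow> real^'m"
    and Z :: "real^'q^'p"
    and \<Theta> :: "real^'q^'m"
    and \<Sigma> :: "real^'p^'p"
    and F :: "(real^'p) measure"
    and \<epsilon> :: "nat \<Rightarrow> nat \<Rightarrow> 'w \<Rightarrow> real^'p"
    and Y :: "nat \<Rightarrow> 'w \<Rightarrow> nat \<Rightarrow> real^'p"
    and R :: "real^'m^'m"
  assumes rank_X: "\<And>n. n > CARD('m) \<Longrightarrow> rows_rank n X = CARD('m)"
    and rank_Z: "rank Z = CARD('q)"
    and pos_def_\<Sigma>: "pos_def \<Sigma>"
    and errors: "\<And>n. n > CARD('m) \<Longrightarrow> growth_errors M n \<epsilon> F \<Sigma>"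
    and model: "\<And>n i \<omega>. n > CARD('m) \<Longrightarrow> i < n \<Longrightarrow> \<omega> \<in> space M \<Longrightarrow>
      Y n \<omega> i = X i v* (\<Theta> ** transpose Z) + \<epsilon> n i \<omega>"
    and pos_def_Sigma_hat: "\<forall>\<^sub>F n in sequentially. AE \<omega> in M. pos_def (Sigma_hat n X (Y n \<omega>))"
    and pos_def_R: "pos_def R"
    and lim_R: "(\<lambda>n. (1 / real n) *\<^sub>R tmult n X X) \<longlonglongrightarrow> R"
begin

abbreviation H :: "nat \<Rightarrow> real^'m^'m" where
  "H n \<equiv> matrix_inv ((1 / real n) *\<^sub>R tmult n X X)"

lemma H_lim: "H \<longlonglongrightarrow> matrix_inv R"
  by (intro tendsto_matrix_inv lim_R pos_def_invertible pos_def_R)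

lemma in_prob_eventually:
  assumes "\<And>n \<omega>. n > CARD('m) \<Longrightarrow> \<omega> \<in> space M \<Longrightarrow> P n \<omega>"
  shows "\<forall>\<^sub>F p in in_prob M. P (fst p) (snd p)"
  by (rule eventually_in_prob_AE, rule eventually_mono[OF eventually_gt_at_top[of "CARD('m)"]]) (use assms in auto)

lemma errors_measurable: "n > CARD('m) \<Longrightarrow> i < n \<Longrightarrow> \<epsilon> n i \<in> borel_measurable M"
  using errors[of n] by (simp add: growth_errors_def indep_vars_def2)

lemma score_bounded: "\<exists>B. \<forall>\<^sub>F n in sequentially.
    integrable M (\<lambda>\<omega>. (score X \<epsilon> n \<omega> $ k $ l)\<^sup>2) \<and> expectation (\<lambda>\<omega>. (score X \<epsilon> n \<omega> $ k $ l)\<^sup>2) \<le> B"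
proof -
  have "(\<lambda>n. ((1 / real n) *\<^sub>R tmult n X X) $ k $ k * \<Sigma> $ l $ l) \<longlonglongrightarrow> R $ k $ k * \<Sigma> $ l $ l"
    by (intro tendsto_intros lim_R)
  from order_tendstoD(2)[OF this, of "R $ k $ k * \<Sigma> $ l $ l + 1"]
  have "\<forall>\<^sub>F n in sequentially. ((1 / real n) *\<^sub>R tmult n X X) $ k $ k * \<Sigma> $ l $ l < R $ k $ k * \<Sigma> $ l $ l + 1" by simp
  with eventually_gt_at_top[of "CARD('m)"]
  have "\<forall>\<^sub>F n in sequentially. integrable M (\<lambda>\<omega>. (score X \<epsilon> n \<omega> $ k $ l)\<^sup>2) \<and>
      expectation (\<lambda>\<omega>. (score X \<epsilon> n \<omega> $ k $ l)\<^sup>2) \<le> R $ k $ k * \<Sigma> $ l $ l + 1"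
  proof eventually_elim
    case (elim n)
    note sm = score_second_moment[OF prob_space_axioms errors[OF elim(1)], where X = X and k = k and l = l]
    from sm(1) elim(2) show ?case unfolding sm(2) by simp
  qed
  then show ?thesis ..
qed

lemma score_mult_in_prob:
  assumes "((\<lambda>p. V (fst p) (snd p)) \<longlongrightarrow> 0) (in_prob M)"
  shows "((\<lambda>p. score X \<epsilon> (fst p) (snd p) $ k $ l * V (fst p) (snd p)) \<longlongrightarrow> 0) (in_prob M)"
proof -
  obtain B where "\<forall>\<^sub>F n in sequentially. integrable M (\<lambda>\<omega>. (score X \<epsilon> n \<omega> $ k $ l)\<^sup>2) \<and>
      expectation (\<lambda>\<omega>. (score X \<epsilon> n \<omega> $ k $ l)\<^sup>2) \<le> B"
    using score_bounded[of k l] ..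
  from tendsto_in_prob_mult_bounded[OF this assms] show ?thesis .
qed

text \<open>Entrywise weak law for the function x_k x_l, which is integrable because the coordinates
  are square integrable.\<close>

lemma error_gram_consistent:
  "((\<lambda>p. (1 / real (fst p)) *\<^sub>R tmult (fst p) (\<lambda>i. \<epsilon> (fst p) i (snd p)) (\<lambda>i. \<epsilon> (fst p) i (snd p))) \<longlongrightarrow> \<Sigma>) (in_prob M)"
proof (intro vec_tendstoI)
  fix k l
  let ?h = "\<lambda>x :: real^'p. x $ k * x $ l"
  note law = growth_errors_law[OF prob_space_axioms errors[OF lessI] zero_less_Suc]
  have h_meas: "?h \<in> borel_measurable borel" by simp
  have iid: "\<forall>\<^sub>F n in sequentially. indep_vars (\<lambda>_. borel) (\<epsilon> n) {..<n} \<and> (\<forall>i<n. distr M borel (\<epsilon> n i) = F)"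
    using eventually_gt_at_top[of "CARD('m)"] by eventually_elim (use errors in \<open>auto simp: growth_errors_def\<close>)
  have lim: "(\<lambda>n. expectation (\<lambda>\<omega>. \<bar>(\<Sum>i<n. ?h (\<epsilon> n i \<omega>)) / n - (\<integral>x. ?h x \<partial>F)\<bar>)) \<longlonglongrightarrow> 0"
    by (rule iid_average_L1[OF iid law(1,2) h_meas law(5)])
  have "((\<lambda>p. (\<Sum>i<fst p. ?h (\<epsilon> (fst p) i (snd p))) / real (fst p) - (\<integral>x. ?h x \<partial>F)) \<longlongrightarrow> 0) (in_prob M)"
  proof (rule tendsto_in_prob_L1[OF _ lim])
    show "\<forall>\<^sub>F n in sequentially. integrable M (\<lambda>\<omega>. (\<Sum>i<n. ?h (\<epsilon> n i \<omega>)) / n - (\<integral>x. ?h x \<partial>F))"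
      using eventually_gt_at_top[of "CARD('m)"] iid
    proof eventually_elim
      case (elim n)
      have "integrable M (\<lambda>\<omega>. ?h (\<epsilon> n i \<omega>))" if "i < n" for i
      proof -
        have "integrable (distr M borel (\<epsilon> n i)) ?h" using elim(2) that law(5) by simp
        then show ?thesis using errors_measurable[OF elim(1) that] by (subst (asm) integrable_distr_eq) auto
      qed
      then show ?case by (intro Bochner_Integration.integrable_diff integrable_divide Bochner_Integration.integrable_sum) auto
    qed
  qed
  then have "((\<lambda>p. ((\<Sum>i<fst p. ?h (\<epsilon> (fst p) i (snd p))) / real (fst p) - \<Sigma> $ k $ l) + \<Sigma> $ k $ l) \<longlongrightarrow> 0 + \<Sigma> $ k $ l) (in_prob M)"
    unfolding law(6) by (intro tendsto_intros)
  then show "((\<lambda>p. ((1 / real (fst p)) *\<^sub>R tmult (fst p) (\<lambda>i. \<epsilon> (fst p) i (snd p)) (\<lambda>i. \<epsilon> (fst p) i (snd p))) $ k $ l)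
      \<longlongrightarrow> \<Sigma> $ k $ l) (in_prob M)"
    by (simp add: tmult_nth)
qed

lemma Sigma_hat_consistent: "((\<lambda>p. Sigma_hat (fst p) X (Y (fst p) (snd p))) \<longlongrightarrow> \<Sigma>) (in_prob M)"
proof -
  let ?U = "\<lambda>p. score X \<epsilon> (fst p) (snd p)"
  let ?E = "\<lambda>p. (1 / real (fst p)) *\<^sub>R tmult (fst p) (\<lambda>i. \<epsilon> (fst p) i (snd p)) (\<lambda>i. \<epsilon> (fst p) i (snd p))"
  have small: "((\<lambda>p. (1 / real (fst p)) *\<^sub>R (transpose (?U p) ** H (fst p) ** ?U p)) \<longlongrightarrow> 0) (in_prob M)"
  proof (intro vec_tendstoI)
    fix a b
    have "((\<lambda>p. ?U p $ l $ b * (?U p $ k $ a * ((1 / real (fst p)) * H (fst p) $ k $ l))) \<longlongrightarrow> 0) (in_prob M)" for k l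
    \<comment> \<open>The score entries are only bounded in L^2, so they are stripped off one at a
      time; what remains is deterministic and vanishes through the factor 1 / n.\<close>
    proof (rule score_mult_in_prob, rule score_mult_in_prob)
      have "(\<lambda>n. (1 / real n) * H n $ k $ l) \<longlonglongrightarrow> 0 * matrix_inv R $ k $ l"
        by (intro tendsto_intros H_lim lim_1_over_n)
      then show "((\<lambda>p. (1 / real (fst p)) * H (fst p) $ k $ l) \<longlongrightarrow> 0) (in_prob M)"
        by (intro tendsto_in_prob_const) simp
    qed
    note lim = this
    have "((\<lambda>p. \<Sum>l\<in>UNIV. \<Sum>k\<in>UNIV. ?U p $ l $ b * (?U p $ k $ a * ((1 / real (fst p)) * H (fst p) $ k $ l))) \<longlongrightarrow>
        0) (in_prob M)"
      by (intro tendsto_null_sum lim)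
    moreover have "((1 / real (fst p)) *\<^sub>R (transpose (?U p) ** H (fst p) ** ?U p)) $ a $ b =
        (\<Sum>l\<in>UNIV. \<Sum>k\<in>UNIV. ?U p $ l $ b * (?U p $ k $ a * ((1 / real (fst p)) * H (fst p) $ k $ l)))" for p
      by (simp add: matrix_matrix_mult_def transpose_def sum_distrib_left sum_distrib_right mult_ac)
    ultimately show "((\<lambda>p. ((1 / real (fst p)) *\<^sub>R (transpose (?U p) ** H (fst p) ** ?U p)) $ a $ b) \<longlongrightarrow>
        (0 :: real^'p^'p) $ a $ b) (in_prob M)" by simp
  qed
  \<comment> \<open>The limit is taken with real subtraction, which agrees with truncated
    subtraction on naturals once n exceeds the number of columns of X.\<close>
  have "(\<lambda>n. real n / (real n - real CARD('m))) \<longlonglongrightarrow> 1" by real_asymp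
  moreover have "\<forall>\<^sub>F n in sequentially. real n / (real n - real CARD('m)) = real n / real (n - CARD('m))"
    using eventually_gt_at_top[of "CARD('m)"] by eventually_elim (simp add: of_nat_diff)
  ultimately have "(\<lambda>n. real n / real (n - CARD('m))) \<longlonglongrightarrow> 1" by (rule Lim_transform_eventually)
  then have fac: "((\<lambda>p. real (fst p) / real (fst p - CARD('m))) \<longlongrightarrow> 1) (in_prob M)"
    by (rule tendsto_in_prob_const)
  have "((\<lambda>p. (real (fst p) / real (fst p - CARD('m))) *\<^sub>R
      (?E p - (1 / real (fst p)) *\<^sub>R (transpose (?U p) ** H (fst p) ** ?U p))) \<longlongrightarrow> 1 *\<^sub>R (\<Sigma> - 0)) (in_prob M)"
    by (intro tendsto_scaleR tendsto_diff fac error_gram_consistent small)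
  moreover have "\<forall>\<^sub>F p in in_prob M. (real (fst p) / real (fst p - CARD('m))) *\<^sub>R
      (?E p - (1 / real (fst p)) *\<^sub>R (transpose (?U p) ** H (fst p) ** ?U p)) = Sigma_hat (fst p) X (Y (fst p) (snd p))"
  proof (rule in_prob_eventually)
    fix n \<omega> assume n: "CARD('m) < n" "\<omega> \<in> space M"
    then have "0 < n" by simp
    from Sigma_hat_error[OF rank_X[OF n(1)] model[OF n(1) _ n(2)] this]
    show "(real n / real (n - CARD('m))) *\<^sub>R ((1 / real n) *\<^sub>R tmult n (\<lambda>i. \<epsilon> n i \<omega>) (\<lambda>i. \<epsilon> n i \<omega>) -
        (1 / real n) *\<^sub>R (transpose (score X \<epsilon> n \<omega>) ** H n ** score X \<epsilon> n \<omega>)) = Sigma_hat n X (Y n \<omega>)"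
      by (simp add: score_def)
  qed
  ultimately have "((\<lambda>p. Sigma_hat (fst p) X (Y (fst p) (snd p))) \<longlongrightarrow> 1 *\<^sub>R (\<Sigma> - 0)) (in_prob M)"
    by (rule Lim_transform_eventually)
  then show ?thesis by simp
qed

section \<open>The normalised error and its linear approximation\<close>

context
  fixes C :: "real^'m^'s" and D :: "real^'q^'t"
begin

definition normalised_error :: "nat \<Rightarrow> 'w \<Rightarrow> real^'t^'s" where
  "normalised_error n \<omega> = sqrt (real n) *\<^sub>R (gamma_hat C D Z n X (Y n \<omega>) - C ** \<Theta> ** transpose D)"

definition linear_error :: "nat \<Rightarrow> 'w \<Rightarrow> real^'t^'s" where
  "linear_error n \<omega> = (C ** matrix_inv R) ** score X \<epsilon> n \<omega> ** (gls_gain Z \<Sigma> ** transpose D)"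

text \<open>Each entry of the difference is a finite sum of score entries, bounded in L^2, times
  coefficient differences that tend to 0 in probability.\<close>

lemma normalised_error_linearisation:
  "((\<lambda>p. normalised_error (fst p) (snd p) - linear_error (fst p) (snd p)) \<longlongrightarrow> 0) (in_prob M)"
proof -
  let ?U = "\<lambda>p. score X \<epsilon> (fst p) (snd p)"
  let ?P = "\<lambda>p. C ** H (fst p)" and ?Pl = "C ** matrix_inv R"
  let ?Q = "\<lambda>p. gls_gain Z (Sigma_hat (fst p) X (Y (fst p) (snd p))) ** transpose D"
    and ?Ql = "gls_gain Z \<Sigma> ** transpose D"
  have P: "(?P \<longlongrightarrow> ?Pl) (in_prob M)"
    by (intro tendsto_matrix_mult tendsto_const tendsto_in_prob_const[OF H_lim])
  have Q: "(?Q \<longlongrightarrow> ?Ql) (in_prob M)"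
    by (intro tendsto_matrix_mult tendsto_const tendsto_gls_gain Sigma_hat_consistent pos_def_\<Sigma> rank_Z)
  have lim: "((\<lambda>p. ?P p ** ?U p ** ?Q p - ?Pl ** ?U p ** ?Ql) \<longlongrightarrow> 0) (in_prob M)"
  proof (intro vec_tendstoI)
    fix a b
    have "((\<lambda>p. ?U p $ k $ l * (?P p $ a $ k * ?Q p $ l $ b - ?Pl $ a $ k * ?Ql $ l $ b)) \<longlongrightarrow> 0) (in_prob M)" for k l
    proof (rule score_mult_in_prob)
      have "((\<lambda>p. ?P p $ a $ k * ?Q p $ l $ b - ?Pl $ a $ k * ?Ql $ l $ b) \<longlongrightarrow>
          ?Pl $ a $ k * ?Ql $ l $ b - ?Pl $ a $ k * ?Ql $ l $ b) (in_prob M)"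
        by (intro tendsto_diff tendsto_mult tendsto_vec_nth P Q tendsto_const)
      then show "((\<lambda>p. ?P p $ a $ k * ?Q p $ l $ b - ?Pl $ a $ k * ?Ql $ l $ b) \<longlongrightarrow> 0) (in_prob M)" by simp
    qed
    note lim = this
    have "((\<lambda>p. \<Sum>l\<in>UNIV. \<Sum>k\<in>UNIV. ?U p $ k $ l * (?P p $ a $ k * ?Q p $ l $ b - ?Pl $ a $ k * ?Ql $ l $ b)) \<longlongrightarrow>
        0) (in_prob M)"
      by (intro tendsto_null_sum lim)
    moreover have entry: "(A ** B ** E) $ a $ b = (\<Sum>l\<in>UNIV. \<Sum>k\<in>UNIV. B $ k $ l * (A $ a $ k * E $ l $ b))"
      for A :: "real^'m^'s" and B :: "real^'p^'m" and E :: "real^'t^'p"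
      by (simp add: matrix_matrix_mult_def sum_distrib_left sum_distrib_right mult_ac)
    ultimately show "((\<lambda>p. (?P p ** ?U p ** ?Q p - ?Pl ** ?U p ** ?Ql) $ a $ b) \<longlongrightarrow> (0 :: real^'t^'s) $ a $ b) (in_prob M)"
      by (simp add: entry right_diff_distrib sum_subtractf)
  qed
  \<comment> \<open>The exact error formula requires a positive definite covariance estimate, so it
    is available only almost surely and enters through the filter.\<close>
  have "\<forall>\<^sub>F n in sequentially. AE \<omega> in M. C ** H n ** score X \<epsilon> n \<omega> ** (gls_gain Z (Sigma_hat n X (Y n \<omega>)) ** transpose D)
      = normalised_error n \<omega>"
    using pos_def_Sigma_hat eventually_gt_at_top[of "CARD('m)"]
  proof eventually_elim
    case (elim n)
    then have "0 < n" by simp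
    from elim(1) AE_space show ?case
    proof eventually_elim
      case (elim \<omega>)
      from gamma_hat_error[OF rank_X model \<open>0 < n\<close> elim(1) rank_Z, where C = C and D = D] \<open>CARD('m) < n\<close> elim(2)
      show ?case by (simp add: normalised_error_def score_def matrix_mul_assoc)
    qed
  qed
  from eventually_in_prob_AE[OF this] have "\<forall>\<^sub>F p in in_prob M. ?P p ** ?U p ** ?Q p - ?Pl ** ?U p ** ?Ql =
      normalised_error (fst p) (snd p) - linear_error (fst p) (snd p)"
    by eventually_elim (simp add: linear_error_def)
  with lim show ?thesis by (rule Lim_transform_eventually)
qed

text \<open>Moving the outer factors to the other side of the inner product reduces this to
  \<open>score_clt\<close>; the limiting variance then simplifies by R^-1 R R^-1 = R^-1 and by
  \<open>gls_gain_covariance\<close>.\<close>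

lemma linear_error_char:
  "(\<lambda>n. CLINT \<omega>|M. iexp (a \<bullet> linear_error n \<omega>)) \<longlonglongrightarrow> complex_of_real (exp (- (a \<bullet>
     ((C ** matrix_inv R ** transpose C) ** a ** (D ** matrix_inv (transpose Z ** matrix_inv \<Sigma> ** Z) ** transpose D))) / 2))"
proof -
  let ?P = "C ** matrix_inv R" and ?Q = "gls_gain Z \<Sigma> ** transpose D"
  let ?A = "transpose ?P ** a ** transpose ?Q"
  have sym: "transpose \<Sigma> = \<Sigma>" "transpose (matrix_inv R) = matrix_inv R"
    using pos_def_\<Sigma> pos_def_matrix_inv[OF pos_def_R] by (simp_all add: pos_def_def)
  have "a \<bullet> linear_error n \<omega> = ?A \<bullet> score X \<epsilon> n \<omega>" for n \<omega>
    unfolding linear_error_def inner_commute[of a] inner_commute[of ?A]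
    by (rule inner_matrix_sandwich)
  moreover have "?A \<bullet> (R ** (?A ** \<Sigma>)) = a \<bullet> ((?P ** R ** transpose ?P) ** a ** (transpose ?Q ** \<Sigma> ** ?Q))"
    by (simp only: inner_matrix_sandwich[of "transpose ?P" a "transpose ?Q"] transpose_transpose matrix_mul_assoc)
  moreover have "?P ** R ** transpose ?P = C ** matrix_inv R ** transpose C"
  proof -
    have "?P ** R ** transpose ?P = C ** (matrix_inv R ** R) ** matrix_inv R ** transpose C"
      by (simp only: matrix_transpose_mul sym matrix_mul_assoc)
    then show ?thesis by (simp add: matrix_inv[OF pos_def_invertible[OF pos_def_R]])
  qed
  moreover have "transpose ?Q ** \<Sigma> ** ?Q = D ** matrix_inv (transpose Z ** matrix_inv \<Sigma> ** Z) ** transpose D"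
    unfolding gls_gain_covariance[OF pos_def_\<Sigma> rank_Z, symmetric]
    by (simp add: matrix_transpose_mul matrix_mul_assoc)
  ultimately show ?thesis
    using score_clt[OF prob_space_axioms errors sym(1) lim_R, where A = ?A] by simp
qed

section \<open>Measurability, and passage to the limit law\<close>

lemma score_measurable:
  assumes "n > CARD('m)"
  shows "(\<lambda>\<omega>. score X \<epsilon> n \<omega>) \<in> borel_measurable M"
  unfolding borel_measurable_matrix_iff score_def
proof (intro allI)
  have m: "(\<lambda>\<omega>. \<epsilon> n i \<omega> $ l) \<in> borel_measurable M" if "i < n" for i l
    by (rule borel_measurable_cart_nth[OF errors_measurable[OF assms that]])
  show "(\<lambda>\<omega>. ((1 / sqrt (real n)) *\<^sub>R tmult n X (\<lambda>i. \<epsilon> n i \<omega>)) $ k $ l) \<in> borel_measurable M" for k l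
    unfolding vector_scaleR_component tmult_nth
    by (intro borel_measurable_scaleR borel_measurable_const borel_measurable_sum borel_measurable_times m) simp
qed

text \<open>\<open>borel_measurable_matrix_inv\<close> covers singular arguments too, so outcomes
  where the covariance estimate cannot be inverted cause no exception.\<close>

lemma normalised_error_measurable:
  assumes n: "n > CARD('m)"
  shows "normalised_error n \<in> borel_measurable M"
proof -
  have Y: "(\<lambda>\<omega>. Y n \<omega> i $ l) \<in> borel_measurable M" if "i < n" for i l
  proof -
    have "(\<lambda>\<omega>. (X i v* (\<Theta> ** transpose Z) + \<epsilon> n i \<omega>) $ l) \<in> borel_measurable M"
      by (intro borel_measurable_cart_nth borel_measurable_add borel_measurable_const errors_measurable n that)
    then show ?thesis using model[OF n that] by (simp cong: measurable_cong)
  qed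
  have XY: "(\<lambda>\<omega>. tmult n X (Y n \<omega>)) \<in> borel_measurable M"
    unfolding borel_measurable_matrix_iff tmult_nth
    by (intro allI borel_measurable_sum borel_measurable_times borel_measurable_const Y) simp
  have YX: "(\<lambda>\<omega>. tmult n (Y n \<omega>) X) \<in> borel_measurable M"
    unfolding borel_measurable_matrix_iff tmult_nth
    by (intro allI borel_measurable_sum borel_measurable_times borel_measurable_const Y) simp
  have YY: "(\<lambda>\<omega>. tmult n (Y n \<omega>) (Y n \<omega>)) \<in> borel_measurable M"
    unfolding borel_measurable_matrix_iff tmult_nth
    by (intro allI borel_measurable_sum borel_measurable_times Y) simp_all
  have S: "(\<lambda>\<omega>. Sigma_hat n X (Y n \<omega>)) \<in> borel_measurable M"
    unfolding Sigma_hat_eq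
    by (intro borel_measurable_scaleR borel_measurable_diff borel_measurable_matrix_mult borel_measurable_const XY YX YY)
  show ?thesis
    unfolding normalised_error_def[abs_def] gamma_hat_def Let_def
    by (intro borel_measurable_scaleR borel_measurable_diff borel_measurable_matrix_mult borel_measurable_matrix_inv
        borel_measurable_const XY S)
qed

text \<open>Slutsky's theorem on the level of characters: the two characters differ by a quantity of
  modulus at most 2 that vanishes in probability, so their expectations have the same limit.\<close>

lemma normalised_error_char:
  "(\<lambda>n. CLINT \<omega>|M. iexp (a \<bullet> normalised_error n \<omega>)) \<longlonglongrightarrow> complex_of_real (exp (- (a \<bullet>
     ((C ** matrix_inv R ** transpose C) ** a ** (D ** matrix_inv (transpose Z ** matrix_inv \<Sigma> ** Z) ** transpose D))) / 2))"
proof -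
  let ?T = normalised_error and ?L = linear_error
  let ?W = "\<lambda>n \<omega>. iexp (a \<bullet> ?T n \<omega>) - iexp (a \<bullet> ?L n \<omega>)"
  have Lm: "?L n \<in> borel_measurable M" if "n > CARD('m)" for n
    unfolding linear_error_def[abs_def]
    by (intro borel_measurable_matrix_mult borel_measurable_const score_measurable that)
  have im: "(\<lambda>\<omega>. iexp (a \<bullet> V \<omega>)) \<in> borel_measurable M" if [measurable]: "V \<in> borel_measurable M" for V :: "'w \<Rightarrow> real^'t^'s"
    by measurable
  have "(\<lambda>n. expectation (?W n)) \<longlonglongrightarrow> 0"
  proof (rule expectation_tendsto_in_prob[where B = 2])
    show "\<forall>\<^sub>F n in sequentially. ?W n \<in> borel_measurable M"
      using eventually_gt_at_top[of "CARD('m)"]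
      by eventually_elim (intro borel_measurable_diff im Lm normalised_error_measurable)
    show "cmod (?W n \<omega>) \<le> 2" for n \<omega>
      by (rule order_trans[OF norm_triangle_ineq4]) simp
    have "((\<lambda>p. iexp (a \<bullet> (?T (fst p) (snd p) - ?L (fst p) (snd p))) - 1) \<longlongrightarrow> iexp (a \<bullet> 0) - 1) (in_prob M)"
      by (intro tendsto_intros normalised_error_linearisation)
    then have "((\<lambda>p. iexp (a \<bullet> (?T (fst p) (snd p) - ?L (fst p) (snd p))) - 1) \<longlongrightarrow> 0) (in_prob M)" by simp
    then show "((\<lambda>p. ?W (fst p) (snd p)) \<longlongrightarrow> 0) (in_prob M)"
    proof (rule Lim_null_comparison[rotated, OF tendsto_norm_zero], intro always_eventually allI)
      fix p
      \<comment> \<open>A factor of modulus 1 is taken out, so that only the difference of the two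
        statistics matters; the linear statistic itself need not converge in probability.\<close>
      have "?W (fst p) (snd p) = iexp (a \<bullet> ?L (fst p) (snd p)) * (iexp (a \<bullet> (?T (fst p) (snd p) - ?L (fst p) (snd p))) - 1)"
        by (simp add: inner_diff_right right_diff_distrib exp_add[symmetric])
      then show "cmod (?W (fst p) (snd p)) \<le> cmod (iexp (a \<bullet> (?T (fst p) (snd p) - ?L (fst p) (snd p))) - 1)"
        by (simp add: norm_mult)
    qed
  qed
  moreover have "\<forall>\<^sub>F n in sequentially. expectation (?W n) =
      (CLINT \<omega>|M. iexp (a \<bullet> ?T n \<omega>)) - (CLINT \<omega>|M. iexp (a \<bullet> ?L n \<omega>))"
    using eventually_gt_at_top[of "CARD('m)"]
  proof eventually_elim
    case (elim n)
    show ?case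
      by (rule Bochner_Integration.integral_diff)
        (auto intro!: integrable_const_bound[of _ 1] im Lm normalised_error_measurable elim)
  qed
  ultimately have "(\<lambda>n. (CLINT \<omega>|M. iexp (a \<bullet> ?T n \<omega>)) - (CLINT \<omega>|M. iexp (a \<bullet> ?L n \<omega>))) \<longlonglongrightarrow> 0"
    by (rule Lim_transform_eventually)
  from Lim_transform[OF linear_error_char this] show ?thesis .
qed

theorem normalised_error_asymptotic_normality:
  "\<exists>N. matrix_normal N 0 (kronecker (C ** matrix_inv R ** transpose C)
      (D ** matrix_inv (transpose Z ** matrix_inv \<Sigma> ** Z) ** transpose D)) \<and>
    converges_in_distribution M normalised_error N"
proof -
  have "pos_def (matrix_inv R)" "pos_def (matrix_inv (transpose Z ** matrix_inv \<Sigma> ** Z))"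
    by (intro pos_def_matrix_inv pos_def_congruence pos_def_R pos_def_\<Sigma> rank_Z)+
  then obtain N where N: "matrix_normal N 0 (kronecker (C ** matrix_inv R ** transpose C)
      (D ** matrix_inv (transpose Z ** matrix_inv \<Sigma> ** Z) ** transpose D))"
    and ch: "\<And>a. vchar N a = complex_of_real (exp (- (a \<bullet> ((C ** matrix_inv R ** transpose C) ** a **
      (D ** matrix_inv (transpose Z ** matrix_inv \<Sigma> ** Z) ** transpose D))) / 2))"
    by (rule exists_matrix_normal[where C = C and D = D]) blast
  \<comment> \<open>The continuity theorem asks for a probability law at every index, whereas
    measurability is known only for large n; the initial terms are replaced by 0, which does not
    affect limits.\<close>
  define T where "T n = (if n > CARD('m) then normalised_error n else (\<lambda>_. 0))" for n
  have T: "T n \<in> borel_measurable M" for n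
    by (simp add: T_def normalised_error_measurable)
  have ev: "\<forall>\<^sub>F n in sequentially. T n = normalised_error n"
    using eventually_gt_at_top[of "CARD('m)"] by eventually_elim (simp add: T_def)
  define \<nu> where "\<nu> n = distr M borel (T n)" for n
  have \<nu>: "prob_space (\<nu> n)" "sets (\<nu> n) = sets borel" for n
    unfolding \<nu>_def by (auto intro: prob_space_distr T)
  have vch: "(\<lambda>n. vchar (\<nu> n) a) \<longlonglongrightarrow> vchar N a" for a
    unfolding ch
  proof (rule Lim_transform_eventually[OF normalised_error_char])
    show "\<forall>\<^sub>F n in sequentially. (CLINT \<omega>|M. iexp (a \<bullet> normalised_error n \<omega>)) = vchar (\<nu> n) a"
      using ev
    proof eventually_elim
      case (elim n)
      then show ?case unfolding \<nu>_def vchar_def using T[of n] by (subst integral_distr) auto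
    qed
  qed
  have "(\<lambda>n. \<integral>\<omega>. f (normalised_error n \<omega>) \<partial>M) \<longlonglongrightarrow> (\<integral>x. f x \<partial>N)"
    if f: "continuous_on UNIV f" "bounded (range f)" for f :: "real^'t^'s \<Rightarrow> real"
  proof -
    have N': "prob_space N" "sets N = sets borel" using N by (auto simp: matrix_normal_def)
    have "(\<lambda>n. \<integral>x. f x \<partial>\<nu> n) \<longlonglongrightarrow> (\<integral>x. f x \<partial>N)"
      by (rule vchar_conv_imp_expectation_conv[OF \<nu> N' vch f])
    moreover have "\<forall>\<^sub>F n in sequentially. (\<integral>x. f x \<partial>\<nu> n) = (\<integral>\<omega>. f (normalised_error n \<omega>) \<partial>M)"
      using ev
    proof eventually_elim
      case (elim n)
      have "f \<in> borel_measurable borel" using f(1) by (rule borel_measurable_continuous_onI)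
      then show ?case using elim T[of n] unfolding \<nu>_def by (subst integral_distr) auto
    qed
    ultimately show ?thesis by (rule Lim_transform_eventually)
  qed
  moreover have "\<forall>\<^sub>F n in sequentially. normalised_error n \<in> borel_measurable M"
    using eventually_gt_at_top[of "CARD('m)"] by eventually_elim (rule normalised_error_measurable)
  ultimately have "converges_in_distribution M normalised_error N"
    unfolding converges_in_distribution_def by blast
  with N show ?thesis by blast
qed

end

end

theorem theorem4p2:
  fixes M :: "'w measure"
    and X :: "nat \<Rightarrow> real^'m"
    and Z :: "real^'q^'p"
    and \<Theta> :: "real^'q^'m"
    and \<Sigma> :: "real^'p^'p"
    and F :: "(real^'p) measure"
    and \<epsilon> :: "nat \<Rightarrow> nat \<Rightarrow> 'w \<Rightarrow> real^'p"
    and Y :: "nat \<Rightarrow> 'w \<Rightarrow> nat \<Rightarrow> real^'p"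
    and R :: "real^'m^'m"
    and C :: "real^'m^'s"
    and D :: "real^'q^'t"
  assumes "prob_space M"
    and "CARD('q) < CARD('p)"
    and "\<And>n. n > CARD('m) \<Longrightarrow> rows_rank n X = CARD('m)"
    and "rank Z = CARD('q)"
    and "pos_def \<Sigma>"
    and "\<And>n. n > CARD('m) \<Longrightarrow> growth_errors M n \<epsilon> F \<Sigma>"
    and "\<And>n i \<omega>. n > CARD('m) \<Longrightarrow> i < n \<Longrightarrow> \<omega> \<in> space M \<Longrightarrow>
           Y n \<omega> i = X i v* (\<Theta> ** transpose Z) + \<epsilon> n i \<omega>"
    and "\<forall>\<^sub>F n in sequentially. AE \<omega> in M. pos_def (Sigma_hat n X (Y n \<omega>))"
    and "pos_def R"
    and "(\<lambda>n. (1 / real n) *\<^sub>R tmult n X X) \<longlonglongrightarrow> R"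
  shows "\<exists>N. matrix_normal N 0
            (kronecker (C ** matrix_inv R ** transpose C)
               (D ** matrix_inv (transpose Z ** matrix_inv \<Sigma> ** Z) ** transpose D)) \<and>
          converges_in_distribution M
            (\<lambda>n \<omega>. sqrt (real n) *\<^sub>R (gamma_hat C D Z n X (Y n \<omega>) - C ** \<Theta> ** transpose D)) N"
proof -
  interpret growth_curve M X Z \<Theta> \<Sigma> F \<epsilon> Y R
    by (intro growth_curve.intro growth_curve_axioms.intro) (use assms in auto)
  show ?thesis
    using normalised_error_asymptotic_normality[of C D] unfolding normalised_error_def[abs_def] .
qed

end
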